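(* Let $v\in V$. The space $\mathcal D(\Omega,v)$ is a $\Gamma$-submodule of $\Gamma^*$, and for each $\gamma\in\Gamma$ and each $\sigma\in W$, $$\gamma\cdot\mathcal D_\sigma^v=\gamma(v)\,\mathcal D_\sigma^v+\sum_{\tau<\sigma}\mathfrak D_{\tau,\sigma}^v(\gamma)\,\mathcal D_\tau^v,$$ where the sum runs over $\tau\in W$ strictly smaller than $\sigma$ in the Bruhat order of $W$.
   Context: Setting. $V=\mathbb C\otimes_{\mathbb R}V_{\mathbb R}$ is the complexification of a finite-dimensional Euclidean space, with the complex bilinear extension $(-,-)$ of the inner product, which is used to identify $V$ with $V^*$. $\Lambda$ is the algebra of polynomial functions on $V$, graded with $\Lambda_1=V^*$. A finite root system is a finite set $\Phi\subset V_{\mathbb R}^*$ of nonzero elements with $\Phi\cap\mathbb C\alpha=\{\pm\alpha\}$ and $s_\alpha^*(\Phi)\subset\Phi$ for all $\alpha\in\Phi$, where $s_\alpha$ is the orthogonal reflection through $\ker\alpha$ (it need not be crystallographic nor span $V^*$). Fix a root system $\Phi$ and a root subsystem $\Psi\subset\Phi$ with base (simple system) $\Omega$ and positive roots $\Psi^+$; let $G=W(\Phi)$ and $W=W(\Psi)\subset G$ be the groups generated by the reflections in $\Phi$ and $\Psi$. Groups act on functions by $(\sigma f)(x)=f(\sigma^{-1}x)$. Put $\Gamma=\Lambda^G$. Lengths $\ell$, simple reflections and Bruhat order in $W$ are with respect to $\Omega$; $\omega_0$ is the longest element of $W$. The Bruhat order is the transitive closure of: $\tau\preceq\sigma$ if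 $\sigma=\tau s_\alpha$ for some $\alpha\in\Psi$ and $\ell(\sigma)=\ell(\tau)+1$. Divided differences: $\nabla_s=\frac1{\alpha_s}(1-s)$ for a simple reflection $s$ with simple root $\alpha_s$, and $\partial_\sigma=\nabla_{s_1}\circ\cdots\circ\nabla_{s_\ell}$ for a reduced decomposition $\sigma=s_1\cdots s_\ell$. Schubert polynomials: $\mathfrak S_\sigma=\frac1{|W|}\partial_{\sigma^{-1}\omega_0}\big(\prod_{\alpha\in\Psi^+}\alpha\big)$. Let $I_W\subset\Lambda$ be the ideal generated by the elements of positive degree in $\Lambda^W$; the $\mathfrak S_\sigma$ ($\sigma \in W$) form a basis of $\Lambda/I_W$, and $c^\rho_{\sigma,\tau}\in\mathbb C$ are defined by $\mathfrak S_\sigma\mathfrak S_\tau\equiv\sum_\rho c^\rho_{\sigma,\tau}\mathfrak S_\rho \bmod I_W$. Postnikov–Stanley operators: let $\Theta$ be the algebra morphism from $\Lambda$ to constant-coefficient differential operators on $\Lambda$ such that, for $\alpha\in V^*$, $\Theta(\alpha)$ is the derivation with $\Theta(\alpha)(\beta)=(\beta,\alpha)$ for $\beta\in V^*$. Let $(f,g)_\Theta=\Theta(f)(g)(0)$ and $\mathcal H_{I_W}=\{g\in\Lambda:(f,g)_\Theta=0\ \forall f\in I_W\}$. $P_\sigma$ is the unique element of $\mathcal H_{I_W}$ with $(P_\sigma,\mathfrak S_\tau)_\Theta=\delta_{\sigma,\tau}$ for all $\tau\in W$. Put $\mathfrak D_\sigma=\Theta(P_\sigma)$ and, for $\tau\le\sigma$,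 $\mathfrak D_{\tau,\sigma}=\sum_{\rho\in W}c^\sigma_{\tau,\rho}\mathfrak D_\rho$. A superscript $0$ means applying the operator and then evaluating at $0$; for $v\in V$, $\mathfrak D_\sigma^v=\mathfrak D_\sigma^0\circ t_v$ and $\mathfrak D_{\tau,\sigma}^v=\mathfrak D_{\tau,\sigma}^0\circ t_v$, where $t_v(f)(x)=f(x+v)$. Let $\mathcal D_\sigma^v=\mathfrak D_\sigma^v|_\Gamma\in\Gamma^*=\mathrm{Hom}_{\mathbb C}(\Gamma,\mathbb C)$ and let $\mathcal D(\Omega,v)\subset\Gamma^*$ be the span of $\{\mathcal D_\sigma^v:\sigma\in W\}$. $\Gamma$ acts on $\Gamma^*$ by $(\gamma\cdot\chi)(g)=\chi(\gamma g)$. *)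

theory Defs
  imports "HOL-Analysis.Analysis" "HOL-Library.Function_Algebras"
begin

section \<open>The complexification of a Euclidean space\<close>

text \<open>
  A pair \<open>(x, y)\<close> of vectors of the Euclidean space \<open>'a\<close> stands for \<open>x + \<i> y\<close> in the
  complexification. \<open>cscale\<close> is its complex scalar multiplication and \<open>cform\<close> the complex bilinear
  (not sesquilinear) extension of the inner product.
\<close>

type_synonym 'a cplx = "'a \<times> 'a"

definition cscale :: "complex \<Rightarrow> 'a::real_inner cplx \<Rightarrow> 'a cplx" where
  "cscale c z = (Re c *\<^sub>R fst z - Im c *\<^sub>R snd z, Re c *\<^sub>R snd z + Im c *\<^sub>R fst z)"

definition cform :: "'a::real_inner cplx \<Rightarrow> 'a cplx \<Rightarrow> complex" where
  "cform z w = Complex (fst z \<bullet> fst w - snd z \<bullet> snd w) (fst z \<bullet> snd w + snd z \<bullet> fst w)"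

text \<open>
  \<open>real_inner\<close> with this condition, rather than \<open>euclidean_space\<close>, also admits the zero space.
\<close>

definition finite_dimensional :: "'a::real_vector itself \<Rightarrow> bool" where
  "finite_dimensional _ \<longleftrightarrow> (\<exists>B::'a set. finite B \<and> span B = UNIV)"

section \<open>Polynomial functions\<close>

text \<open>
  Sums and products of functions are pointwise, so that the complex-valued functions form a
  commutative ring; multiplication by a scalar \<open>c\<close> is multiplication by the constant
  function \<open>\<lambda>_. c\<close>.
\<close>

inductive_set poly_fun :: "('a::real_inner cplx \<Rightarrow> complex) set" where
  const: "(\<lambda>_. c) \<in> poly_fun"
| linear: "Vector_Spaces.linear cscale (*) f \<Longrightarrow> f \<in> poly_fun"
| add: "f \<in> poly_fun \<Longrightarrow> g \<in> poly_fun \<Longrightarrow> f + g \<in> poly_fun"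
| mult: "f \<in> poly_fun \<Longrightarrow> g \<in> poly_fun \<Longrightarrow> f * g \<in> poly_fun"

definition homogeneous :: "nat \<Rightarrow> ('a::real_inner cplx \<Rightarrow> complex) \<Rightarrow> bool" where
  "homogeneous d f \<longleftrightarrow> f \<in> poly_fun \<and> (\<forall>c x. f (cscale c x) = c ^ d * f x)"

inductive_set ideal_generated ::
  "('a::real_inner cplx \<Rightarrow> complex) set \<Rightarrow> ('a cplx \<Rightarrow> complex) set" for S where
  zero: "0 \<in> ideal_generated S"
| add: "a \<in> poly_fun \<Longrightarrow> g \<in> S \<Longrightarrow> h \<in> ideal_generated S \<Longrightarrow> a * g + h \<in> ideal_generated S"

section \<open>Root systems and reflection groups\<close>

text \<open>
  A root is given by the real vector \<open>\<alpha>\<close> that represents it under the identification of a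
  Euclidean space with its dual; as a linear function on the complexification it is
  \<open>root_fun \<alpha>\<close>.
\<close>

definition root_fun :: "'a::real_inner \<Rightarrow> 'a cplx \<Rightarrow> complex" where
  "root_fun \<alpha> = cform (\<alpha>, 0)"

definition refl_along :: "'a::real_inner \<Rightarrow> 'a \<Rightarrow> 'a" where
  "refl_along \<alpha> x = x - (2 * (\<alpha> \<bullet> x) / (\<alpha> \<bullet> \<alpha>)) *\<^sub>R \<alpha>"

definition root_system :: "'a::real_inner set \<Rightarrow> bool" where
  "root_system \<Phi> \<longleftrightarrow> finite \<Phi> \<and> 0 \<notin> \<Phi>
     \<and> (\<forall>\<alpha>\<in>\<Phi>. {\<beta>\<in>\<Phi>. \<exists>c. (\<beta>, 0) = cscale c (\<alpha>, 0)} = {\<alpha>, - \<alpha>})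
     \<and> (\<forall>\<alpha>\<in>\<Phi>. refl_along \<alpha> ` \<Phi> \<subseteq> \<Phi>)"

definition positive_roots :: "'a::real_inner set \<Rightarrow> 'a set \<Rightarrow> 'a set" where
  "positive_roots \<Psi> \<Omega> = {\<alpha>\<in>\<Psi>. \<exists>c. (\<forall>\<omega>\<in>\<Omega>. c \<omega> \<ge> 0) \<and> \<alpha> = (\<Sum>\<omega>\<in>\<Omega>. c \<omega> *\<^sub>R \<omega>)}"

definition is_base :: "'a::real_inner set \<Rightarrow> 'a set \<Rightarrow> bool" where
  "is_base \<Psi> \<Omega> \<longleftrightarrow> \<Omega> \<subseteq> \<Psi> \<and> independent \<Omega>
     \<and> (\<forall>\<alpha>\<in>\<Psi>. \<alpha> \<in> positive_roots \<Psi> \<Omega> \<or> - \<alpha> \<in> positive_roots \<Psi> \<Omega>)"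

text \<open>
  The group generated by the reflections, as a set of maps of the real space. Closure under
  inverses is automatic because reflections are involutions.
\<close>

inductive_set weyl_group :: "'a::real_inner set \<Rightarrow> ('a \<Rightarrow> 'a) set" for \<Phi> where
  id: "id \<in> weyl_group \<Phi>"
| refl: "\<alpha> \<in> \<Phi> \<Longrightarrow> \<sigma> \<in> weyl_group \<Phi> \<Longrightarrow> refl_along \<alpha> \<circ> \<sigma> \<in> weyl_group \<Phi>"

text \<open>
  \<open>map_prod (inv \<sigma>) (inv \<sigma>)\<close> is the complex-linear extension of \<open>\<sigma>\<inverse>\<close>.
\<close>

definition act :: "('a::real_inner \<Rightarrow> 'a) \<Rightarrow> ('a cplx \<Rightarrow> complex) \<Rightarrow> 'a cplx \<Rightarrow> complex" where
  "act \<sigma> f = f \<circ> map_prod (inv \<sigma>) (inv \<sigma>)"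

definition invariants :: "'a::real_inner set \<Rightarrow> ('a cplx \<Rightarrow> complex) set" where
  "invariants \<Phi> = {f \<in> poly_fun. \<forall>\<sigma>\<in>weyl_group \<Phi>. act \<sigma> f = f}"

definition invariant_ideal :: "'a::real_inner set \<Rightarrow> ('a cplx \<Rightarrow> complex) set" where
  "invariant_ideal \<Psi> = ideal_generated {f \<in> invariants \<Psi>. \<exists>d>0. homogeneous d f}"

text \<open>
  Words in the simple reflections are lists of simple roots.
\<close>

definition word_prod :: "'a::real_inner list \<Rightarrow> 'a \<Rightarrow> 'a" where
  "word_prod \<alpha>s = foldr (\<lambda>\<alpha> \<tau>. refl_along \<alpha> \<circ> \<tau>) \<alpha>s id"

definition len :: "'a::real_inner set \<Rightarrow> ('a \<Rightarrow> 'a) \<Rightarrow> nat" where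
  "len \<Omega> \<sigma> = (LEAST n. \<exists>\<alpha>s. set \<alpha>s \<subseteq> \<Omega> \<and> length \<alpha>s = n \<and> word_prod \<alpha>s = \<sigma>)"

definition reduced_word :: "'a::real_inner set \<Rightarrow> ('a \<Rightarrow> 'a) \<Rightarrow> 'a list \<Rightarrow> bool" where
  "reduced_word \<Omega> \<sigma> \<alpha>s \<longleftrightarrow> set \<alpha>s \<subseteq> \<Omega> \<and> length \<alpha>s = len \<Omega> \<sigma> \<and> word_prod \<alpha>s = \<sigma>"

definition longest :: "'a::real_inner set \<Rightarrow> 'a set \<Rightarrow> 'a \<Rightarrow> 'a" where
  "longest \<Psi> \<Omega> = (THE \<omega>. \<omega> \<in> weyl_group \<Psi> \<and> (\<forall>\<sigma>\<in>weyl_group \<Psi>. len \<Omega> \<sigma> \<le> len \<Omega> \<omega>))"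

definition bruhat_cover :: "'a::real_inner set \<Rightarrow> 'a set \<Rightarrow> ('a \<Rightarrow> 'a) \<Rightarrow> ('a \<Rightarrow> 'a) \<Rightarrow> bool" where
  "bruhat_cover \<Psi> \<Omega> \<tau> \<sigma> \<longleftrightarrow> \<tau> \<in> weyl_group \<Psi> \<and> \<sigma> \<in> weyl_group \<Psi>
     \<and> (\<exists>\<alpha>\<in>\<Psi>. \<sigma> = \<tau> \<circ> refl_along \<alpha>) \<and> len \<Omega> \<sigma> = len \<Omega> \<tau> + 1"

text \<open>Lengths increase along covers, so the transitive closure is the strict Bruhat order.\<close>

definition bruhat_less :: "'a::real_inner set \<Rightarrow> 'a set \<Rightarrow> ('a \<Rightarrow> 'a) \<Rightarrow> ('a \<Rightarrow> 'a) \<Rightarrow> bool" where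
  "bruhat_less \<Psi> \<Omega> = (bruhat_cover \<Psi> \<Omega>)\<^sup>+\<^sup>+"

section \<open>Divided differences and Schubert polynomials\<close>

text \<open>The quotient of \<open>f - s f\<close> by \<open>\<alpha>\<close>, for a reflection \<open>s\<close> with root \<open>\<alpha>\<close>, is taken in the
  ring of polynomial functions.\<close>

definition nabla ::
  "'a::real_inner \<Rightarrow> ('a cplx \<Rightarrow> complex) \<Rightarrow> 'a cplx \<Rightarrow> complex" where
  "nabla \<alpha> f = (THE q. q \<in> poly_fun \<and> f - act (refl_along \<alpha>) f = root_fun \<alpha> * q)"

text \<open>The operator does not depend on the reduced word, so any one of them may be chosen.\<close>

definition div_diff ::
  "'a::real_inner set \<Rightarrow> ('a \<Rightarrow> 'a) \<Rightarrow> ('a cplx \<Rightarrow> complex) \<Rightarrow> 'a cplx \<Rightarrow> complex" where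
  "div_diff \<Omega> \<sigma> = foldr (\<lambda>\<alpha> D. nabla \<alpha> \<circ> D) (SOME \<alpha>s. reduced_word \<Omega> \<sigma> \<alpha>s) id"

definition schubert ::
  "'a::real_inner set \<Rightarrow> 'a set \<Rightarrow> ('a \<Rightarrow> 'a) \<Rightarrow> 'a cplx \<Rightarrow> complex" where
  "schubert \<Psi> \<Omega> \<sigma> = (\<lambda>_. 1 / of_nat (card (weyl_group \<Psi>)))
     * div_diff \<Omega> (inv \<sigma> \<circ> longest \<Psi> \<Omega>) (\<Prod>\<alpha>\<in>positive_roots \<Psi> \<Omega>. root_fun \<alpha>)"

text \<open>\<open>struct_const \<Psi> \<Omega> \<sigma> \<tau> \<rho>\<close> is the coefficient at \<open>\<rho>\<close> of the product of the Schubert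
  polynomials of \<open>\<sigma>\<close> and \<open>\<tau>\<close>; requiring the value 0 off the group makes the function unique.\<close>

definition struct_const ::
  "'a::real_inner set \<Rightarrow> 'a set \<Rightarrow> ('a \<Rightarrow> 'a) \<Rightarrow> ('a \<Rightarrow> 'a) \<Rightarrow> ('a \<Rightarrow> 'a) \<Rightarrow> complex" where
  "struct_const \<Psi> \<Omega> \<sigma> \<tau> = (THE c. (\<forall>\<rho>. \<rho> \<notin> weyl_group \<Psi> \<longrightarrow> c \<rho> = 0) \<and>
     schubert \<Psi> \<Omega> \<sigma> * schubert \<Psi> \<Omega> \<tau> - (\<Sum>\<rho>\<in>weyl_group \<Psi>. (\<lambda>_. c \<rho>) * schubert \<Psi> \<Omega> \<rho>)
       \<in> invariant_ideal \<Psi>)"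

section \<open>Postnikov--Stanley operators\<close>

text \<open>
  The algebra morphism from polynomial functions to differential operators: the linear
  function \<open>cform a\<close> acts as the derivation sending \<open>cform b\<close> to the constant \<open>cform b a\<close>. As
  the linear functions generate, all values are then constant-coefficient differential
  operators. Operators act on polynomial functions only; the value 0 elsewhere makes the
  morphism unique as a total function.
\<close>

definition is_Theta ::
  "(('a::real_inner cplx \<Rightarrow> complex) \<Rightarrow> ('a cplx \<Rightarrow> complex) \<Rightarrow> ('a cplx \<Rightarrow> complex)) \<Rightarrow> bool" where
  "is_Theta T \<longleftrightarrow>
     (\<forall>f g. f \<notin> poly_fun \<or> g \<notin> poly_fun \<longrightarrow> T f g = 0)
   \<and> (\<forall>f\<in>poly_fun. \<forall>g\<in>poly_fun. T f g \<in> poly_fun)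
   \<and> (\<forall>f\<in>poly_fun. \<forall>g\<in>poly_fun. \<forall>h\<in>poly_fun. T f (g + h) = T f g + T f h)
   \<and> (\<forall>f\<in>poly_fun. \<forall>g\<in>poly_fun. \<forall>c. T f ((\<lambda>_. c) * g) = (\<lambda>_. c) * T f g)
   \<and> (\<forall>g\<in>poly_fun. T 1 g = g)
   \<and> (\<forall>f\<in>poly_fun. \<forall>g\<in>poly_fun. \<forall>h\<in>poly_fun. T (f + g) h = T f h + T g h)
   \<and> (\<forall>f\<in>poly_fun. \<forall>h\<in>poly_fun. \<forall>c. T ((\<lambda>_. c) * f) h = (\<lambda>_. c) * T f h)
   \<and> (\<forall>f\<in>poly_fun. \<forall>g\<in>poly_fun. \<forall>h\<in>poly_fun. T (f * g) h = T f (T g h))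
   \<and> (\<forall>a. \<forall>g\<in>poly_fun. \<forall>h\<in>poly_fun.
        T (cform a) (g * h) = T (cform a) g * h + g * T (cform a) h)
   \<and> (\<forall>a b. T (cform a) (cform b) = (\<lambda>_. cform b a))"

definition Theta ::
  "('a::real_inner cplx \<Rightarrow> complex) \<Rightarrow> ('a cplx \<Rightarrow> complex) \<Rightarrow> ('a cplx \<Rightarrow> complex)" where
  "Theta = (THE T. is_Theta T)"

definition theta_form ::
  "('a::real_inner cplx \<Rightarrow> complex) \<Rightarrow> ('a cplx \<Rightarrow> complex) \<Rightarrow> complex" where
  "theta_form f g = Theta f g 0"

definition harmonics :: "'a::real_inner set \<Rightarrow> ('a cplx \<Rightarrow> complex) set" where
  "harmonics \<Psi> = {g \<in> poly_fun. \<forall>f\<in>invariant_ideal \<Psi>. theta_form f g = 0}"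

definition dual_poly ::
  "'a::real_inner set \<Rightarrow> 'a set \<Rightarrow> ('a \<Rightarrow> 'a) \<Rightarrow> 'a cplx \<Rightarrow> complex" where
  "dual_poly \<Psi> \<Omega> \<sigma> = (THE p. p \<in> harmonics \<Psi> \<and>
     (\<forall>\<tau>\<in>weyl_group \<Psi>. theta_form p (schubert \<Psi> \<Omega> \<tau>) = (if \<sigma> = \<tau> then 1 else 0)))"

definition PS_op ::
  "'a::real_inner set \<Rightarrow> 'a set \<Rightarrow> ('a \<Rightarrow> 'a) \<Rightarrow> ('a cplx \<Rightarrow> complex) \<Rightarrow> ('a cplx \<Rightarrow> complex)" where
  "PS_op \<Psi> \<Omega> \<sigma> = Theta (dual_poly \<Psi> \<Omega> \<sigma>)"

definition PS_skew_op ::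
  "'a::real_inner set \<Rightarrow> 'a set \<Rightarrow> ('a \<Rightarrow> 'a) \<Rightarrow> ('a \<Rightarrow> 'a)
     \<Rightarrow> ('a cplx \<Rightarrow> complex) \<Rightarrow> ('a cplx \<Rightarrow> complex)" where
  "PS_skew_op \<Psi> \<Omega> \<tau> \<sigma> f =
     (\<Sum>\<rho>\<in>weyl_group \<Psi>. (\<lambda>_. struct_const \<Psi> \<Omega> \<tau> \<rho> \<sigma>) * PS_op \<Psi> \<Omega> \<rho> f)"

definition translate ::
  "'a::real_inner cplx \<Rightarrow> ('a cplx \<Rightarrow> complex) \<Rightarrow> 'a cplx \<Rightarrow> complex" where
  "translate v f = (\<lambda>x. f (x + v))"

definition PS_at ::
  "'a::real_inner set \<Rightarrow> 'a set \<Rightarrow> 'a cplx \<Rightarrow> ('a \<Rightarrow> 'a) \<Rightarrow> ('a cplx \<Rightarrow> complex) \<Rightarrow> complex" where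
  "PS_at \<Psi> \<Omega> v \<sigma> f = PS_op \<Psi> \<Omega> \<sigma> (translate v f) 0"

definition PS_skew_at ::
  "'a::real_inner set \<Rightarrow> 'a set \<Rightarrow> 'a cplx \<Rightarrow> ('a \<Rightarrow> 'a) \<Rightarrow> ('a \<Rightarrow> 'a)
     \<Rightarrow> ('a cplx \<Rightarrow> complex) \<Rightarrow> complex" where
  "PS_skew_at \<Psi> \<Omega> v \<tau> \<sigma> f = PS_skew_op \<Psi> \<Omega> \<tau> \<sigma> (translate v f) 0"

section \<open>The dual of the invariant ring\<close>

text \<open>Functionals on the invariant ring are extended by 0 to all functions.\<close>

definition inv_dual :: "'a::real_inner set \<Rightarrow> (('a cplx \<Rightarrow> complex) \<Rightarrow> complex) set" where
  "inv_dual \<Phi> = {\<xi>. (\<forall>f\<in>invariants \<Phi>. \<forall>g\<in>invariants \<Phi>. \<xi> (f + g) = \<xi> f + \<xi> g)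
     \<and> (\<forall>f\<in>invariants \<Phi>. \<forall>c. \<xi> ((\<lambda>_. c) * f) = c * \<xi> f)
     \<and> (\<forall>f. f \<notin> invariants \<Phi> \<longrightarrow> \<xi> f = 0)}"

definition dual_act :: "'a::real_inner set \<Rightarrow> ('a cplx \<Rightarrow> complex)
     \<Rightarrow> (('a cplx \<Rightarrow> complex) \<Rightarrow> complex) \<Rightarrow> ('a cplx \<Rightarrow> complex) \<Rightarrow> complex" where
  "dual_act \<Phi> \<gamma> \<xi> g = (if g \<in> invariants \<Phi> then \<xi> (\<gamma> * g) else 0)"

definition is_inv_submodule ::
  "'a::real_inner set \<Rightarrow> (('a cplx \<Rightarrow> complex) \<Rightarrow> complex) set \<Rightarrow> bool" where
  "is_inv_submodule \<Phi> M \<longleftrightarrow> M \<subseteq> inv_dual \<Phi> \<and> 0 \<in> M \<and> (\<forall>\<xi>\<in>M. \<forall>\<eta>\<in>M. \<xi> + \<eta> \<in> M)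
     \<and> (\<forall>\<gamma>\<in>invariants \<Phi>. \<forall>\<xi>\<in>M. dual_act \<Phi> \<gamma> \<xi> \<in> M)"

definition PS_fun :: "'a::real_inner set \<Rightarrow> 'a set \<Rightarrow> 'a set \<Rightarrow> 'a cplx \<Rightarrow> ('a \<Rightarrow> 'a)
     \<Rightarrow> ('a cplx \<Rightarrow> complex) \<Rightarrow> complex" where
  "PS_fun \<Phi> \<Psi> \<Omega> v \<sigma> g = (if g \<in> invariants \<Phi> then PS_at \<Psi> \<Omega> v \<sigma> g else 0)"

definition PS_space :: "'a::real_inner set \<Rightarrow> 'a set \<Rightarrow> 'a set \<Rightarrow> 'a cplx
     \<Rightarrow> (('a cplx \<Rightarrow> complex) \<Rightarrow> complex) set" where
  "PS_space \<Phi> \<Psi> \<Omega> v =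
     {\<xi>. \<exists>a. \<xi> = (\<Sum>\<sigma>\<in>weyl_group \<Psi>. (\<lambda>_. a \<sigma>) * PS_fun \<Phi> \<Psi> \<Omega> v \<sigma>)}"

end

theory Submission
  imports Defs
begin

text \<open>
  Let \<open>eps w f\<close> be the value at the origin of the divided difference of \<open>f\<close> along \<open>w\<close>. Divided
  differences are linear over the invariants of \<open>W\<close>, so \<open>eps w\<close> vanishes on the ideal \<open>I\<^sub>W\<close>; up to a
  nonzero factor the \<open>eps w\<close> are dual to the Schubert polynomials, and conversely a homogeneous
  polynomial killed by all of them lies in \<open>I\<^sub>W\<close>: by induction on the degree, \<open>f - w f \<in> I\<^sub>W\<close> for
  all \<open>w\<close>, and one averages. Hence \<open>P\<^sub>w\<close> represents \<open>eps w\<close> for the pairing \<open>(-,-)\<^sub>\<Theta>\<close>, and the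
  expansion of \<open>g\<close> in Schubert polynomials gives
  \<open>eps w (f g) = \<Sum>\<^sub>u eps w (f \<SS>\<^sub>u) eps u g\<close>.

  For a linear function \<open>\<lambda>\<close>, the twisted Leibniz rule yields
  \<open>eps w (\<lambda> g) = \<Sum> (\<lambda>, \<gamma>\<^sup>\<or>) eps (w s\<^sub>\<gamma>) g\<close>, summed over the Bruhat covers \<open>w s\<^sub>\<gamma>\<close> of which \<open>w\<close> is
  the upper end. Iterating, \<open>eps w (f g) - f(0) eps w g\<close> is a combination of the \<open>eps u g\<close> with
  \<open>u < w\<close>. So \<open>eps w (f \<SS>\<^sub>u)\<close> vanishes unless \<open>u \<le> w\<close>, and for \<open>u = w\<close> it is \<open>f(0)\<close>. Translating \<open>f\<close>
  and \<open>g\<close> by \<open>v\<close> gives the theorem.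
\<close>

section \<open>Polynomial functions\<close>

text \<open>Polynomials are functions here, and \<open>Theta\<close>, \<open>nabla\<close>,
  \<open>div_diff\<close>, \<open>dual_poly\<close> and \<open>struct_const\<close> are given by
  description or choice, so each must first be shown well defined. Three points need an idea. A
  functional on all polynomials need not be represented by a polynomial through the pairing; but
  \<open>eps w\<close> lives in the single degree l(w), and within one degree Euler's identity
  produces a representing polynomial. The value of \<open>eps\<close> of the longest element on the
  product of the positive roots must be nonzero; an adjointness of divided differences trades it for
  a value on a power of a dominant linear function, which is a sum of positive terms. Finally the
  structure constants must disappear: summing them against the operators is the Schubert expansion
  read backwards, so the skew functional of \<open>u\<close> and \<open>w\<close> at the origin
  sends \<open>f\<close> to \<open>eps w (f * \<SS> u) / kappa\<close>, and the product formula
  becomes an identity about \<open>eps\<close>. Root systems may be non-crystallographic: heights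
  and pairings with coroots are only real, so inductions count roots or letters.\<close>

type_synonym 'a cfun = "'a cplx \<Rightarrow> complex"

lemma vector_space_cscale: "vector_space (cscale :: complex \<Rightarrow> 'a::real_inner cplx \<Rightarrow> _)"
  by unfold_locales (auto simp: cscale_def algebra_simps prod_eq_iff)

lemma cform_add_right: "cform a (x + y) = cform a x + cform a y"
  by (auto simp: cform_def complex_eq_iff inner_add_right)

lemma cform_cscale_right: "cform a (cscale c x) = c * cform a x"
  by (auto simp: cform_def cscale_def complex_eq_iff inner_add_right inner_diff_right algebra_simps)

lemma cform_commute: "cform a b = cform b a"
  by (auto simp: cform_def complex_eq_iff inner_commute)

lemma cform_cscale_left: "cform (cscale c a) x = c * cform a x"
  by (metis cform_commute cform_cscale_right)

lemma cform_zero_right [simp]: "cform a 0 = 0"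
  by (simp add: cform_def complex_eq_iff)

lemma linear_cform: "Vector_Spaces.linear cscale (*) (cform (a :: 'a::real_inner cplx))"
proof -
  interpret vector_space "cscale :: complex \<Rightarrow> 'a cplx \<Rightarrow> _" by (rule vector_space_cscale)
  show ?thesis
    by unfold_locales (auto simp: cform_add_right cform_cscale_right algebra_simps)
qed

lemma cscale_0 [simp]: "cscale c 0 = 0" and cscale_0_left [simp]: "cscale 0 x = 0"
  and cscale_1 [simp]: "cscale 1 x = x"
  by (simp_all add: cscale_def prod_eq_iff)

lemma cscale_add_left: "cscale (c + d) x = cscale c x + cscale d x"
  and cscale_add_right: "cscale c (x + y) = cscale c x + cscale c y"
  and cscale_cscale: "cscale c (cscale d x) = cscale (c * d) x"
  by (simp_all add: cscale_def prod_eq_iff algebra_simps)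

lemma cform_in_poly_fun [intro, simp]: "cform a \<in> poly_fun"
  by (rule poly_fun.linear[OF linear_cform])

lemma poly_fun_const [intro, simp]: "(\<lambda>_. c) \<in> poly_fun"
  by (rule poly_fun.const)

lemma poly_fun_0 [intro, simp]: "0 \<in> poly_fun" and poly_fun_1 [intro, simp]: "1 \<in> poly_fun"
  using poly_fun.const[of 0] poly_fun.const[of 1] by (simp_all add: zero_fun_def one_fun_def)

lemmas poly_fun_add [intro] = poly_fun.add and poly_fun_mult [intro] = poly_fun.mult

lemma poly_fun_uminus [intro]: "f \<in> poly_fun \<Longrightarrow> - f \<in> poly_fun"
  using poly_fun.mult[OF poly_fun.const[of "-1"], of f] by (simp add: func_times fun_Compl_def)

lemma poly_fun_diff [intro]: "f \<in> poly_fun \<Longrightarrow> g \<in> poly_fun \<Longrightarrow> f - g \<in> poly_fun"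
  using poly_fun.add[of f "- g"] poly_fun_uminus[of g] by simp

lemma poly_fun_sum [intro]: "(\<And>i. i \<in> A \<Longrightarrow> f i \<in> poly_fun) \<Longrightarrow> sum f A \<in> poly_fun"
  by (induction A rule: infinite_finite_induct) auto

lemma poly_fun_power [intro]: "f \<in> poly_fun \<Longrightarrow> f ^ n \<in> poly_fun"
  by (induction n) auto

lemma sum_fun_apply: "sum f A x = (\<Sum>i\<in>A. f i x)"
  by (induction A rule: infinite_finite_induct) auto

lemma prod_fun_apply: "prod f A x = (\<Prod>i\<in>A. f i x)"
  by (induction A rule: infinite_finite_induct) auto

lemma power_fun_apply: "(f ^ n) x = (f x :: 'b :: monoid_mult) ^ n"
  by (induction n) auto

lemma homogeneousD: "homogeneous d f \<Longrightarrow> f \<in> poly_fun"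
  "homogeneous d f \<Longrightarrow> f (cscale c x) = c ^ d * f x"
  unfolding homogeneous_def by blast+

lemma homogeneous_0 [simp]: "homogeneous d 0"
  by (auto simp: homogeneous_def)

lemma homogeneous_const: "homogeneous 0 (\<lambda>_. c)"
  by (auto simp: homogeneous_def)

lemma homogeneous_cform: "homogeneous 1 (cform a)"
  by (auto simp: homogeneous_def cform_cscale_right)

lemma homogeneous_add: "homogeneous d f \<Longrightarrow> homogeneous d g \<Longrightarrow> homogeneous d (f + g)"
  by (auto simp: homogeneous_def algebra_simps)

lemma homogeneous_mult: "homogeneous d f \<Longrightarrow> homogeneous e g \<Longrightarrow> homogeneous (d + e) (f * g)"
  by (auto simp: homogeneous_def power_add)

lemma homogeneous_scale: "homogeneous d f \<Longrightarrow> homogeneous d ((\<lambda>_. c) * f)"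
  using homogeneous_mult[OF homogeneous_const] by fastforce

lemma homogeneous_diff: "homogeneous d f \<Longrightarrow> homogeneous d g \<Longrightarrow> homogeneous d (f - g)"
  by (auto simp: homogeneous_def algebra_simps)

lemma homogeneous_sum: "(\<And>i. i \<in> A \<Longrightarrow> homogeneous d (f i)) \<Longrightarrow> homogeneous d (sum f A)"
  by (induction A rule: infinite_finite_induct) (auto intro: homogeneous_add)

lemma homogeneous_power: "homogeneous d f \<Longrightarrow> homogeneous (n * d) (f ^ n)"
  by (induction n) (auto simp: one_fun_def intro: homogeneous_mult homogeneous_const)

lemma homogeneous_at_0: "homogeneous d f \<Longrightarrow> d > 0 \<Longrightarrow> f 0 = 0"
  using homogeneousD(2)[of d f 0 0] by (simp add: zero_power)

lemma homogeneous_degree_0: "homogeneous 0 f \<Longrightarrow> f = (\<lambda>_. f 0)"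
  using homogeneousD(2)[of 0 f 0] by (auto simp: fun_eq_iff)

locale finite_dimensional_inner =
  fixes ty :: "'a::real_inner itself"
  assumes fin_dim: "finite_dimensional TYPE('a)"
begin

text \<open>\<open>basis_orthogonal\<close> may return \<open>0\<close> among its vectors, so it is
  removed before normalising. An empty \<open>E\<close> is allowed, which covers the zero
  space.\<close>

lemma orthonormal_basis_exists:
  "\<exists>E::'a set. finite E \<and> (\<forall>x. x = (\<Sum>e\<in>E. (x \<bullet> e) *\<^sub>R e))"
proof -
  obtain B :: "'a set" where B: "finite B" "span B = UNIV"
    using fin_dim by (auto simp: finite_dimensional_def)
  obtain C :: "'a set" where C: "finite C" "span C = UNIV" "pairwise orthogonal C"
    using basis_orthogonal[OF B(1)] unfolding B(2) by metis
  define E where "E = (\<lambda>c. c /\<^sub>R norm c) ` (C - {0})"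
  have finE: "finite E" using C by (simp add: E_def)
  have orth: "e \<bullet> e' = (if e = e' then 1 else 0)" if "e \<in> E" "e' \<in> E" for e e'
  proof -
    from that obtain c c' where c: "c \<in> C" "c \<noteq> 0" "e = c /\<^sub>R norm c"
      "c' \<in> C" "c' \<noteq> 0" "e' = c' /\<^sub>R norm c'"
      by (auto simp: E_def)
    have "e \<bullet> e' = 0" if "c \<noteq> c'"
      using C(3) c that by (auto simp: pairwise_def orthogonal_def)
    moreover have "e \<bullet> e = 1" using c
      by (simp add: dot_square_norm power2_eq_square field_simps)
    ultimately show ?thesis using c(3,6) by metis
  qed
  have "C \<subseteq> span E"
  proof
    fix c assume "c \<in> C"
    show "c \<in> span E"
    proof (cases "c = 0")
      case False
      then have "c /\<^sub>R norm c \<in> E" using \<open>c \<in> C\<close> by (auto simp: E_def)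
      then have "norm c *\<^sub>R (c /\<^sub>R norm c) \<in> span E" by (intro span_scale span_base)
      then show ?thesis using False by simp
    qed (simp add: span_zero)
  qed
  then have "span E = UNIV" using C(2) by (metis span_minimal subspace_span top.extremum_uniqueI)
  have "x = (\<Sum>e\<in>E. (x \<bullet> e) *\<^sub>R e)" for x
  proof -
    have "x \<in> span E" using \<open>span E = UNIV\<close> by simp
    then obtain u where u: "x = (\<Sum>e\<in>E. u e *\<^sub>R e)"
      using span_finite[OF finE] by auto
    have "x \<bullet> e = u e" if "e \<in> E" for e
      using that finE unfolding u by (simp add: inner_sum_left orth if_distrib sum.delta cong: if_cong)
    then show ?thesis using u by simp
  qed
  then show ?thesis using finE by blast
qed

lemma real_functional_inner:
  assumes "linear (f :: 'a \<Rightarrow> real)"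
  shows "\<exists>a. \<forall>x. f x = a \<bullet> x"
proof -
  obtain E :: "'a set" where E: "finite E" "\<And>x. x = (\<Sum>e\<in>E. (x \<bullet> e) *\<^sub>R e)"
    using orthonormal_basis_exists by auto
  have "f x = (\<Sum>e\<in>E. f e *\<^sub>R e) \<bullet> x" for x
    by (subst E(2)[of x]) (simp add: linear_sum[OF assms] linear_cmul[OF assms] inner_sum_left
        inner_commute inner_sum_right mult.commute)
  then show ?thesis by blast
qed

text \<open>On real vectors the real and imaginary parts of \<open>f\<close> are inner products with
  some \<open>a\<close> and \<open>b\<close>. Complex linearity then forces the representing vector
  \<open>(a, b)\<close>, without conjugation because \<open>cform\<close> is bilinear.\<close>

lemma complex_functional_cform:
  assumes "Vector_Spaces.linear cscale (*) (f :: 'a cfun)"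
  shows "\<exists>a. f = cform a"
proof -
  interpret f: Vector_Spaces.linear cscale "(*)" f by fact
  have *: "f (r *\<^sub>R x, 0) = r * f (x, 0)" for r x
    using f.scale[of "of_real r" "(x,0)"] by (simp add: cscale_def)
  have add: "f (x + y, 0) = f (x, 0) + f (y, 0)" for x y
    using f.add[of "(x,0)" "(y,0)"] by simp
  have lin: "linear (\<lambda>x. Re (f (x,0)))" "linear (\<lambda>x. Im (f (x,0)))"
    by (auto intro!: linearI simp: * add)
  obtain a b where a: "\<And>x. Re (f (x,0)) = a \<bullet> x" and b: "\<And>x. Im (f (x,0)) = b \<bullet> x"
    using real_functional_inner[OF lin(1)] real_functional_inner[OF lin(2)] by blast
  have "f z = cform (a, b) z" for z
  proof -
    obtain x y where z: "z = (x, y)" by force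
    have "z = (x, 0) + cscale \<i> (y, 0)" by (simp add: z cscale_def)
    then have "f z = f (x, 0) + \<i> * f (y, 0)" by (simp add: f.add f.scale)
    then show ?thesis by (simp add: z complex_eq_iff a b cform_def)
  qed
  then show ?thesis by blast
qed

text \<open>Trades the abstract linear functions of \<open>poly_fun\<close> for the generators
  \<open>cform a\<close>, on which every later operator is computed explicitly.\<close>

lemma poly_fun_induct [consumes 1, case_names const cform add mult]:
  assumes "(f :: 'a cfun) \<in> poly_fun"
    and "\<And>c. P (\<lambda>_. c)" and "\<And>a. P (cform a)"
    and "\<And>f g. f \<in> poly_fun \<Longrightarrow> g \<in> poly_fun \<Longrightarrow> P f \<Longrightarrow> P g \<Longrightarrow> P (f + g)"
    and "\<And>f g. f \<in> poly_fun \<Longrightarrow> g \<in> poly_fun \<Longrightarrow> P f \<Longrightarrow> P g \<Longrightarrow> P (f * g)"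
  shows "P f"
  using assms(1)
proof (induction rule: poly_fun.induct)
  case (linear f)
  then show ?case using complex_functional_cform assms(3) by metis
next
  case (add f g)
  then show ?case using assms(4)[of f g] by (simp add: func_plus)
next
  case (mult f g)
  then show ?case using assms(5)[of f g] by (simp add: func_times)
qed (rule assms)

text \<open>The existence of some decomposition is all that \<open>homogeneous_induct\<close> uses,
  so homogeneous components need be neither defined nor shown unique.\<close>

inductive homogeneous_sum :: "('a cfun) \<Rightarrow> bool" where
  single: "homogeneous d f \<Longrightarrow> homogeneous_sum f"
| add: "homogeneous_sum f \<Longrightarrow> homogeneous_sum g \<Longrightarrow> homogeneous_sum (f + g)"

lemma homogeneous_sum_mult:
  assumes "homogeneous_sum f" "homogeneous_sum g"
  shows "homogeneous_sum (f * g)"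
  using assms
proof (induction f rule: homogeneous_sum.induct)
  case (single d f)
  from this(2,1) show ?case
    by (induction g rule: homogeneous_sum.induct)
      (auto simp: distrib_left intro: homogeneous_sum.intros homogeneous_mult)
qed (auto simp: distrib_right intro: homogeneous_sum.intros)

lemma poly_fun_homogeneous_sum: "f \<in> poly_fun \<Longrightarrow> homogeneous_sum f"
  by (induction rule: poly_fun_induct)
    (blast intro: homogeneous_sum_mult homogeneous_sum.intros homogeneous_const homogeneous_cform)+

lemma homogeneous_induct [consumes 1, case_names homogeneous add]:
  assumes "(f :: 'a cfun) \<in> poly_fun"
    and "\<And>d f. homogeneous d f \<Longrightarrow> P f"
    and "\<And>f g. f \<in> poly_fun \<Longrightarrow> g \<in> poly_fun \<Longrightarrow> P f \<Longrightarrow> P g \<Longrightarrow> P (f + g)"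
  shows "P f"
proof -
  have "homogeneous_sum f" by (rule poly_fun_homogeneous_sum) fact
  then have "f \<in> poly_fun \<and> P f"
    by induction (blast intro: assms dest: homogeneousD(1))+
  then show ?thesis ..
qed

end

section \<open>Constant-coefficient differential operators\<close>

lemma translate_simps [simp]:
  "translate v (f + g) = translate v f + translate v g"
  "translate v (f * g) = translate v f * translate v g"
  "translate v (\<lambda>_. c) = (\<lambda>_. c)"
  by (simp_all add: translate_def fun_eq_iff)

text \<open>The derivative along a complex line. \<open>deriv\<close> is unspecified where the
  restriction to the line is not differentiable, hence the polynomial hypotheses of the sum and
  product rules below.\<close>

definition dir_deriv ::
  "'a::real_inner cplx \<Rightarrow> ('a cfun) \<Rightarrow> 'a cfun" where
  "dir_deriv a f x = deriv (\<lambda>t. f (x + cscale t a)) 0"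

lemma dir_deriv_const [simp]: "dir_deriv a (\<lambda>_. c) = 0"
  by (simp add: dir_deriv_def fun_eq_iff)

lemma dir_deriv_cform [simp]: "dir_deriv a (cform b) = (\<lambda>_. cform b a)"
proof
  fix x
  have "((\<lambda>t. cform b (x + cscale t a)) has_field_derivative cform b a) (at 0)"
    unfolding cform_add_right cform_cscale_right by (auto intro!: derivative_eq_intros)
  then show "dir_deriv a (cform b) x = cform b a"
    unfolding dir_deriv_def by (rule DERIV_imp_deriv)
qed

lemma dir_deriv_translate: "dir_deriv a (translate v f) = translate v (dir_deriv a f)"
  by (simp add: dir_deriv_def translate_def fun_eq_iff add_ac)

text \<open>The graph of \<open>f \<mapsto> \<Theta>(f)\<close>, a relation because one function has many expressions in linear
  functions. That it is single-valued comes from the symmetry of \<open>\<Theta>(f)(g)(0)\<close> in \<open>f\<close> and \<open>g\<close>,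
  which makes this value depend only on the function \<open>f\<close>.\<close>

inductive theta_rel ::
  "('a::real_inner cfun) \<Rightarrow> (('a cfun) \<Rightarrow> 'a cfun) \<Rightarrow> bool"
where
  const: "theta_rel (\<lambda>_. c) (\<lambda>h. (\<lambda>_. c) * h)"
| cform: "theta_rel (cform a) (dir_deriv a)"
| add: "theta_rel f A \<Longrightarrow> theta_rel g B \<Longrightarrow> theta_rel (f + g) (\<lambda>h. A h + B h)"
| mult: "theta_rel f A \<Longrightarrow> theta_rel g B \<Longrightarrow> theta_rel (f * g) (\<lambda>h. A (B h))"

lemma theta_rel_poly_fun: "theta_rel f A \<Longrightarrow> f \<in> poly_fun"
  by (induction rule: theta_rel.induct) blast+

context finite_dimensional_inner
begin

lemma translate_poly_fun [intro]: "(f :: 'a cfun) \<in> poly_fun \<Longrightarrow> translate v f \<in> poly_fun"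
proof (induction rule: poly_fun_induct)
  case (cform a)
  have "translate v (cform a) = cform a + (\<lambda>_. cform a v)"
    by (simp add: translate_def cform_add_right fun_eq_iff)
  then show ?case by (metis cform_in_poly_fun poly_fun_add poly_fun_const)
next
  case (add f g) then show ?case unfolding translate_simps by blast
next
  case (mult f g) then show ?case unfolding translate_simps by blast
qed simp

lemma poly_fun_line_differentiable:
  "(f :: 'a cfun) \<in> poly_fun \<Longrightarrow> (\<lambda>t. f (x + cscale t a)) field_differentiable at s"
  by (induction rule: poly_fun_induct)
    (auto simp: cform_add_right cform_cscale_right
      intro!: field_differentiable_add field_differentiable_mult derivative_intros)

lemma dir_deriv_add:
  "(f :: 'a cfun) \<in> poly_fun \<Longrightarrow> g \<in> poly_fun \<Longrightarrow>
    dir_deriv a (f + g) = dir_deriv a f + dir_deriv a g"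
  by (simp add: dir_deriv_def fun_eq_iff poly_fun_line_differentiable)

lemma dir_deriv_mult:
  "(f :: 'a cfun) \<in> poly_fun \<Longrightarrow> g \<in> poly_fun \<Longrightarrow>
    dir_deriv a (f * g) = dir_deriv a f * g + f * dir_deriv a g"
  by (simp add: dir_deriv_def fun_eq_iff poly_fun_line_differentiable algebra_simps)

lemma dir_deriv_poly_fun [intro]:
  "(f :: 'a cfun) \<in> poly_fun \<Longrightarrow> dir_deriv a f \<in> poly_fun"
proof (induction rule: poly_fun_induct)
  case (add f g) then show ?case unfolding dir_deriv_add[OF add(1,2)] by blast
next
  case (mult f g) then show ?case unfolding dir_deriv_mult[OF mult(1,2)] by blast
qed auto

lemma dir_deriv_scale:
  "(f :: 'a cfun) \<in> poly_fun \<Longrightarrow> dir_deriv a ((\<lambda>_. c) * f) = (\<lambda>_. c) * dir_deriv a f"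
  by (simp add: dir_deriv_mult)

lemma theta_rel_linear:
  assumes "theta_rel f A"
  shows "(h :: 'a cfun) \<in> poly_fun \<Longrightarrow> A h \<in> poly_fun"
    "h \<in> poly_fun \<Longrightarrow> k \<in> poly_fun \<Longrightarrow> A (h + k) = A h + A k"
    "h \<in> poly_fun \<Longrightarrow> A ((\<lambda>_. c) * h) = (\<lambda>_. c) * A h"
proof -
  have *: "A h \<in> poly_fun \<and> A (h + k) = A h + A k \<and> A ((\<lambda>_. c) * h) = (\<lambda>_. c) * A h"
    if "h \<in> poly_fun" "k \<in> poly_fun" for h k :: "'a cfun"
    using assms that
  proof (induction arbitrary: h k)
    case (const d)
    have "(\<lambda>_. d) * ((\<lambda>_. c) * h) = (\<lambda>_. c) * ((\<lambda>_. d) * h)" by (rule mult.left_commute)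
    then show ?case using const by (auto simp only: distrib_left intro!: poly_fun_mult poly_fun_const)
  next
    case (cform a)
    then show ?case by (metis dir_deriv_add dir_deriv_scale dir_deriv_poly_fun)
  next
    case (add f A g B)
    have *: "A h \<in> poly_fun" "B h \<in> poly_fun" "A (h + k) = A h + A k" "B (h + k) = B h + B k"
      "A ((\<lambda>_. c) * h) = (\<lambda>_. c) * A h" "B ((\<lambda>_. c) * h) = (\<lambda>_. c) * B h"
      using add.IH(1)[OF add.prems] add.IH(2)[OF add.prems] by blast+
    show ?case unfolding * using *(1,2) by (auto simp only: distrib_left add_ac intro!: poly_fun_add)
  next
    case (mult f A g B)
    then show ?case
      using mult.IH(1)[of "B h" "B k"] mult.IH(2)[of h k] mult.IH(2)[of k h] by simp
  qed
  show "h \<in> poly_fun \<Longrightarrow> A h \<in> poly_fun"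
    "h \<in> poly_fun \<Longrightarrow> k \<in> poly_fun \<Longrightarrow> A (h + k) = A h + A k"
    "h \<in> poly_fun \<Longrightarrow> A ((\<lambda>_. c) * h) = (\<lambda>_. c) * A h"
    using * by blast+
qed

lemma theta_rel_translate:
  assumes "theta_rel f A" and "(h :: 'a cfun) \<in> poly_fun"
  shows "A (translate v h) = translate v (A h)"
  using assms by (induction arbitrary: h) (simp_all add: dir_deriv_translate theta_rel_linear)

lemma theta_rel_one:
  assumes "theta_rel (f :: 'a cfun) A"
  shows "A 1 = (\<lambda>_. f 0)"
  using assms
proof induction
  case (mult f A g B)
  have "A (\<lambda>_. g 0) = A ((\<lambda>_. g 0) * 1)" by (simp add: func_times func_one)
  also have "\<dots> = (\<lambda>_. g 0) * A 1" by (rule theta_rel_linear(3)[OF mult(1)]) simp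
  finally show ?case using mult by (simp add: func_times mult.commute)
qed (simp_all add: func_times func_one func_plus func_zero dir_deriv_const)

text \<open>The Weyl algebra relation: the commutator of the operator of \<open>g\<close> with
  multiplication by \<open>cform a\<close> is the operator of the derivative of \<open>g\<close>.
  Both sides obey the Leibniz rule in \<open>g\<close>, so generators suffice.\<close>

lemma theta_rel_commutator:
  assumes "theta_rel (g :: 'a cfun) B"
  shows "\<exists>B'. theta_rel (dir_deriv a g) B' \<and>
    (\<forall>h\<in>poly_fun. B (h * cform a) = B h * cform a + B' h)"
  using assms
proof induction
  case (const c)
  show ?case
    by (rule exI[of _ "\<lambda>h. (\<lambda>_. 0) * h"])
      (use theta_rel.const[of 0] in \<open>simp add: func_zero func_times func_plus mult_ac\<close>)
next
  case (cform b)
  have "dir_deriv b (h * cform a) = dir_deriv b h * cform a + (\<lambda>_. cform b a) * h"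
    if "h \<in> poly_fun" for h
    using that by (simp add: dir_deriv_mult cform_commute[of a b] fun_eq_iff)
  then show ?case unfolding dir_deriv_cform using theta_rel.const[of "cform b a"] by blast
next
  case (add f A g B)
  then obtain A' B' where *:
    "theta_rel (dir_deriv a f) A'" "\<forall>h\<in>poly_fun. A (h * cform a) = A h * cform a + A' h"
    "theta_rel (dir_deriv a g) B'" "\<forall>h\<in>poly_fun. B (h * cform a) = B h * cform a + B' h"
    by blast
  have "theta_rel (dir_deriv a (f + g)) (\<lambda>h. A' h + B' h)"
    unfolding dir_deriv_add[OF add(1,2)[THEN theta_rel_poly_fun]]
    by (intro theta_rel.intros *)
  moreover have "A (h * cform a) + B (h * cform a) = (A h + B h) * cform a + (A' h + B' h)"
    if h: "h \<in> poly_fun" for h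
    using h * by (simp add: algebra_simps del: plus_fun_apply times_fun_apply)
  ultimately show ?case by blast
next
  case (mult f A g B)
  then obtain A' B' where *:
    "theta_rel (dir_deriv a f) A'" "\<forall>h\<in>poly_fun. A (h * cform a) = A h * cform a + A' h"
    "theta_rel (dir_deriv a g) B'" "\<forall>h\<in>poly_fun. B (h * cform a) = B h * cform a + B' h"
    by blast
  have "theta_rel (dir_deriv a (f * g)) (\<lambda>h. A' (B h) + A (B' h))"
    unfolding dir_deriv_mult[OF mult(1,2)[THEN theta_rel_poly_fun]]
    by (intro theta_rel.intros mult *)
  moreover have "A (B (h * cform a)) = A (B h) * cform a + (A' (B h) + A (B' h))"
    if h: "h \<in> poly_fun" for h
  proof -
    have Bh: "B h \<in> poly_fun" "B' h \<in> poly_fun"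
      using h mult(2) *(3) theta_rel_linear(1) by blast+
    show ?thesis
      using theta_rel_linear(2)[OF mult(1) poly_fun_mult[OF Bh(1) cform_in_poly_fun] Bh(2)] * h Bh
      by (simp add: add_ac del: plus_fun_apply times_fun_apply)
  qed
  ultimately show ?case by blast
qed

text \<open>Multiplication by \<open>f\<close> is adjoint to differentiation by \<open>f\<close>.
  Stating this with an operator \<open>B'\<close> for \<open>A g\<close> makes it compose, so
  products of symbols follow by applying it twice.\<close>

lemma theta_rel_adjoint:
  assumes "theta_rel (f :: 'a cfun) A" and "theta_rel g B"
  shows "\<exists>B'. theta_rel (A g) B' \<and> (\<forall>h\<in>poly_fun. B' h 0 = B (h * f) 0)"
  using assms
proof (induction arbitrary: g B)
  case (const c)
  have "((\<lambda>_. c) * B h) 0 = B (h * (\<lambda>_. c)) 0" if "h \<in> poly_fun" for h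
    using theta_rel_linear(3)[OF const that, of c] by (metis mult.commute)
  then show ?case using theta_rel.mult[OF theta_rel.const[of c] const] by blast
next
  case (cform a)
  then obtain B' where "theta_rel (dir_deriv a g) B'"
    "\<forall>h\<in>poly_fun. B (h * cform a) = B h * cform a + B' h"
    using theta_rel_commutator by blast
  \<comment> \<open>Linear functions vanish at the origin, so only the commutator survives.\<close>
  moreover have "(B h * cform a + B' h) 0 = B' h 0" for h by simp
  ultimately show ?case by metis
next
  case (add f A f' A')
  obtain B1 where B1: "theta_rel (A g) B1" "\<forall>h\<in>poly_fun. B1 h 0 = B (h * f) 0"
    using add.IH(1)[OF add.prems] by blast
  obtain B2 where B2: "theta_rel (A' g) B2" "\<forall>h\<in>poly_fun. B2 h 0 = B (h * f') 0"
    using add.IH(2)[OF add.prems] by blast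
  have "(B1 h + B2 h) 0 = B (h * (f + f')) 0" if "h \<in> poly_fun" for h
  proof -
    have "h * f \<in> poly_fun" "h * f' \<in> poly_fun"
      using that add.hyps[THEN theta_rel_poly_fun] by blast+
    then have "B (h * (f + f')) = B (h * f) + B (h * f')"
      unfolding distrib_left by (rule theta_rel_linear(2)[OF add.prems])
    then show ?thesis using B1(2) B2(2) that by simp
  qed
  then show ?case using theta_rel.add[OF B1(1) B2(1)] by blast
next
  case (mult f A f' A')
  obtain B2 where B2: "theta_rel (A' g) B2" "\<forall>h\<in>poly_fun. B2 h 0 = B (h * f') 0"
    using mult.IH(2)[OF mult.prems] by blast
  obtain B1 where B1: "theta_rel (A (A' g)) B1" "\<forall>h\<in>poly_fun. B1 h 0 = B2 (h * f) 0"
    using mult.IH(1)[OF B2(1)] by blast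
  have "B1 h 0 = B (h * (f * f')) 0" if "h \<in> poly_fun" for h
    using that B1 B2 mult.hyps[THEN theta_rel_poly_fun] by (simp add: poly_fun_mult mult.assoc)
  then show ?case using B1(1) by blast
qed

text \<open>The adjunction with \<open>h = 1\<close>: an operator applied to \<open>1\<close>
  returns the value of its symbol at the origin.\<close>

lemma theta_rel_symmetric:
  assumes "theta_rel (f :: 'a cfun) A" and "theta_rel g B"
  shows "A g 0 = B f 0"
proof -
  obtain B' where B': "theta_rel (A g) B'" "\<forall>h\<in>poly_fun. B' h 0 = B (h * f) 0"
    using theta_rel_adjoint[OF assms] by blast
  have "A g 0 = B' 1 0" by (simp add: theta_rel_one[OF B'(1)])
  also have "\<dots> = B f 0" using B'(2) by simp
  finally show ?thesis .
qed

lemma theta_rel_exists: "(f :: 'a cfun) \<in> poly_fun \<Longrightarrow> \<exists>A. theta_rel f A"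
  by (induction rule: poly_fun_induct) (blast intro: theta_rel.intros)+

text \<open>The operators commute with translations, so the value at \<open>x\<close> is a value at
  the origin, where symmetry replaces \<open>A\<close> by an operator \<open>B\<close> of the
  translated \<open>g\<close>.\<close>

lemma theta_rel_unique:
  assumes "theta_rel (f :: 'a cfun) A" "theta_rel f A'" "g \<in> poly_fun"
  shows "A g = A' g"
proof
  fix x
  obtain B where B: "theta_rel (translate x g) B"
    using theta_rel_exists[OF translate_poly_fun[OF assms(3)]] by blast
  have "A g x = A (translate x g) 0"
    using theta_rel_translate[OF assms(1,3), of x] by (simp add: translate_def)
  also have "\<dots> = A' (translate x g) 0"
    using theta_rel_symmetric[OF assms(1) B] theta_rel_symmetric[OF assms(2) B] by simp
  also have "\<dots> = A' g x"
    using theta_rel_translate[OF assms(2,3), of x] by (simp add: translate_def)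
  finally show "A g x = A' g x" .
qed

section \<open>Existence and uniqueness of the morphism, and its bilinear pairing\<close>

lemma is_ThetaD:
  assumes "is_Theta T"
  shows "f \<in> poly_fun \<Longrightarrow> g \<in> poly_fun \<Longrightarrow> h \<in> poly_fun \<Longrightarrow> T f (g + h) = T f g + T f h"
    "f \<in> poly_fun \<Longrightarrow> g \<in> poly_fun \<Longrightarrow> T f ((\<lambda>_. c) * g) = (\<lambda>_. c) * T f g"
    "g \<in> poly_fun \<Longrightarrow> T 1 g = g"
    "f \<in> poly_fun \<Longrightarrow> g \<in> poly_fun \<Longrightarrow> h \<in> poly_fun \<Longrightarrow> T (f + g) h = T f h + T g h"
    "f \<in> poly_fun \<Longrightarrow> h \<in> poly_fun \<Longrightarrow> T ((\<lambda>_. c) * f) h = (\<lambda>_. c) * T f h"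
    "f \<in> poly_fun \<Longrightarrow> g \<in> poly_fun \<Longrightarrow> h \<in> poly_fun \<Longrightarrow> T (f * g) h = T f (T g h)"
    "g \<in> poly_fun \<Longrightarrow> h \<in> poly_fun \<Longrightarrow> T (cform a) (g * h) = T (cform a) g * h + g * T (cform a) h"
    "T (cform a) (cform b) = (\<lambda>_. cform b a)"
  using assms unfolding is_Theta_def by meson+

lemma is_Theta_theta_rel:
  assumes T: "is_Theta T" and "theta_rel (f :: 'a cfun) A" and "h \<in> poly_fun"
  shows "T f h = A h"
  using assms(2,3)
proof (induction arbitrary: h)
  case (const c)
  have "T (\<lambda>_. c) h = T ((\<lambda>_. c) * 1) h" by (simp add: func_times func_one)
  also have "\<dots> = (\<lambda>_. c) * h"
    unfolding is_ThetaD(5)[OF T poly_fun_1 const] is_ThetaD(3)[OF T const] ..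
  finally show ?case .
next
  case (cform a)
  from cform show ?case
  proof (induction rule: poly_fun_induct)
    case (const c)
    \<comment> \<open>The Leibniz rule for \<open>1 = 1 * 1\<close> forces a derivation to kill
      \<open>1\<close>.\<close>
    have "T (cform a) (1 * 1) = T (cform a) 1 * 1 + 1 * T (cform a) 1"
      by (rule is_ThetaD(7)[OF T]) blast+
    then have 0: "T (cform a) 1 = 0" by simp
    have "T (cform a) (\<lambda>_. c) = T (cform a) ((\<lambda>_. c) * 1)" by (simp add: func_times func_one)
    also have "\<dots> = 0" unfolding is_ThetaD(2)[OF T cform_in_poly_fun poly_fun_1] 0 by simp
    finally show ?case by simp
  next
    case (cform b)
    show ?case unfolding is_ThetaD(8)[OF T] dir_deriv_cform ..
  next
    case (add f g)
    show ?case
      unfolding is_ThetaD(1)[OF T cform_in_poly_fun add(1,2)] dir_deriv_add[OF add(1,2)] add(3,4) ..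
  next
    case (mult f g)
    show ?case unfolding is_ThetaD(7)[OF T mult(1,2)] dir_deriv_mult[OF mult(1,2)] mult(3,4) ..
  qed
next
  case (add f A g B)
  show ?case
    unfolding is_ThetaD(4)[OF T add.hyps[THEN theta_rel_poly_fun] add.prems]
      add.IH[OF add.prems] ..
next
  case (mult f A g B)
  have "B h \<in> poly_fun" using mult theta_rel_linear by blast
  then show ?case
    unfolding is_ThetaD(6)[OF T mult.hyps[THEN theta_rel_poly_fun] mult.prems] mult.IH(2)[OF mult.prems]
    by (rule mult.IH(1))
qed

lemma is_Theta_exists: "\<exists>T :: ('a cfun) \<Rightarrow> _. is_Theta T"
proof -
  define T :: "('a cfun) \<Rightarrow> ('a cfun) \<Rightarrow> 'a cfun" where
    "T f g = (if f \<in> poly_fun \<and> g \<in> poly_fun then (SOME A. theta_rel f A) g else 0)" for f g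
  \<comment> \<open>The choice made in \<open>T\<close> is harmless: on polynomials it agrees with
    every operator related to \<open>f\<close>.\<close>
  have T: "T f g = A g" if "theta_rel f A" "g \<in> poly_fun" for f g A
    using that theta_rel_poly_fun[OF that(1)] theta_rel_unique[OF someI[of "theta_rel f" A] that(1)]
    by (simp add: T_def)
  have Tex: "\<exists>A. theta_rel f A \<and> (\<forall>g\<in>poly_fun. T f g = A g)" if "f \<in> poly_fun" for f
    using theta_rel_exists[OF that] T by blast
  have "is_Theta T"
    unfolding is_Theta_def
  proof (intro conjI allI ballI impI)
    fix f g :: "'a cfun" assume "f \<notin> poly_fun \<or> g \<notin> poly_fun"
    then show "T f g = 0" by (auto simp: T_def)
  next
    fix f g :: "'a cfun" assume "f \<in> poly_fun" "g \<in> poly_fun"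
    then show "T f g \<in> poly_fun" using Tex[of f] theta_rel_linear(1)[of f _ g] by auto
  next
    fix f g h :: "'a cfun" assume *: "f \<in> poly_fun" "g \<in> poly_fun" "h \<in> poly_fun"
    then obtain A where A: "theta_rel f A" using theta_rel_exists by blast
    show "T f (g + h) = T f g + T f h"
      unfolding T[OF A *(2)] T[OF A *(3)] T[OF A poly_fun_add[OF *(2,3)]]
      by (rule theta_rel_linear(2)[OF A *(2,3)])
  next
    fix f g :: "'a cfun" and c assume *: "f \<in> poly_fun" "g \<in> poly_fun"
    then obtain A where A: "theta_rel f A" using theta_rel_exists by blast
    show "T f ((\<lambda>_. c) * g) = (\<lambda>_. c) * T f g"
      unfolding T[OF A *(2)] T[OF A poly_fun_mult[OF poly_fun_const *(2)]]
      by (rule theta_rel_linear(3)[OF A *(2)])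
  next
    fix g :: "'a cfun" assume "g \<in> poly_fun"
    then show "T 1 g = g" using T[OF theta_rel.const[of 1]] by (simp add: func_one func_times)
  next
    fix f g h :: "'a cfun" assume *: "f \<in> poly_fun" "g \<in> poly_fun" "h \<in> poly_fun"
    then obtain A B where AB: "theta_rel f A" "theta_rel g B" using theta_rel_exists by blast
    show "T (f + g) h = T f h + T g h"
      unfolding T[OF theta_rel.add[OF AB] *(3)] T[OF AB(1) *(3)] T[OF AB(2) *(3)] ..
  next
    fix f h :: "'a cfun" and c assume *: "f \<in> poly_fun" "h \<in> poly_fun"
    then obtain A where A: "theta_rel f A" using theta_rel_exists by blast
    show "T ((\<lambda>_. c) * f) h = (\<lambda>_. c) * T f h"
      unfolding T[OF theta_rel.mult[OF theta_rel.const A] *(2)] T[OF A *(2)] ..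
  next
    fix f g h :: "'a cfun" assume *: "f \<in> poly_fun" "g \<in> poly_fun" "h \<in> poly_fun"
    then obtain A B where AB: "theta_rel f A" "theta_rel g B" using theta_rel_exists by blast
    have "B h \<in> poly_fun" using AB(2) *(3) theta_rel_linear(1) by blast
    then show "T (f * g) h = T f (T g h)"
      unfolding T[OF theta_rel.mult[OF AB] *(3)] T[OF AB(2) *(3)] by (simp only: T[OF AB(1)])
  next
    fix a :: "'a cplx" and g h :: "'a cfun" assume "g \<in> poly_fun" "h \<in> poly_fun"
    then show "T (cform a) (g * h) = T (cform a) g * h + g * T (cform a) h"
      by (simp only: T[OF theta_rel.cform] poly_fun_mult dir_deriv_mult)
  next
    fix a b :: "'a cplx"
    show "T (cform a) (cform b) = (\<lambda>_. cform b a)" by (simp add: T[OF theta_rel.cform])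
  qed
  then show ?thesis by (rule exI[of is_Theta])
qed

lemma is_Theta_Theta: "is_Theta (Theta :: ('a cfun) \<Rightarrow> _)"
proof -
  obtain T :: "('a cfun) \<Rightarrow> _" where T: "is_Theta T" using is_Theta_exists by blast
  have "T' = T" if T': "is_Theta T'" for T'
  proof (intro ext)
    fix f g x
    show "T' f g x = T f g x"
    proof (cases "f \<in> poly_fun \<and> g \<in> poly_fun")
      case True
      then obtain A where A: "theta_rel f A" using theta_rel_exists by blast
      show ?thesis
        using True by (simp only: is_Theta_theta_rel[OF T A] is_Theta_theta_rel[OF T' A])
    next
      case False
      then have "T' f g = 0" "T f g = 0"
        using T[unfolded is_Theta_def, THEN conjunct1] T'[unfolded is_Theta_def, THEN conjunct1]
        by auto
      then show ?thesis by simp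
    qed
  qed
  then show ?thesis unfolding Theta_def using T by (intro theI[of is_Theta T])
qed

lemma Theta_theta_rel: "theta_rel (f :: 'a cfun) A \<Longrightarrow> h \<in> poly_fun \<Longrightarrow> Theta f h = A h"
  by (rule is_Theta_theta_rel[OF is_Theta_Theta])

lemma theta_form_commute:
  assumes "(f :: 'a cfun) \<in> poly_fun" "g \<in> poly_fun"
  shows "theta_form f g = theta_form g f"
proof -
  obtain A B where AB: "theta_rel f A" "theta_rel g B" using assms theta_rel_exists by blast
  show ?thesis
    unfolding theta_form_def Theta_theta_rel[OF AB(1) assms(2)] Theta_theta_rel[OF AB(2) assms(1)]
    by (rule theta_rel_symmetric[OF AB])
qed

lemma theta_form_add_right:
  assumes "(f :: 'a cfun) \<in> poly_fun" "g \<in> poly_fun" "h \<in> poly_fun"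
  shows "theta_form f (g + h) = theta_form f g + theta_form f h"
  unfolding theta_form_def is_ThetaD(1)[OF is_Theta_Theta assms] by simp

lemma theta_form_scale_right:
  assumes "(f :: 'a cfun) \<in> poly_fun" "g \<in> poly_fun"
  shows "theta_form f ((\<lambda>_. c) * g) = c * theta_form f g"
  unfolding theta_form_def is_ThetaD(2)[OF is_Theta_Theta assms] by simp

lemma theta_form_add_left:
  assumes "(f :: 'a cfun) \<in> poly_fun" "g \<in> poly_fun" "h \<in> poly_fun"
  shows "theta_form (f + g) h = theta_form f h + theta_form g h"
  unfolding theta_form_commute[OF poly_fun_add[OF assms(1,2)] assms(3)]
    theta_form_commute[OF assms(1,3)] theta_form_commute[OF assms(2,3)]
  by (rule theta_form_add_right[OF assms(3,1,2)])

lemma theta_form_scale_left: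
  assumes "(f :: 'a cfun) \<in> poly_fun" "g \<in> poly_fun"
  shows "theta_form ((\<lambda>_. c) * f) g = c * theta_form f g"
  unfolding theta_form_commute[OF poly_fun_mult[OF poly_fun_const assms(1)] assms(2)]
    theta_form_commute[OF assms]
  by (rule theta_form_scale_right[OF assms(2,1)])

lemma theta_form_mult_cform:
  assumes "(f :: 'a cfun) \<in> poly_fun" "g \<in> poly_fun"
  shows "theta_form (f * cform a) g = theta_form f (dir_deriv a g)"
proof -
  obtain A where A: "theta_rel f A" using assms theta_rel_exists by blast
  show ?thesis
    unfolding theta_form_def Theta_theta_rel[OF theta_rel.mult[OF A theta_rel.cform] assms(2)]
      Theta_theta_rel[OF A dir_deriv_poly_fun[OF assms(2)]] ..
qed

lemma theta_form_sum_left: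
  assumes "\<And>i. i \<in> I \<Longrightarrow> (f i :: 'a cfun) \<in> poly_fun" "g \<in> poly_fun"
  shows "theta_form (sum f I) g = (\<Sum>i\<in>I. theta_form (f i) g)"
  using assms(1)
proof (induction I rule: infinite_finite_induct)
  case (insert i I)
  have "theta_form (f i + sum f I) g = theta_form (f i) g + theta_form (sum f I) g"
    by (rule theta_form_add_left) (use insert assms(2) in blast)+
  then show ?case using insert by (simp del: plus_fun_apply)
qed (use theta_form_scale_left[of 0 g 0] assms(2) in \<open>simp_all add: func_zero func_times\<close>)

end

section \<open>Grading, and representation of functionals by the pairing\<close>

context finite_dimensional_inner
begin

lemma poly_fun_comp_cscale: "(f :: 'a cfun) \<in> poly_fun \<Longrightarrow> (\<lambda>x. f (cscale c x)) \<in> poly_fun"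
proof (induction rule: poly_fun_induct)
  case (cform a)
  have "(\<lambda>x. cform a (cscale c x)) = (\<lambda>_. c) * cform a"
    by (simp add: fun_eq_iff cform_cscale_right)
  then show ?case by (metis cform_in_poly_fun poly_fun_mult poly_fun_const)
next
  case (add f g) then show ?case using poly_fun_add by (simp add: func_plus)
next
  case (mult f g) then show ?case using poly_fun_mult by (simp add: func_times)
qed simp

lemma poly_fun_line_isCont:
  "(f :: 'a cfun) \<in> poly_fun \<Longrightarrow> isCont (\<lambda>t. f (x + cscale t a)) s"
  by (rule field_differentiable_imp_continuous_at[OF poly_fun_line_differentiable])

text \<open>The case \<open>c = 0\<close> follows by letting \<open>c\<close> tend to
  \<open>0\<close> along a line. It is treated once here because the arguments below cancel a factor
  \<open>c\<close>.\<close>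

lemma homogeneousI:
  assumes f: "(f :: 'a cfun) \<in> poly_fun"
    and hom: "\<And>c x. c \<noteq> 0 \<Longrightarrow> f (cscale c x) = c ^ d * f x"
  shows "homogeneous d f"
proof -
  have "f (cscale 0 x) = 0 ^ d * f x" for x
  proof -
    have 1: "((\<lambda>t. f (0 + cscale t x)) \<longlongrightarrow> f (0 + cscale 0 x)) (at 0)"
      using poly_fun_line_isCont[OF f, where x = 0 and a = x and s = 0] unfolding isCont_def .
    have "((\<lambda>t. t ^ d * f x) \<longlongrightarrow> 0 ^ d * f x) (at (0::complex))"
      by (intro tendsto_intros)
    moreover have "\<forall>\<^sub>F t in at 0. t ^ d * f x = f (0 + cscale t x)"
      using eventually_neq_at_within[of 0 0 UNIV] by eventually_elim (simp add: hom)
    ultimately have "((\<lambda>t. f (0 + cscale t x)) \<longlongrightarrow> 0 ^ d * f x) (at 0)"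
      by (rule Lim_transform_eventually)
    then show ?thesis using tendsto_unique[OF at_neq_bot 1] by simp
  qed
  with f hom show ?thesis unfolding homogeneous_def by metis
qed

text \<open>The function \<open>f (c x + c t a)\<close> of \<open>t\<close> is differentiated in two
  ways, by the chain rule and by the homogeneity of \<open>f\<close>.\<close>

lemma dir_deriv_homogeneous:
  assumes f: "homogeneous (Suc d) (f :: 'a cfun)"
  shows "homogeneous d (dir_deriv a f)"
proof (rule homogeneousI)
  show "dir_deriv a f \<in> poly_fun" using homogeneousD(1)[OF f] by blast
  fix c :: complex and x :: "'a cplx" assume c: "c \<noteq> 0"
  have "((\<lambda>t. f (cscale c x + cscale t a)) has_field_derivative dir_deriv a f (cscale c x)) (at 0)"
    unfolding dir_deriv_def
    using poly_fun_line_differentiable[OF homogeneousD(1)[OF f]] field_differentiable_derivI by blast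
  then have "((\<lambda>t. f (cscale c x + cscale (c * t) a)) has_field_derivative dir_deriv a f (cscale c x) * c) (at 0)"
    using DERIV_chain2[of "\<lambda>t. f (cscale c x + cscale t a)" _ "\<lambda>t. c * t" 0 c UNIV]
    by (auto intro!: derivative_eq_intros)
  moreover have "f (cscale c x + cscale (c * t) a) = c ^ Suc d * f (x + cscale t a)" for t
    unfolding homogeneousD(2)[OF f, symmetric] by (simp add: cscale_add_right cscale_cscale)
  ultimately have "((\<lambda>t. c ^ Suc d * f (x + cscale t a)) has_field_derivative dir_deriv a f (cscale c x) * c) (at 0)"
    by simp
  moreover have "((\<lambda>t. c ^ Suc d * f (x + cscale t a)) has_field_derivative c ^ Suc d * dir_deriv a f x) (at 0)"
    unfolding dir_deriv_def
    using poly_fun_line_differentiable[OF homogeneousD(1)[OF f], of x a 0]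
    by (intro DERIV_cmult field_differentiable_derivI)
  ultimately have "dir_deriv a f (cscale c x) * c = c ^ Suc d * dir_deriv a f x"
    by (rule DERIV_unique)
  then show "dir_deriv a f (cscale c x) = c ^ d * dir_deriv a f x" using c by simp
qed

lemma dir_deriv_expand:
  fixes E :: "'a set" and f :: "'a cfun"
  assumes E: "\<And>x. x = (\<Sum>e\<in>E. (x \<bullet> e) *\<^sub>R e)" and "f \<in> poly_fun"
  shows "dir_deriv a f x = (\<Sum>e\<in>E. cform (e, 0) a * dir_deriv (e, 0) f x)"
  using assms(2)
proof (induction rule: poly_fun_induct)
  case (cform b)
  have *: "y \<bullet> z = (\<Sum>e\<in>E. (e \<bullet> z) * (y \<bullet> e))" for y z
  proof -
    have "y \<bullet> z = y \<bullet> (\<Sum>e\<in>E. (z \<bullet> e) *\<^sub>R e)" using E[of z] by simp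
    also have "\<dots> = (\<Sum>e\<in>E. (e \<bullet> z) * (y \<bullet> e))" by (simp add: inner_sum_right inner_commute)
    finally show ?thesis .
  qed
  show ?case unfolding dir_deriv_cform
    by (simp add: cform_def complex_eq_iff *[of "fst b" "fst a"] *[of "fst b" "snd a"]
        *[of "snd b" "fst a"] *[of "snd b" "snd a"] sum_subtractf sum.distrib)
next
  case (add f g)
  show ?case unfolding dir_deriv_add[OF add(1,2)]
    by (simp add: add.IH distrib_left sum.distrib)
next
  case (mult f g)
  show ?case unfolding dir_deriv_mult[OF mult(1,2)]
    by (simp add: mult.IH algebra_simps sum.distrib sum_distrib_left sum_distrib_right)
qed simp

text \<open>Differentiates at \<open>x\<close> in the direction \<open>x\<close> itself, where
  \<open>x + t x = (1 + t) x\<close>, and then expands that direction in the orthonormal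
  vectors.\<close>

lemma euler_homogeneous:
  fixes E :: "'a set" and f :: "'a cfun"
  assumes E: "\<And>x. x = (\<Sum>e\<in>E. (x \<bullet> e) *\<^sub>R e)" and f: "homogeneous d f"
  shows "(\<Sum>e\<in>E. dir_deriv (e, 0) f * cform (e, 0)) = (\<lambda>_. of_nat d) * f"
proof
  fix x
  have "((\<lambda>t. (1 + t) ^ d * f x) has_field_derivative of_nat d * f x) (at 0)"
    by (auto intro!: derivative_eq_intros)
  moreover have "f (x + cscale t x) = (1 + t) ^ d * f x" for t
    unfolding homogeneousD(2)[OF f, symmetric] by (simp add: cscale_add_left)
  ultimately have "dir_deriv x f x = of_nat d * f x"
    unfolding dir_deriv_def by (simp add: DERIV_imp_deriv)
  then show "(\<Sum>e\<in>E. dir_deriv (e, 0) f * cform (e, 0)) x = ((\<lambda>_. of_nat d) * f) x"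
    using dir_deriv_expand[OF E homogeneousD(1)[OF f], of x x] by (simp add: sum_fun_apply mult.commute)
qed

definition poly_functional :: "(('a cfun) \<Rightarrow> complex) \<Rightarrow> bool" where
  "poly_functional \<epsilon> \<longleftrightarrow> (\<forall>f\<in>poly_fun. \<forall>g\<in>poly_fun. \<epsilon> (f + g) = \<epsilon> f + \<epsilon> g) \<and>
     (\<forall>f\<in>poly_fun. \<forall>c. \<epsilon> ((\<lambda>_. c) * f) = c * \<epsilon> f)"

lemma poly_functionalD:
  assumes "poly_functional \<epsilon>"
  shows "f \<in> poly_fun \<Longrightarrow> g \<in> poly_fun \<Longrightarrow> \<epsilon> (f + g) = \<epsilon> f + \<epsilon> g"
    "f \<in> poly_fun \<Longrightarrow> \<epsilon> ((\<lambda>_. c) * f) = c * \<epsilon> f"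
  using assms unfolding poly_functional_def by blast+

lemma poly_functional_0: "poly_functional \<epsilon> \<Longrightarrow> \<epsilon> 0 = 0"
  using poly_functionalD(2)[of \<epsilon> 0 0] by simp

lemma poly_functional_sum:
  assumes \<epsilon>: "poly_functional \<epsilon>" and f: "\<And>i. i \<in> I \<Longrightarrow> f i \<in> poly_fun"
  shows "\<epsilon> (sum f I) = (\<Sum>i\<in>I. \<epsilon> (f i))"
  using f
proof (induction I rule: infinite_finite_induct)
  case (insert i I)
  have "\<epsilon> (f i + sum f I) = \<epsilon> (f i) + \<epsilon> (sum f I)"
    by (rule poly_functionalD(1)[OF \<epsilon>]) (use insert in blast)+
  then show ?case using insert by (simp del: plus_fun_apply)
qed (use poly_functional_0[OF \<epsilon>] in simp_all)

lemma poly_functional_diff: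
  assumes \<epsilon>: "poly_functional \<epsilon>" and "f \<in> poly_fun" "g \<in> poly_fun"
  shows "\<epsilon> (f - g) = \<epsilon> f - \<epsilon> g"
  using poly_functionalD(1)[OF \<epsilon> poly_fun_diff[OF assms(2,3)] assms(3)] by simp

lemma poly_functional_theta_form:
  "(p :: 'a cfun) \<in> poly_fun \<Longrightarrow> poly_functional (theta_form p)"
  unfolding poly_functional_def using theta_form_add_right theta_form_scale_right by blast

lemma theta_form_const: "(f :: 'a cfun) \<in> poly_fun \<Longrightarrow> theta_form (\<lambda>_. c) f = c * f 0"
  unfolding theta_form_def Theta_theta_rel[OF theta_rel.const] by simp

text \<open>Replaces a dimension count on monomials. Euler's identity writes \<open>f\<close> of
  degree d + 1 as the mean, with factor 1/(d + 1), of the products of its derivatives with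
  \<open>cform (e, 0)\<close>. The functionals sending \<open>f\<close> to
  \<open>\<epsilon> (f * cform (e, 0))\<close> are represented by some \<open>P e\<close> in degree
  d, and multiplication by \<open>cform (e, 0)\<close> is adjoint to the derivative along
  \<open>e\<close>; this dictates \<open>Q\<close>.\<close>

lemma homogeneous_functional_representation:
  assumes "poly_functional \<epsilon>"
  shows "\<exists>P. homogeneous d P \<and> (\<forall>f. homogeneous d f \<longrightarrow> theta_form P f = \<epsilon> f)"
  using assms
proof (induction d arbitrary: \<epsilon>)
  case 0
  have "theta_form (\<lambda>_. \<epsilon> 1) f = \<epsilon> f" if f: "homogeneous 0 f" for f
  proof -
    have "f = (\<lambda>_. f 0) * 1" using homogeneous_degree_0[OF f] by (simp add: func_times func_one)
    moreover have "\<epsilon> ((\<lambda>_. f 0) * 1) = f 0 * \<epsilon> 1" by (rule poly_functionalD(2)[OF 0 poly_fun_1])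
    ultimately have "\<epsilon> f = f 0 * \<epsilon> 1" by simp
    then show ?thesis using homogeneousD(1)[OF f] by (simp add: theta_form_const)
  qed
  then show ?case using homogeneous_const by blast
next
  case (Suc d)
  obtain E :: "'a set" where E: "finite E" "\<And>x. x = (\<Sum>e\<in>E. (x \<bullet> e) *\<^sub>R e)"
    using orthonormal_basis_exists by blast
  have "\<exists>P. homogeneous d P \<and> (\<forall>f. homogeneous d f \<longrightarrow> theta_form P f = \<epsilon> (f * cform (e, 0)))" for e
  proof (rule Suc.IH)
    show "poly_functional (\<lambda>f. \<epsilon> (f * cform (e, 0)))"
      unfolding poly_functional_def distrib_right mult.assoc
      by (intro conjI ballI allI poly_functionalD[OF Suc.prems] poly_fun_mult cform_in_poly_fun)
  qed
  then obtain P where P: "\<And>e. homogeneous d (P e)"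
    "\<And>e f. homogeneous d f \<Longrightarrow> theta_form (P e) f = \<epsilon> (f * cform (e, 0))" by metis
  define Q where "Q = (\<lambda>_. 1 / of_nat (Suc d)) * (\<Sum>e\<in>E. P e * cform (e, 0))"
  have "homogeneous (d + 1) (\<Sum>e\<in>E. P e * cform (e, 0))"
    by (intro homogeneous_sum homogeneous_mult P homogeneous_cform)
  then have Q: "homogeneous (Suc d) Q" unfolding Q_def by (intro homogeneous_scale) simp
  have "theta_form Q f = \<epsilon> f" if f: "homogeneous (Suc d) f" for f
  proof -
    have pf: "f \<in> poly_fun" using homogeneousD(1)[OF f] .
    have pP: "P e * cform (e, 0) \<in> poly_fun" for e using homogeneousD(1)[OF P(1)] by blast
    have pD: "dir_deriv (e, 0) f * cform (e, 0) \<in> poly_fun" for e :: 'a using pf by blast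
    have "theta_form Q f = 1 / of_nat (Suc d) * theta_form (\<Sum>e\<in>E. P e * cform (e, 0)) f"
      unfolding Q_def by (rule theta_form_scale_left[OF poly_fun_sum[OF pP] pf])
    also have "theta_form (\<Sum>e\<in>E. P e * cform (e, 0)) f = (\<Sum>e\<in>E. theta_form (P e * cform (e, 0)) f)"
      by (rule theta_form_sum_left[OF pP pf])
    also have "\<dots> = (\<Sum>e\<in>E. \<epsilon> (dir_deriv (e, 0) f * cform (e, 0)))"
      by (rule sum.cong[OF HOL.refl])
        (rule trans[OF theta_form_mult_cform[OF homogeneousD(1)[OF P(1)] pf]
            P(2)[OF dir_deriv_homogeneous[OF f]]])
    also have "\<dots> = \<epsilon> (\<Sum>e\<in>E. dir_deriv (e, 0) f * cform (e, 0))"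
      by (rule poly_functional_sum[OF Suc.prems pD, symmetric])
    also have "\<dots> = of_nat (Suc d) * \<epsilon> f"
      unfolding euler_homogeneous[OF E(2) f] by (rule poly_functionalD(2)[OF Suc.prems pf])
    finally show ?thesis by (simp del: of_nat_Suc)
  qed
  then show ?case using Q by blast
qed

text \<open>The chain rule: rescaling the variable of the argument amounts to rescaling that of the
  symbol.\<close>

lemma theta_rel_comp_cscale:
  assumes "theta_rel (f :: 'a cfun) A"
  shows "\<exists>A'. theta_rel (\<lambda>x. f (cscale c x)) A' \<and>
    (\<forall>h\<in>poly_fun. A (\<lambda>x. h (cscale c x)) = (\<lambda>x. A' h (cscale c x)))"
  using assms
proof induction
  case (const k)
  have "(\<lambda>_. k) * (\<lambda>x. h (cscale c x)) = (\<lambda>x. ((\<lambda>_. k) * h) (cscale c x))" for h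
    by (simp add: fun_eq_iff)
  then show ?case using theta_rel.const[of k] by blast
next
  case (cform a)
  have "(\<lambda>x. cform a (cscale c x)) = cform (cscale c a)"
    by (simp add: fun_eq_iff cform_cscale_right cform_cscale_left)
  moreover have "dir_deriv a (\<lambda>x. h (cscale c x)) = (\<lambda>x. dir_deriv (cscale c a) h (cscale c x))" for h
    by (simp add: dir_deriv_def fun_eq_iff cscale_add_right cscale_cscale mult.commute)
  ultimately show ?case using theta_rel.cform by metis
next
  case (add f A g B)
  then obtain A' B' where *: "theta_rel (\<lambda>x. f (cscale c x)) A'"
    "\<And>h. h\<in>poly_fun \<Longrightarrow> A (\<lambda>x. h (cscale c x)) = (\<lambda>x. A' h (cscale c x))"
    "theta_rel (\<lambda>x. g (cscale c x)) B'"
    "\<And>h. h\<in>poly_fun \<Longrightarrow> B (\<lambda>x. h (cscale c x)) = (\<lambda>x. B' h (cscale c x))" by blast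
  show ?case
    by (intro exI[of _ "\<lambda>h. A' h + B' h"] conjI ballI)
      (use theta_rel.add[OF *(1,3)] *(2,4) in \<open>auto simp: func_plus\<close>)
next
  case (mult f A g B)
  then obtain A' B' where *: "theta_rel (\<lambda>x. f (cscale c x)) A'"
    "\<And>h. h\<in>poly_fun \<Longrightarrow> A (\<lambda>x. h (cscale c x)) = (\<lambda>x. A' h (cscale c x))"
    "theta_rel (\<lambda>x. g (cscale c x)) B'"
    "\<And>h. h\<in>poly_fun \<Longrightarrow> B (\<lambda>x. h (cscale c x)) = (\<lambda>x. B' h (cscale c x))" by blast
  have "A (B (\<lambda>x. h (cscale c x))) = (\<lambda>x. A' (B' h) (cscale c x))" if "h \<in> poly_fun" for h
    unfolding *(4)[OF that] by (rule *(2)[OF theta_rel_linear(1)[OF *(3) that]])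
  then show ?case
    by (intro exI[of _ "\<lambda>h. A' (B' h)"] conjI ballI)
      (use theta_rel.mult[OF *(1,3)] in \<open>auto simp: func_times\<close>)
qed

text \<open>Rescaling by \<open>2\<close> can be moved from \<open>f\<close> to \<open>p\<close>,
  which multiplies the pairing by \<open>2 ^ k\<close> in one reading and by \<open>2 ^ d\<close> in
  the other.\<close>

lemma theta_form_orthogonal_degrees:
  assumes p: "homogeneous d (p :: 'a cfun)" and f: "homogeneous k f" and "d \<noteq> k"
  shows "theta_form p f = 0"
proof -
  have pp: "p \<in> poly_fun" and pf: "f \<in> poly_fun" using p f homogeneousD(1) by blast+
  obtain A where A: "theta_rel p A" using theta_rel_exists[OF pp] by blast
  obtain A' where A': "theta_rel (\<lambda>x. p (cscale 2 x)) A'"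
    "A (\<lambda>x. f (cscale 2 x)) = (\<lambda>x. A' f (cscale 2 x))"
    using theta_rel_comp_cscale[OF A] pf by blast
  have 1: "(\<lambda>x. p (cscale 2 x)) = (\<lambda>_. 2 ^ d) * p" "(\<lambda>x. f (cscale 2 x)) = (\<lambda>_. 2 ^ k) * f"
    using homogeneousD(2)[OF p] homogeneousD(2)[OF f] by (auto simp: fun_eq_iff)
  have "2 ^ k * theta_form p f = A (\<lambda>x. f (cscale 2 x)) 0"
    unfolding 1(2) theta_form_def Theta_theta_rel[OF A pf] theta_rel_linear(3)[OF A pf] by simp
  also have "\<dots> = Theta (\<lambda>x. p (cscale 2 x)) f 0"
    unfolding Theta_theta_rel[OF A'(1) pf] A'(2) by simp
  also have "\<dots> = 2 ^ d * theta_form p f"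
    unfolding 1(1) theta_form_def[symmetric] by (rule theta_form_scale_left[OF pp pf])
  finally show ?thesis using \<open>d \<noteq> k\<close> by (auto simp del: power_Suc)
      (metis norm_numeral norm_power of_nat_eq_iff of_nat_numeral of_nat_power power_inject_exp one_less_numeral_iff semiring_norm(76))
qed

text \<open>Concentration in one degree is essential: evaluation at a nonzero point, for example,
  would require an infinite series instead of a polynomial.\<close>

lemma graded_functional_representation:
  assumes \<epsilon>: "poly_functional \<epsilon>" and deg: "\<And>k f. homogeneous k f \<Longrightarrow> k \<noteq> d \<Longrightarrow> \<epsilon> f = 0"
  shows "\<exists>P\<in>poly_fun. \<forall>f\<in>poly_fun. theta_form P f = \<epsilon> f"
proof -
  obtain P where P: "homogeneous d P" "\<And>f. homogeneous d f \<Longrightarrow> theta_form P f = \<epsilon> f"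
    using homogeneous_functional_representation[OF \<epsilon>] by blast
  have "theta_form P f = \<epsilon> f" if "f \<in> poly_fun" for f
    using that
  proof (induction rule: homogeneous_induct)
    case (homogeneous k f)
    then show ?case using P(2) deg theta_form_orthogonal_degrees[OF P(1)] by metis
  next
    case (add f g)
    then show ?case
      by (simp only: theta_form_add_right[OF homogeneousD(1)[OF P(1)] add(1,2)] poly_functionalD(1)[OF \<epsilon>])
  qed
  then show ?thesis using P(1) homogeneousD(1) by blast
qed

text \<open>Evaluation at \<open>y\<close> is represented by a power series, formally the
  exponential of \<open>cform y\<close>, with homogeneous parts \<open>P d\<close>. On a fixed
  polynomial its partial sums evaluate correctly as soon as \<open>M\<close> is large, so a
  \<open>p\<close> orthogonal to all of them vanishes at \<open>y\<close>.\<close>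

lemma theta_form_nondegenerate:
  assumes p: "(p :: 'a cfun) \<in> poly_fun" and 0: "\<And>f. f \<in> poly_fun \<Longrightarrow> theta_form p f = 0"
  shows "p = 0"
proof
  fix y
  have ev: "poly_functional (\<lambda>f. f y)" by (simp add: poly_functional_def)
  obtain P where P: "\<And>d. homogeneous d (P d)" "\<And>d f. homogeneous d f \<Longrightarrow> theta_form (P d) f = f y"
    using homogeneous_functional_representation[OF ev] by metis
  have PP: "P d \<in> poly_fun" for d using homogeneousD(1)[OF P(1)] .
  have "\<exists>N. \<forall>M\<ge>N. theta_form (\<Sum>d\<le>M. P d) q = q y" if "q \<in> poly_fun" for q
    using that
  proof (induction rule: homogeneous_induct)
    case (homogeneous k f)
    have "theta_form (\<Sum>d\<le>M. P d) f = f y" if "M \<ge> k" for M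
    proof -
      have "theta_form (\<Sum>d\<le>M. P d) f = (\<Sum>d\<le>M. theta_form (P d) f)"
        by (rule theta_form_sum_left[OF PP homogeneousD(1)[OF homogeneous]])
      also have "\<dots> = (\<Sum>d\<le>M. if d = k then f y else 0)"
        using P(2)[OF homogeneous] theta_form_orthogonal_degrees[OF P(1) homogeneous]
        by (intro sum.cong) auto
      finally show ?thesis using that by simp
    qed
    then show ?case by blast
  next
    case (add f g)
    then obtain N N' where "\<And>M. M \<ge> N \<Longrightarrow> theta_form (\<Sum>d\<le>M. P d) f = f y"
      "\<And>M. M \<ge> N' \<Longrightarrow> theta_form (\<Sum>d\<le>M. P d) g = g y" by blast
    then have "theta_form (\<Sum>d\<le>M. P d) (f + g) = (f + g) y" if "M \<ge> max N N'" for M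
      unfolding theta_form_add_right[OF poly_fun_sum[OF PP] add(1,2)] using that by simp
    then show ?case by blast
  qed
  then obtain M where "theta_form (\<Sum>d\<le>M. P d) p = p y" using p by blast
  moreover have S: "(\<Sum>d\<le>M. P d) \<in> poly_fun" by (rule poly_fun_sum[OF PP])
  ultimately show "p y = 0 y"
    using theta_form_commute[OF S p] 0[OF S] by simp
qed

end

section \<open>Reflections and reduced words\<close>

lemma linear_refl_along: "linear (refl_along \<alpha>)"
  by (rule linearI)
    (simp_all add: refl_along_def inner_add_right algebra_simps add_divide_distrib)

text \<open>True also for \<open>\<alpha> = 0\<close>, since division by zero turns
  \<open>refl_along 0\<close> into the identity.\<close>

lemma refl_along_inner: "refl_along \<alpha> x \<bullet> refl_along \<alpha> y = x \<bullet> y"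
proof (cases "\<alpha> = 0")
  case False
  then have "\<alpha> \<bullet> \<alpha> \<noteq> 0" by simp
  then show ?thesis
    unfolding refl_along_def by (simp add: inner_diff_left inner_diff_right inner_commute field_simps)
qed (simp add: refl_along_def)

lemma refl_along_refl_along [simp]: "refl_along \<alpha> (refl_along \<alpha> x) = x"
proof (cases "\<alpha> = 0")
  case False
  then have "\<alpha> \<bullet> \<alpha> \<noteq> 0" by simp
  then show ?thesis
    unfolding refl_along_def
    by (simp add: inner_diff_right field_simps flip: scaleR_left.add)
qed (simp add: refl_along_def)

lemma refl_along_comp [simp]: "refl_along \<alpha> \<circ> refl_along \<alpha> = id"
  by (simp add: fun_eq_iff)

lemma refl_along_self: "\<alpha> \<noteq> 0 \<Longrightarrow> refl_along \<alpha> \<alpha> = - \<alpha>"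
  by (simp add: refl_along_def) (metis add_diff_cancel_left' scaleR_2 minus_diff_eq)

lemma refl_along_uminus [simp]: "refl_along (- \<alpha>) = refl_along \<alpha>"
  by (simp add: refl_along_def fun_eq_iff)

lemma bij_refl_along: "bij (refl_along \<alpha>)"
  by (rule o_bij[of "refl_along \<alpha>"]) simp_all

lemma inv_refl_along [simp]: "inv (refl_along \<alpha>) = refl_along \<alpha>"
  by (rule inv_unique_comp) simp_all

lemma orthogonal_transformation_refl_along: "orthogonal_transformation (refl_along \<alpha>)"
  by (simp add: orthogonal_transformation_def linear_refl_along refl_along_inner)

lemma orthogonal_transformation_refl_along_conj:
  assumes "orthogonal_transformation w"
  shows "w (refl_along \<gamma> x) = refl_along (w \<gamma>) (w x)"
  using assms unfolding orthogonal_transformation_def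
  by (simp add: refl_along_def linear_diff linear_cmul)

lemma word_prod_simps [simp]:
  "word_prod [] = id" "word_prod (\<alpha> # as) = refl_along \<alpha> \<circ> word_prod as"
  by (simp_all add: word_prod_def)

lemma word_prod_append: "word_prod (as @ bs) = word_prod as \<circ> word_prod bs"
  by (induction as) (auto simp: comp_assoc)

lemma word_prod_rev_comp: "word_prod as \<circ> word_prod (rev as) = id"
proof (induction as)
  case (Cons \<alpha> as)
  then have "word_prod as (word_prod (rev as) x) = x" for x by (metis comp_apply id_apply)
  then show ?case by (simp add: word_prod_append fun_eq_iff)
qed simp

lemma inv_word_prod: "inv (word_prod as) = word_prod (rev as)"
  using word_prod_rev_comp[of as] word_prod_rev_comp[of "rev as"] by (simp add: inv_unique_comp)

context
  fixes \<Psi> :: "'a::real_inner set"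
  assumes roots: "root_system \<Psi>"
begin

lemma root_nonzero: "\<alpha> \<in> \<Psi> \<Longrightarrow> \<alpha> \<noteq> 0"
  using roots unfolding root_system_def by blast

lemma root_scaleR:
  assumes "\<alpha> \<in> \<Psi>" "c *\<^sub>R \<alpha> \<in> \<Psi>"
  shows "c *\<^sub>R \<alpha> = \<alpha> \<or> c *\<^sub>R \<alpha> = - \<alpha>"
proof -
  have "(c *\<^sub>R \<alpha>, 0) = cscale (of_real c) (\<alpha>, 0)" by (simp add: cscale_def)
  then have "c *\<^sub>R \<alpha> \<in> {\<beta>\<in>\<Psi>. \<exists>c. (\<beta>, 0) = cscale c (\<alpha>, 0)}" using assms by blast
  then show ?thesis using roots assms unfolding root_system_def by blast
qed

lemma root_refl: "\<alpha> \<in> \<Psi> \<Longrightarrow> \<beta> \<in> \<Psi> \<Longrightarrow> refl_along \<alpha> \<beta> \<in> \<Psi>"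
  using roots unfolding root_system_def by blast

lemma weyl_group_orthogonal: "w \<in> weyl_group \<Psi> \<Longrightarrow> orthogonal_transformation w"
proof (induction rule: weyl_group.induct)
  case id
  show ?case unfolding id_def by (rule orthogonal_transformation_id)
next
  case (refl \<alpha> w)
  show ?case by (rule orthogonal_transformation_compose[OF orthogonal_transformation_refl_along refl.IH])
qed

lemma weyl_group_linear: "w \<in> weyl_group \<Psi> \<Longrightarrow> linear w"
  by (rule orthogonal_transformation_linear[OF weyl_group_orthogonal])

lemma weyl_group_bij: "w \<in> weyl_group \<Psi> \<Longrightarrow> bij w"
  by (induction rule: weyl_group.induct) (blast intro: bij_comp bij_refl_along bij_id)+

lemma weyl_group_root: "w \<in> weyl_group \<Psi> \<Longrightarrow> \<beta> \<in> \<Psi> \<Longrightarrow> w \<beta> \<in> \<Psi>"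
  by (induction rule: weyl_group.induct) (auto intro: root_refl)

lemma weyl_group_comp: "u \<in> weyl_group \<Psi> \<Longrightarrow> w \<in> weyl_group \<Psi> \<Longrightarrow> u \<circ> w \<in> weyl_group \<Psi>"
  by (induction rule: weyl_group.induct) (auto simp: comp_assoc intro: weyl_group.refl)

lemma weyl_group_refl_along: "\<alpha> \<in> \<Psi> \<Longrightarrow> refl_along \<alpha> \<in> weyl_group \<Psi>"
  using weyl_group.refl[OF _ weyl_group.id, of \<alpha> \<Psi>] by simp

lemma weyl_group_inv: "w \<in> weyl_group \<Psi> \<Longrightarrow> inv w \<in> weyl_group \<Psi>"
proof (induction rule: weyl_group.induct)
  case (refl \<alpha> w)
  have "inv (refl_along \<alpha> \<circ> w) = inv w \<circ> refl_along \<alpha>"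
    using o_inv_distrib[OF bij_refl_along weyl_group_bij[OF refl(2)]] by simp
  then show ?case using weyl_group_comp refl weyl_group_refl_along by metis
next
  case id
  show ?case unfolding inv_id by (rule weyl_group.id)
qed

lemma weyl_group_inv_f [simp]: "w \<in> weyl_group \<Psi> \<Longrightarrow> inv w (w x) = x"
  and weyl_group_f_inv [simp]: "w \<in> weyl_group \<Psi> \<Longrightarrow> w (inv w x) = x"
  using weyl_group_bij by (auto simp: bij_def surj_f_inv_f)

lemma weyl_group_inv_comp [simp]: "w \<in> weyl_group \<Psi> \<Longrightarrow> inv w \<circ> w = id"
  and weyl_group_comp_inv [simp]: "w \<in> weyl_group \<Psi> \<Longrightarrow> w \<circ> inv w = id"
  by (auto simp: fun_eq_iff)

text \<open>An element that fixes every root is the identity: \<open>w x - x\<close> lies in the span of the roots,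
  and \<open>w\<close> preserves inner products.\<close>

lemma weyl_group_eqI:
  assumes u: "u \<in> weyl_group \<Psi>" and w: "w \<in> weyl_group \<Psi>" and eq: "\<And>\<beta>. \<beta> \<in> \<Psi> \<Longrightarrow> u \<beta> = w \<beta>"
  shows "u = w"
proof -
  have fix_id: "v = id" if v: "v \<in> weyl_group \<Psi>" and fixed: "\<And>\<beta>. \<beta> \<in> \<Psi> \<Longrightarrow> v \<beta> = \<beta>" for v
  proof
    fix x
    have "v x - x \<in> span \<Psi>"
      using v
    proof (induction arbitrary: x rule: weyl_group.induct)
      case (refl \<alpha> w)
      have "(refl_along \<alpha> \<circ> w) x - x = (w x - x) - (2 * (\<alpha> \<bullet> w x) / (\<alpha> \<bullet> \<alpha>)) *\<^sub>R \<alpha>"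
        by (simp add: refl_along_def)
      then show ?case using refl by (metis span_base span_diff span_scale)
    qed (simp add: span_zero)
    moreover have "v y = y" if "y \<in> span \<Psi>" for y
      using linear_eq_on_span[OF weyl_group_linear[OF v] linear_id, of \<Psi> y] fixed that by simp
    ultimately have "v (v x - x) = v x - x" by blast
    then have "(v x - x) \<bullet> v x = (v x - x) \<bullet> x"
      using weyl_group_orthogonal[OF v] unfolding orthogonal_transformation_def by metis
    then have "(v x - x) \<bullet> (v x - x) = 0" by (simp add: inner_diff_right)
    then show "v x = id x" by simp
  qed
  have "inv w \<circ> u = id"
    by (rule fix_id) (use u w eq weyl_group_comp weyl_group_inv in auto)
  then have "w \<circ> (inv w \<circ> u) = w" by simp
  then show ?thesis unfolding comp_assoc[symmetric] using w by simp
qed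

lemma finite_weyl_group: "finite (weyl_group \<Psi>)"
proof -
  have fin: "finite \<Psi>" using roots by (simp add: root_system_def)
  have "finite ((\<lambda>w. restrict w \<Psi>) ` weyl_group \<Psi>)"
    by (rule finite_subset[of _ "\<Psi> \<rightarrow>\<^sub>E \<Psi>"]) (auto intro: finite_PiE fin weyl_group_root)
  moreover have "inj_on (\<lambda>w. restrict w \<Psi>) (weyl_group \<Psi>)"
    by (rule inj_onI) (metis weyl_group_eqI restrict_apply')
  ultimately show ?thesis by (rule finite_imageD)
qed

end

text \<open>Each entry pairs a word with one letter deleted with the root \<open>\<gamma>\<close> whose reflection, multiplied
  on the right, performs the deletion in the group.\<close>

fun deletions :: "'a::real_inner list \<Rightarrow> ('a \<times> 'a list) list" where
  "deletions [] = []"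
| "deletions (\<alpha> # as) = (inv (word_prod as) \<alpha>, as) # map (\<lambda>(\<gamma>, d). (\<gamma>, \<alpha> # d)) (deletions as)"

lemma length_deletions [simp]: "length (deletions as) = length as"
  by (induction as) auto

section \<open>Positive roots and words in the simple reflections\<close>

locale based_root_system = finite_dimensional_inner "TYPE('a)"
  for \<Psi> \<Omega> :: "'a::real_inner set" +
  assumes roots: "root_system \<Psi>" and base: "is_base \<Psi> \<Omega>"
begin

abbreviation "W \<equiv> weyl_group \<Psi>"
abbreviation "red_word \<equiv> reduced_word \<Omega>"
abbreviation bruhat_order (infix "\<sqsubset>" 50) where "bruhat_order \<equiv> bruhat_less \<Psi> \<Omega>"
abbreviation "pos \<equiv> positive_roots \<Psi> \<Omega>"

lemmas W_linear = weyl_group_linear[OF roots]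
  and W_bij = weyl_group_bij[OF roots]
  and W_root = weyl_group_root[OF roots]
  and W_comp = weyl_group_comp[OF roots]
  and W_refl = weyl_group_refl_along[OF roots]
  and W_inv = weyl_group_inv[OF roots]
  and W_inv_f [simp] = weyl_group_inv_f[OF roots]
  and W_f_inv [simp] = weyl_group_f_inv[OF roots]
  and W_id = weyl_group.id[of \<Psi>]

lemma finite_roots: "finite \<Psi>" using roots by (simp add: root_system_def)

lemma base_subset: "\<Omega> \<subseteq> \<Psi>" and independent_base: "independent \<Omega>"
  using base by (auto simp: is_base_def)

lemma finite_base: "finite \<Omega>" using base_subset finite_roots finite_subset by blast

lemma pos_subset: "pos \<subseteq> \<Psi>" by (auto simp: positive_roots_def)

lemma finite_pos: "finite pos" using pos_subset finite_roots finite_subset by blast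

lemma W_uminus: "w \<in> W \<Longrightarrow> w (- x) = - w x"
  using W_linear linear_neg by blast

lemma coordinates_exist:
  "\<exists>\<phi> :: 'a \<Rightarrow> 'a \<Rightarrow> real. \<forall>\<omega>. linear (\<phi> \<omega>) \<and> (\<forall>\<omega>'\<in>\<Omega>. \<phi> \<omega> \<omega>' = (if \<omega> = \<omega>' then 1 else 0))"
proof (intro choice allI)
  fix \<omega> :: 'a
  show "\<exists>f :: 'a \<Rightarrow> real. linear f \<and> (\<forall>\<omega>'\<in>\<Omega>. f \<omega>' = (if \<omega> = \<omega>' then 1 else 0))"
    by (rule linear_independent_extend[OF independent_base])
qed

text \<open>Coordinates with respect to the base, extended linearly to the whole space because the
  roots need not span it. Off the span of \<open>\<Omega>\<close> the extension is
  arbitrary.\<close>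

definition coord :: "'a \<Rightarrow> 'a \<Rightarrow> real" where
  "coord = (SOME \<phi>. \<forall>\<omega>. linear (\<phi> \<omega>) \<and> (\<forall>\<omega>'\<in>\<Omega>. \<phi> \<omega> \<omega>' = (if \<omega> = \<omega>' then 1 else 0)))"

lemma linear_coord: "linear (coord \<omega>)"
  and coord_base: "\<omega>' \<in> \<Omega> \<Longrightarrow> coord \<omega> \<omega>' = (if \<omega> = \<omega>' then 1 else 0)"
  using someI_ex[OF coordinates_exist] unfolding coord_def by blast+

lemma coord_sum: "\<omega> \<in> \<Omega> \<Longrightarrow> coord \<omega> (\<Sum>\<omega>\<in>\<Omega>. c \<omega> *\<^sub>R \<omega>) = c \<omega>"
  using finite_base
  by (simp add: linear_sum[OF linear_coord] linear_cmul[OF linear_coord] coord_base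
      if_distrib cong: if_cong)

lemma pos_expand:
  assumes "\<beta> \<in> pos"
  shows "\<beta> = (\<Sum>\<omega>\<in>\<Omega>. coord \<omega> \<beta> *\<^sub>R \<omega>)" and "\<omega> \<in> \<Omega> \<Longrightarrow> coord \<omega> \<beta> \<ge> 0"
proof -
  obtain c where c: "\<forall>\<omega>\<in>\<Omega>. c \<omega> \<ge> 0" "\<beta> = (\<Sum>\<omega>\<in>\<Omega>. c \<omega> *\<^sub>R \<omega>)"
    using assms by (auto simp: positive_roots_def)
  have "coord \<omega> \<beta> = c \<omega>" if "\<omega> \<in> \<Omega>" for \<omega> using coord_sum[OF that] c by simp
  then show "\<beta> = (\<Sum>\<omega>\<in>\<Omega>. coord \<omega> \<beta> *\<^sub>R \<omega>)" "\<omega> \<in> \<Omega> \<Longrightarrow> coord \<omega> \<beta> \<ge> 0"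
    using c by simp_all
qed

lemma pos_or_neg: "\<beta> \<in> \<Psi> \<Longrightarrow> \<beta> \<in> pos \<or> - \<beta> \<in> pos"
  using base by (auto simp: is_base_def)

lemma not_pos_and_neg: "\<beta> \<in> pos \<Longrightarrow> - \<beta> \<notin> pos"
proof
  assume *: "\<beta> \<in> pos" "- \<beta> \<in> pos"
  have "coord \<omega> \<beta> = 0" if "\<omega> \<in> \<Omega>" for \<omega>
    using pos_expand(2)[OF *(1) that] pos_expand(2)[OF *(2) that] linear_neg[OF linear_coord] by simp
  then have "\<beta> = 0" using pos_expand(1)[OF *(1)] by simp
  then show False using *(1) pos_subset root_nonzero[OF roots] by blast
qed

text \<open>All coordinates of a root have the same sign, so a single positive one decides.\<close>

lemma posI: "\<beta> \<in> \<Psi> \<Longrightarrow> \<omega> \<in> \<Omega> \<Longrightarrow> coord \<omega> \<beta> > 0 \<Longrightarrow> \<beta> \<in> pos"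
  using pos_or_neg[of \<beta>] pos_expand(2)[of "- \<beta>" \<omega>] linear_neg[OF linear_coord] by fastforce

lemma base_pos: "\<omega> \<in> \<Omega> \<Longrightarrow> \<omega> \<in> pos"
  using posI[of \<omega> \<omega>] base_subset coord_base by auto

text \<open>The reflection changes only the coordinate at \<open>\<alpha>\<close>. The only
  multiples of \<open>\<alpha>\<close> among the roots are \<open>\<alpha>\<close> and
  \<open>- \<alpha>\<close>, so \<open>\<beta>\<close> has a positive coordinate elsewhere, and it
  survives.\<close>

lemma simple_reflection_pos:
  assumes \<alpha>: "\<alpha> \<in> \<Omega>" and \<beta>: "\<beta> \<in> pos" "\<beta> \<noteq> \<alpha>"
  shows "refl_along \<alpha> \<beta> \<in> pos"
proof -
  have "\<exists>\<omega>\<in>\<Omega>. \<omega> \<noteq> \<alpha> \<and> coord \<omega> \<beta> > 0"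
  proof (rule ccontr)
    assume "\<not> ?thesis"
    then have 0: "coord \<omega> \<beta> = 0" if "\<omega> \<in> \<Omega>" "\<omega> \<noteq> \<alpha>" for \<omega>
      using pos_expand(2)[OF \<beta>(1) that(1)] that by force
    have "\<beta> = (\<Sum>\<omega>\<in>\<Omega>. if \<omega> = \<alpha> then coord \<alpha> \<beta> *\<^sub>R \<alpha> else 0)"
      by (subst pos_expand(1)[OF \<beta>(1)], rule sum.cong) (auto simp: 0)
    then have eq: "\<beta> = coord \<alpha> \<beta> *\<^sub>R \<alpha>" using finite_base \<alpha> by simp
    then have "\<beta> = \<alpha> \<or> \<beta> = - \<alpha>"
      using root_scaleR[OF roots, of \<alpha> "coord \<alpha> \<beta>"] \<alpha> \<beta>(1) base_subset pos_subset by auto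
    then show False using \<beta> not_pos_and_neg base_pos[OF \<alpha>] by auto
  qed
  then obtain \<omega> where \<omega>: "\<omega> \<in> \<Omega>" "\<omega> \<noteq> \<alpha>" "coord \<omega> \<beta> > 0" by blast
  have "coord \<omega> (refl_along \<alpha> \<beta>) = coord \<omega> \<beta>"
    using \<omega> \<alpha> by (simp add: refl_along_def linear_diff[OF linear_coord] linear_cmul[OF linear_coord] coord_base)
  then show ?thesis
    using posI[of "refl_along \<alpha> \<beta>" \<omega>] \<omega> root_refl[OF roots] \<alpha> \<beta> base_subset pos_subset by auto
qed

text \<open>The inner product with \<open>x\<close> is the height, the sum of the coordinates. It
  measures progress in \<open>pos_conjugate_simple\<close> and later provides the point
  \<open>dominant\<close>.\<close>

lemma dominant_vector_exists: "\<exists>x. (\<forall>\<beta>\<in>pos. x \<bullet> \<beta> > 0) \<and> (\<forall>\<omega>\<in>\<Omega>. x \<bullet> \<omega> = 1)"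
proof -
  obtain f :: "'a \<Rightarrow> real" where f: "linear f" "\<forall>\<omega>\<in>\<Omega>. f \<omega> = 1"
    using linear_independent_extend[OF independent_base, of "\<lambda>_. 1"] by blast
  obtain x where x: "\<And>y. f y = x \<bullet> y" using real_functional_inner[OF f(1)] by blast
  have "x \<bullet> \<beta> > 0" if \<beta>: "\<beta> \<in> pos" for \<beta>
  proof -
    have "\<beta> \<noteq> 0" using \<beta> pos_subset root_nonzero[OF roots] by blast
    then obtain \<omega> where "\<omega> \<in> \<Omega>" "coord \<omega> \<beta> \<noteq> 0"
      using pos_expand(1)[OF \<beta>] by (metis (no_types, lifting) scaleR_zero_left sum.neutral)
    then have "(\<Sum>\<omega>\<in>\<Omega>. coord \<omega> \<beta>) > 0"
      using pos_expand(2)[OF \<beta>] finite_base by (metis (no_types, lifting) less_le sum_pos2)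
    moreover have "x \<bullet> \<beta> = (\<Sum>\<omega>\<in>\<Omega>. coord \<omega> \<beta>)"
      using arg_cong[OF pos_expand(1)[OF \<beta>], of "\<lambda>y. x \<bullet> y"] f(2) x by (simp add: inner_sum_right)
    ultimately show ?thesis by simp
  qed
  then show ?thesis using f(2) x by metis
qed

lemma word_prod_in_W: "set as \<subseteq> \<Omega> \<Longrightarrow> word_prod as \<in> W"
  using base_subset by (induction as) (auto intro: weyl_group.id weyl_group.refl)

text \<open>Since \<open>\<beta> \<bullet> \<beta> > 0\<close>, some simple \<open>\<omega>\<close>
  with positive coordinate satisfies \<open>\<omega> \<bullet> \<beta> > 0\<close>, and reflecting
  in it lowers the height. Heights need not be integers, so the induction counts the positive roots
  of smaller height.\<close>

lemma pos_conjugate_simple: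
  assumes "\<beta> \<in> pos"
  shows "\<exists>as \<alpha>. set as \<subseteq> \<Omega> \<and> \<alpha> \<in> \<Omega> \<and> \<beta> = word_prod as \<alpha>"
proof -
  obtain x where x: "\<And>\<omega>. \<omega> \<in> \<Omega> \<Longrightarrow> x \<bullet> \<omega> = 1"
    using dominant_vector_exists by blast
  show ?thesis using assms
  proof (induction "card {\<gamma> \<in> pos. x \<bullet> \<gamma> < x \<bullet> \<beta>}" arbitrary: \<beta> rule: less_induct)
    case less
    show ?case
    proof (cases "\<beta> \<in> \<Omega>")
      case True
      then show ?thesis by (intro exI[of _ "[]"] exI[of _ \<beta>]) simp
    next
      case False
      have "\<exists>\<omega>\<in>\<Omega>. coord \<omega> \<beta> * (\<omega> \<bullet> \<beta>) > 0"
      proof (rule ccontr)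
        assume "\<not> ?thesis"
        then have "(\<Sum>\<omega>\<in>\<Omega>. coord \<omega> \<beta> * (\<omega> \<bullet> \<beta>)) \<le> 0" by (intro sum_nonpos) force
        then have "\<beta> \<bullet> \<beta> \<le> 0"
          using arg_cong[OF pos_expand(1)[OF less.prems], of "\<lambda>y. y \<bullet> \<beta>"] by (simp add: inner_sum_left)
        moreover have "\<beta> \<noteq> 0" using less.prems pos_subset root_nonzero[OF roots] by blast
        ultimately show False using inner_gt_zero_iff[of \<beta>] by linarith
      qed
      then obtain \<omega> where \<omega>: "\<omega> \<in> \<Omega>" "coord \<omega> \<beta> * (\<omega> \<bullet> \<beta>) > 0" by blast
      then have 1: "\<omega> \<bullet> \<beta> > 0" using pos_expand(2)[OF less.prems \<omega>(1)]
        by (simp add: zero_less_mult_iff)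
      have 2: "\<omega> \<bullet> \<omega> > 0" using \<omega>(1) base_subset root_nonzero[OF roots] by auto
      define \<gamma> where "\<gamma> = refl_along \<omega> \<beta>"
      have \<gamma>: "\<gamma> \<in> pos" unfolding \<gamma>_def using simple_reflection_pos \<omega>(1) less.prems False by metis
      have lt: "x \<bullet> \<gamma> < x \<bullet> \<beta>"
        using 1 2 x[OF \<omega>(1)] by (simp add: \<gamma>_def refl_along_def inner_diff_right)
      have "card {\<gamma>' \<in> pos. x \<bullet> \<gamma>' < x \<bullet> \<gamma>} < card {\<gamma> \<in> pos. x \<bullet> \<gamma> < x \<bullet> \<beta>}"
        by (rule psubset_card_mono) (use finite_pos \<gamma> lt in \<open>auto simp: psubset_eq\<close>)
      from less.hyps[OF this \<gamma>] obtain as \<alpha> where "set as \<subseteq> \<Omega>" "\<alpha> \<in> \<Omega>" "\<gamma> = word_prod as \<alpha>" by blast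
      moreover have "\<beta> = refl_along \<omega> \<gamma>" by (simp add: \<gamma>_def)
      ultimately show ?thesis using \<omega>(1) by (intro exI[of _ "\<omega> # as"] exI[of _ \<alpha>]) simp
    qed
  qed
qed

text \<open>The reflection in \<open>w \<alpha>\<close> is the conjugate by \<open>w\<close> of the
  reflection in \<open>\<alpha>\<close>, which gives the word
  \<open>as @ [\<alpha>] @ rev as\<close> for the reflection in an arbitrary root.\<close>

lemma W_words: "w \<in> W \<Longrightarrow> \<exists>as. set as \<subseteq> \<Omega> \<and> word_prod as = w"
proof (induction rule: weyl_group.induct)
  case id
  show ?case by (rule exI[of _ "[]"]) simp
next
  case (refl \<beta> w)
  then obtain bs where bs: "set bs \<subseteq> \<Omega>" "word_prod bs = w" by blast
  have "\<exists>as \<alpha>. set as \<subseteq> \<Omega> \<and> \<alpha> \<in> \<Omega> \<and> refl_along \<beta> = refl_along (word_prod as \<alpha>)"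
    using pos_or_neg[OF refl(1)] pos_conjugate_simple by (metis refl_along_uminus)
  then obtain as \<alpha> where as: "set as \<subseteq> \<Omega>" "\<alpha> \<in> \<Omega>" "refl_along \<beta> = refl_along (word_prod as \<alpha>)"
    by blast
  have "refl_along \<beta> x = word_prod (as @ [\<alpha>] @ rev as) x" for x
    using orthogonal_transformation_refl_along_conj[OF weyl_group_orthogonal[OF roots word_prod_in_W[OF as(1)]],
        of \<alpha> "word_prod (rev as) x"] fun_cong[OF word_prod_rev_comp[of as], of x]
    by (simp add: as(3) word_prod_append)
  then have "word_prod ((as @ [\<alpha>] @ rev as) @ bs) = refl_along \<beta> \<circ> w"
    unfolding word_prod_append[of _ bs] bs(2) by (simp add: fun_eq_iff)
  then show ?case using as bs by (intro exI[of _ "(as @ [\<alpha>] @ rev as) @ bs"]) auto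
qed

text \<open>For \<open>w = word_prod as\<close>, the reflection in \<open>inv w \<alpha>\<close> is
  the conjugate \<open>inv w \<circ> refl_along \<alpha> \<circ> w\<close>; multiplied on the right,
  it cancels a leading letter \<open>\<alpha>\<close>.\<close>

lemma deletions_props:
  assumes "set as \<subseteq> \<Omega>" "(\<gamma>, d) \<in> set (deletions as)"
  shows "\<gamma> \<in> \<Psi> \<and> set d \<subseteq> \<Omega> \<and> length as = Suc (length d) \<and> word_prod d = word_prod as \<circ> refl_along \<gamma>"
  using assms
proof (induction as arbitrary: \<gamma> d)
  case (Cons \<alpha> as)
  have w: "word_prod as \<in> W" using Cons.prems(1) word_prod_in_W by simp
  from Cons.prems(2) consider "\<gamma> = inv (word_prod as) \<alpha>" "d = as"
    | d' where "d = \<alpha> # d'" "(\<gamma>, d') \<in> set (deletions as)" by auto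
  then show ?case
  proof cases
    case 1
    have "refl_along \<alpha> (word_prod as (refl_along \<gamma> x)) = word_prod as x" for x
      using orthogonal_transformation_refl_along_conj[OF weyl_group_orthogonal[OF roots w], of \<gamma> x] w
      by (simp add: 1)
    then show ?thesis
      using 1 Cons.prems(1) w base_subset W_inv W_root by (auto simp: fun_eq_iff)
  next
    case 2
    then show ?thesis using Cons.IH[OF _ 2(2)] Cons.prems(1) by (auto simp: comp_assoc)
  qed
qed simp

section \<open>Inversions, length and the longest element\<close>

definition inversions :: "('a \<Rightarrow> 'a) \<Rightarrow> 'a set" where
  "inversions w = {\<gamma> \<in> pos. - w \<gamma> \<in> pos}"

lemma finite_inversions: "finite (inversions w)"
  using finite_pos by (simp add: inversions_def)

lemma W_pos_or_neg: "w \<in> W \<Longrightarrow> \<gamma> \<in> pos \<Longrightarrow> w \<gamma> \<in> pos \<or> - w \<gamma> \<in> pos"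
  using pos_or_neg W_root pos_subset by blast

text \<open>As the letters act one by one from the right, the image of \<open>\<gamma>\<close> must
  turn from positive to negative at some letter \<open>\<alpha>\<close>. A simple reflection does
  this only to its own root, so the image is \<open>\<alpha>\<close> just before, and deleting this
  letter is the entry for \<open>\<gamma>\<close>.\<close>

lemma strong_exchange:
  assumes "set as \<subseteq> \<Omega>" "\<gamma> \<in> inversions (word_prod as)"
  shows "\<exists>d. (\<gamma>, d) \<in> set (deletions as)"
  using assms
proof (induction as)
  case Nil
  then show ?case using not_pos_and_neg by (auto simp: inversions_def)
next
  case (Cons \<alpha> as)
  then have w: "word_prod as \<in> W" and \<alpha>: "\<alpha> \<in> \<Omega>" and \<gamma>: "\<gamma> \<in> pos"
    and neg: "- refl_along \<alpha> (word_prod as \<gamma>) \<in> pos"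
    using word_prod_in_W by (auto simp: inversions_def)
  show ?case
  proof (cases "- word_prod as \<gamma> \<in> pos")
    case True
    then show ?thesis using Cons \<gamma> by (force simp: inversions_def)
  next
    case False
    then have "word_prod as \<gamma> \<in> pos" using W_pos_or_neg[OF w \<gamma>] by blast
    then have "word_prod as \<gamma> = \<alpha>"
      using simple_reflection_pos[OF \<alpha>] neg not_pos_and_neg by blast
    then have "\<gamma> = inv (word_prod as) \<alpha>" using w by force
    then show ?thesis by auto
  qed
qed

lemma inversions_subset_deletions:
  "set as \<subseteq> \<Omega> \<Longrightarrow> inversions (word_prod as) \<subseteq> set (map fst (deletions as))"
  using strong_exchange by force

lemma card_inversions_le: "set as \<subseteq> \<Omega> \<Longrightarrow> card (inversions (word_prod as)) \<le> length as"
  using card_mono[OF _ inversions_subset_deletions, of as] card_length[of "map fst (deletions as)"]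
  by simp

lemma len_le: "set as \<subseteq> \<Omega> \<Longrightarrow> len \<Omega> (word_prod as) \<le> length as"
  unfolding len_def by (rule Least_le) blast

lemma reduced_word_exists: "w \<in> W \<Longrightarrow> \<exists>as. red_word w as"
proof -
  assume "w \<in> W"
  then have "\<exists>n as. set as \<subseteq> \<Omega> \<and> length as = n \<and> word_prod as = w" using W_words by blast
  then show ?thesis unfolding reduced_word_def len_def by (rule LeastI2_ex) blast
qed

text \<open>All old inversions persist and \<open>inv w \<alpha>\<close> becomes a new one.\<close>

lemma card_inversions_simple_comp:
  assumes w: "w \<in> W" and \<alpha>: "\<alpha> \<in> \<Omega>" and \<gamma>: "inv w \<alpha> \<in> pos"
  shows "Suc (card (inversions w)) \<le> card (inversions (refl_along \<alpha> \<circ> w))"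
proof -
  define \<gamma> where "\<gamma> = inv w \<alpha>"
  have w\<gamma>: "w \<gamma> = \<alpha>" using w by (simp add: \<gamma>_def)
  have pos\<gamma>: "\<gamma> \<in> pos" using \<gamma> by (simp add: \<gamma>_def)
  have "\<gamma> \<notin> inversions w" using w\<gamma> not_pos_and_neg base_pos[OF \<alpha>] by (auto simp: inversions_def)
  moreover have "inversions w \<subseteq> inversions (refl_along \<alpha> \<circ> w)"
  proof
    fix \<delta> assume "\<delta> \<in> inversions w"
    then have \<delta>: "\<delta> \<in> pos" "- w \<delta> \<in> pos" by (auto simp: inversions_def)
    have "- w \<delta> \<noteq> \<alpha>"
    proof
      assume "- w \<delta> = \<alpha>"
      then have "w (- \<delta>) = w \<gamma>" using W_uminus[OF w] w\<gamma> by simp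
      then have "- \<delta> = \<gamma>" using W_inv_f[OF w] by metis
      then show False using \<delta>(1) pos\<gamma> not_pos_and_neg by force
    qed
    then have "refl_along \<alpha> (- w \<delta>) \<in> pos" using simple_reflection_pos[OF \<alpha> \<delta>(2)] by blast
    then show "\<delta> \<in> inversions (refl_along \<alpha> \<circ> w)"
      using \<delta>(1) by (simp add: inversions_def linear_neg[OF linear_refl_along])
  qed
  moreover have "\<gamma> \<in> inversions (refl_along \<alpha> \<circ> w)"
    using pos\<gamma> w\<gamma> base_pos[OF \<alpha>] root_nonzero[OF roots, of \<alpha>] \<alpha> base_subset
    by (auto simp: inversions_def refl_along_self)
  ultimately have "card (insert \<gamma> (inversions w)) \<le> card (inversions (refl_along \<alpha> \<circ> w))"
    by (intro card_mono finite_inversions) auto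
  then show ?thesis using \<open>\<gamma> \<notin> inversions w\<close> finite_inversions by simp
qed

text \<open>Does the work of the parity of the length. If \<open>inv w \<alpha>\<close> is negative,
  the previous lemma applies to \<open>refl_along \<alpha> \<circ> w\<close> instead of
  \<open>w\<close>.\<close>

lemma card_inversions_simple_comp_neq:
  assumes w: "w \<in> W" and \<alpha>: "\<alpha> \<in> \<Omega>"
  shows "card (inversions (refl_along \<alpha> \<circ> w)) \<noteq> card (inversions w)"
proof (cases "inv w \<alpha> \<in> pos")
  case True
  then show ?thesis using card_inversions_simple_comp[OF w \<alpha>] by simp
next
  case False
  have sw: "refl_along \<alpha> \<circ> w \<in> W" using w \<alpha> base_subset weyl_group.refl by blast
  have "inv (refl_along \<alpha> \<circ> w) \<alpha> = inv w (refl_along \<alpha> \<alpha>)"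
    using o_inv_distrib[OF bij_refl_along W_bij[OF w], of \<alpha>] by simp
  also have "\<dots> = - inv w \<alpha>"
    using root_nonzero[OF roots] \<alpha> base_subset W_uminus[OF W_inv[OF w]] by (auto simp: refl_along_self)
  finally have "inv (refl_along \<alpha> \<circ> w) \<alpha> \<in> pos"
    using False W_pos_or_neg[OF W_inv[OF w] base_pos[OF \<alpha>]] by simp
  from card_inversions_simple_comp[OF sw \<alpha> this] show ?thesis
    by (simp add: comp_assoc[symmetric] del: comp_apply)
qed

lemma reduced_word_card_inversions:
  assumes "red_word w as"
  shows "card (inversions w) = length as"
  using assms
proof (induction as arbitrary: w)
  case Nil
  then have "w = word_prod []" by (simp only: reduced_word_def)
  then show ?case using card_inversions_le[of "[]"] by (simp only: list.set empty_subsetI list.size le_zero_eq)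
next
  case (Cons \<alpha> as)
  define w' where "w' = word_prod as"
  have \<alpha>: "\<alpha> \<in> \<Omega>" and as: "set as \<subseteq> \<Omega>" and w: "w = refl_along \<alpha> \<circ> w'" and len: "len \<Omega> w = Suc (length as)"
    using Cons.prems by (auto simp: reduced_word_def w'_def)
  have w': "w' \<in> W" unfolding w'_def by (rule word_prod_in_W[OF as])
  have minimal: "length as < length bs" if "set bs \<subseteq> \<Omega>" "word_prod bs = w" for bs
    using len_le[OF that(1)] that(2) len by simp
  obtain bs where bs: "red_word w' bs" using reduced_word_exists[OF w'] by blast
  have "length as < length (\<alpha> # bs)"
    by (rule minimal) (use bs \<alpha> w in \<open>auto simp: reduced_word_def\<close>)
  then have "red_word w' as"
    using bs as len_le[OF as] by (simp add: reduced_word_def w'_def)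
  then have IH: "card (inversions w') = length as" by (rule Cons.IH)
  define \<gamma> where "\<gamma> = inv w' \<alpha>"
  have w\<gamma>: "w' \<gamma> = \<alpha>" using w' by (simp add: \<gamma>_def)
  have \<gamma>root: "\<gamma> \<in> \<Psi>" unfolding \<gamma>_def using W_root W_inv w' \<alpha> base_subset by blast
  \<comment> \<open>Otherwise strong exchange deletes a letter of \<open>as\<close> and yields a
    word for \<open>w\<close> even shorter than \<open>as\<close>.\<close>
  have "- \<gamma> \<notin> pos"
  proof
    assume neg: "- \<gamma> \<in> pos"
    then have "- \<gamma> \<in> inversions w'"
      using w\<gamma> W_uminus[OF w'] base_pos[OF \<alpha>] by (simp add: inversions_def)
    then obtain d where d: "(- \<gamma>, d) \<in> set (deletions as)"
      using strong_exchange[OF as] unfolding w'_def by blast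
    have "w' (refl_along \<gamma> x) = refl_along \<alpha> (w' x)" for x
      using orthogonal_transformation_refl_along_conj[OF weyl_group_orthogonal[OF roots w'], of \<gamma> x]
      by (simp add: w\<gamma>)
    then have "word_prod d = w"
      using deletions_props[OF as d] w by (simp add: w'_def fun_eq_iff)
    then show False using minimal[of d] deletions_props[OF as d] by simp
  qed
  then have \<gamma>: "\<gamma> \<in> pos" using pos_or_neg[OF \<gamma>root] by blast
  then have "card (inversions w) \<ge> Suc (length as)"
    using card_inversions_simple_comp[OF w' \<alpha>] IH w by (simp add: \<gamma>_def)
  moreover have "card (inversions w) \<le> Suc (length as)"
    using card_inversions_le[of "\<alpha> # as"] \<alpha> as w by (simp add: w'_def)
  ultimately show ?case by simp
qed

lemma len_eq_card_inversions: "w \<in> W \<Longrightarrow> len \<Omega> w = card (inversions w)"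
  using reduced_word_exists reduced_word_card_inversions by (metis reduced_word_def)

lemma reduced_word_iff:
  "red_word w as \<longleftrightarrow> set as \<subseteq> \<Omega> \<and> word_prod as = w \<and> length as = card (inversions w)"
  using len_eq_card_inversions word_prod_in_W unfolding reduced_word_def by metis

text \<open>A reduced word has as many deletions as \<open>w\<close> has inversions, so counting
  turns the inclusion given by strong exchange into an equality without repetitions. In particular
  the roots attached to the deletions are positive.\<close>

lemma reduced_word_deletions:
  assumes "red_word w as"
  shows "distinct (map fst (deletions as))" and "set (map fst (deletions as)) = inversions w"
proof -
  have as: "set as \<subseteq> \<Omega>" "word_prod as = w" and card: "card (inversions w) = length as"
    using assms reduced_word_iff by auto
  have sub: "inversions w \<subseteq> set (map fst (deletions as))"
    using inversions_subset_deletions[OF as(1)] as(2) by simp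
  have "card (set (map fst (deletions as))) \<le> card (inversions w)"
    using card_length[of "map fst (deletions as)"] card by simp
  then show eq: "set (map fst (deletions as)) = inversions w"
    using sub by (intro card_seteq[symmetric]) auto
  show "distinct (map fst (deletions as))"
    by (rule card_distinct) (simp add: eq card flip: set_map)
qed

lemma inversions_empty: "w \<in> W \<Longrightarrow> card (inversions w) = 0 \<Longrightarrow> w = id"
  using reduced_word_exists reduced_word_card_inversions
  by (metis reduced_word_def word_prod_simps(1) length_0_conv)

lemma reduced_word_tl: "red_word w (\<alpha> # as) \<Longrightarrow> red_word (word_prod as) as"
proof -
  assume red: "red_word w (\<alpha> # as)"
  then have as: "set as \<subseteq> \<Omega>" "\<alpha> \<in> \<Omega>" by (auto simp: reduced_word_def)
  obtain bs where bs: "red_word (word_prod as) bs"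
    using reduced_word_exists word_prod_in_W as by blast
  then have "len \<Omega> w \<le> Suc (length bs)"
    using len_le[of "\<alpha> # bs"] red as by (auto simp: reduced_word_def)
  then show ?thesis using red bs len_le[OF as(1)] by (auto simp: reduced_word_def)
qed

lemma inversions_inv:
  assumes w: "w \<in> W"
  shows "card (inversions (inv w)) = card (inversions w)"
proof (rule bij_betw_same_card[symmetric], rule bij_betwI[where g = "\<lambda>\<gamma>. - inv w \<gamma>"])
  show "(\<lambda>\<gamma>. - w \<gamma>) \<in> inversions w \<rightarrow> inversions (inv w)"
    using w W_uminus[OF W_inv[OF w]] by (auto simp: inversions_def)
  show "(\<lambda>\<gamma>. - inv w \<gamma>) \<in> inversions (inv w) \<rightarrow> inversions w"
    using w W_uminus[OF w] by (auto simp: inversions_def)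
qed (use w W_uminus[OF w] W_uminus[OF W_inv[OF w]] in auto)

text \<open>Take \<open>w\<close> with the most inversions. If it kept a simple
  \<open>\<alpha>\<close> positive, \<open>w \<circ> refl_along \<alpha>\<close> would have one
  more. So it makes the base negative, and hence, by linearity, all positive roots.\<close>

lemma longest_exists: "\<exists>w\<in>W. inversions w = pos"
proof -
  obtain w where w: "w \<in> W" "\<And>u. u \<in> W \<Longrightarrow> card (inversions u) \<le> card (inversions w)"
  proof -
    let ?S = "(\<lambda>w. card (inversions w)) ` W"
    have S: "finite ?S" "?S \<noteq> {}" using finite_weyl_group[OF roots] W_id by blast+
    obtain w where "w \<in> W" "Max ?S = card (inversions w)" using Max_in[OF S] by blast
    then show ?thesis using that Max_ge[OF S(1)] by (metis imageI)
  qed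
  have neg: "- w \<alpha> \<in> pos" if \<alpha>: "\<alpha> \<in> \<Omega>" for \<alpha>
  proof (rule ccontr)
    assume "- w \<alpha> \<notin> pos"
    then have pos: "w \<alpha> \<in> pos" using W_pos_or_neg[OF w(1) base_pos[OF \<alpha>]] by blast
    have \<alpha>0: "\<alpha> \<noteq> 0" using \<alpha> base_subset root_nonzero[OF roots] by blast
    have notin: "\<alpha> \<notin> inversions w" using pos not_pos_and_neg by (auto simp: inversions_def)
    have "insert \<alpha> (refl_along \<alpha> ` inversions w) \<subseteq> inversions (w \<circ> refl_along \<alpha>)"
      using pos \<alpha> \<alpha>0 notin base_pos[OF \<alpha>] simple_reflection_pos[OF \<alpha>] W_uminus[OF w(1)]
      by (auto simp: inversions_def refl_along_self)
    moreover have "\<alpha> \<notin> refl_along \<alpha> ` inversions w"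
    proof
      assume "\<alpha> \<in> refl_along \<alpha> ` inversions w"
      then obtain y where "y \<in> inversions w" "\<alpha> = refl_along \<alpha> y" by blast
      then have "refl_along \<alpha> \<alpha> \<in> inversions w" by (metis refl_along_refl_along)
      then show False using \<alpha>0 not_pos_and_neg[OF base_pos[OF \<alpha>]] by (simp add: refl_along_self inversions_def)
    qed
    moreover have "inj_on (refl_along \<alpha>) (inversions w)"
      using bij_refl_along bij_is_inj inj_on_subset by blast
    ultimately have "Suc (card (inversions w)) \<le> card (inversions (w \<circ> refl_along \<alpha>))"
      using card_mono[OF finite_inversions, of "insert \<alpha> (refl_along \<alpha> ` inversions w)"] finite_inversions
      by (simp add: card_image)
    moreover have "w \<circ> refl_along \<alpha> \<in> W" using w W_comp W_refl \<alpha> base_subset by blast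
    ultimately show False using w(2) by fastforce
  qed
  have "- w \<beta> \<in> pos" if \<beta>: "\<beta> \<in> pos" for \<beta>
  proof -
    have "- w \<beta> = (\<Sum>\<omega>\<in>\<Omega>. coord \<omega> \<beta> *\<^sub>R (- w \<omega>))"
      using arg_cong[OF pos_expand(1)[OF \<beta>], of w] W_linear[OF w(1)]
      by (simp add: linear_sum linear_cmul sum_negf)
    then have "coord \<omega>' (- w \<beta>) = (\<Sum>\<omega>\<in>\<Omega>. coord \<omega> \<beta> * coord \<omega>' (- w \<omega>))" for \<omega>'
      by (simp only: linear_sum[OF linear_coord] linear_cmul[OF linear_coord] real_scaleR_def)
    then have ge: "coord \<omega>' (- w \<beta>) \<ge> 0" if "\<omega>' \<in> \<Omega>" for \<omega>'
      using that pos_expand(2) \<beta> neg by (auto intro!: sum_nonneg mult_nonneg_nonneg)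
    show ?thesis
    proof (rule ccontr)
      assume "- w \<beta> \<notin> pos"
      then have p: "w \<beta> \<in> pos" using W_pos_or_neg[OF w(1) \<beta>] by blast
      have "coord \<omega> (w \<beta>) = 0" if "\<omega> \<in> \<Omega>" for \<omega>
        using ge[OF that] pos_expand(2)[OF p that] linear_neg[OF linear_coord] by simp
      then have "w \<beta> = 0" using pos_expand(1)[OF p] by simp
      then show False using p pos_subset root_nonzero[OF roots] by blast
    qed
  qed
  then show ?thesis using w(1) by (auto simp: inversions_def)
qed

lemma inversions_pos_unique:
  assumes "u \<in> W" "w \<in> W" "inversions u = pos" "inversions w = pos"
  shows "u = w"
proof -
  have neg: "- u \<gamma> \<in> pos" "- w \<gamma> \<in> pos" if "\<gamma> \<in> pos" for \<gamma>
    using that assms(3,4) by (auto simp: inversions_def)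
  have inj: "inj_on (\<lambda>\<gamma>. - w \<gamma>) pos"
    using W_bij[OF assms(2)] by (auto simp: inj_on_def bij_def)
  have surj: "(\<lambda>\<gamma>. - w \<gamma>) ` pos = pos"
    by (rule endo_inj_surj[OF finite_pos _ inj]) (use neg in blast)
  have "inv w (- \<gamma>) \<in> pos" if "\<gamma> \<in> pos" for \<gamma>
  proof -
    have "\<gamma> \<in> (\<lambda>\<gamma>. - w \<gamma>) ` pos" using that by (simp only: surj)
    then obtain \<gamma>' where "\<gamma>' \<in> pos" "\<gamma> = - w \<gamma>'" by blast
    then show ?thesis using assms(2) by simp
  qed
  then have "inv w (u \<gamma>) \<in> pos" if "\<gamma> \<in> pos" for \<gamma>
    using neg(1)[OF that] by fastforce
  then have "inversions (inv w \<circ> u) = {}" using not_pos_and_neg by (auto simp: inversions_def)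
  then have "inv w \<circ> u = id" using inversions_empty W_comp W_inv assms by (metis card.empty)
  then have "w \<circ> (inv w \<circ> u) = w" by simp
  then show ?thesis unfolding comp_assoc[symmetric] using assms(2) weyl_group_comp_inv[OF roots] by simp
qed

abbreviation "w\<^sub>0 \<equiv> longest \<Psi> \<Omega>"

lemma card_inversions_eq_imp: "card (inversions w) = card pos \<Longrightarrow> inversions w = pos"
  by (rule card_subset_eq[OF finite_pos]) (auto simp: inversions_def)

lemma card_inversions_le_pos: "card (inversions w) \<le> card pos"
  by (rule card_mono[OF finite_pos]) (auto simp: inversions_def)

lemma longest_props: "w\<^sub>0 \<in> W" "inversions w\<^sub>0 = pos"
proof -
  obtain u where u: "u \<in> W" "inversions u = pos" using longest_exists by blast
  have "w\<^sub>0 = u"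
    unfolding longest_def
  proof (rule the_equality)
    show "u \<in> W \<and> (\<forall>\<sigma>\<in>W. len \<Omega> \<sigma> \<le> len \<Omega> u)"
      using u card_inversions_le_pos by (simp add: len_eq_card_inversions)
    fix w assume w: "w \<in> W \<and> (\<forall>\<sigma>\<in>W. len \<Omega> \<sigma> \<le> len \<Omega> w)"
    then have "card pos \<le> card (inversions w)" using u len_eq_card_inversions by metis
    then have "inversions w = pos" using card_inversions_eq_imp card_inversions_le_pos le_antisym by blast
    then show "w = u" using inversions_pos_unique u w by blast
  qed
  then show "w\<^sub>0 \<in> W" "inversions w\<^sub>0 = pos" using u by auto
qed

lemma longest_unique: "w \<in> W \<Longrightarrow> card (inversions w) = card pos \<Longrightarrow> w = w\<^sub>0"
  using inversions_pos_unique longest_props card_inversions_eq_imp by blast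

text \<open>The map \<open>\<gamma> \<mapsto> - w\<^sub>0 \<gamma>\<close> permutes the positive
  roots and carries the inversions of \<open>inv w \<circ> w\<^sub>0\<close> to the complement of
  those of \<open>inv w\<close>. This is what gives \<open>\<SS> w\<close> the degree l(w).\<close>

lemma card_inversions_inv_longest:
  assumes w: "w \<in> W"
  shows "card (inversions (inv w \<circ> w\<^sub>0)) + card (inversions w) = card pos"
proof -
  have neg: "- w\<^sub>0 \<gamma> \<in> pos" if "\<gamma> \<in> pos" for \<gamma>
    using that longest_props(2) by (auto simp: inversions_def)
  have inj: "inj_on (\<lambda>\<gamma>. - w\<^sub>0 \<gamma>) pos"
    using W_bij[OF longest_props(1)] by (auto simp: inj_on_def bij_def)
  have surj: "(\<lambda>\<gamma>. - w\<^sub>0 \<gamma>) ` pos = pos"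
    by (rule endo_inj_surj[OF finite_pos _ inj]) (use neg in blast)
  have "(\<lambda>\<gamma>. - w\<^sub>0 \<gamma>) ` inversions (inv w \<circ> w\<^sub>0) = pos - inversions (inv w)"
  proof (intro equalityI subsetI)
    fix \<delta> assume "\<delta> \<in> (\<lambda>\<gamma>. - w\<^sub>0 \<gamma>) ` inversions (inv w \<circ> w\<^sub>0)"
    then obtain \<gamma> where \<gamma>: "\<gamma> \<in> pos" "- inv w (w\<^sub>0 \<gamma>) \<in> pos" "\<delta> = - w\<^sub>0 \<gamma>" by (auto simp: inversions_def)
    then have "inv w \<delta> \<in> pos" using W_uminus[OF W_inv[OF w]] by simp
    then show "\<delta> \<in> pos - inversions (inv w)" using \<gamma> neg not_pos_and_neg by (auto simp: inversions_def)
  next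
    fix \<delta> assume \<delta>: "\<delta> \<in> pos - inversions (inv w)"
    then have "\<delta> \<in> (\<lambda>\<gamma>. - w\<^sub>0 \<gamma>) ` pos" by (simp only: surj Diff_iff)
    then obtain \<gamma> where \<gamma>: "\<gamma> \<in> pos" "\<delta> = - w\<^sub>0 \<gamma>" by blast
    have "inv w \<delta> \<in> pos" using \<delta> W_pos_or_neg[OF W_inv[OF w], of \<delta>] by (auto simp: inversions_def)
    then have "\<gamma> \<in> inversions (inv w \<circ> w\<^sub>0)"
      using \<gamma> W_uminus[OF W_inv[OF w]] by (simp add: inversions_def)
    then show "\<delta> \<in> (\<lambda>\<gamma>. - w\<^sub>0 \<gamma>) ` inversions (inv w \<circ> w\<^sub>0)" using \<gamma> by blast
  qed
  moreover have "inversions (inv w \<circ> w\<^sub>0) \<subseteq> pos" by (auto simp: inversions_def)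
  ultimately have "card (inversions (inv w \<circ> w\<^sub>0)) = card (pos - inversions (inv w))"
    by (metis card_image inj inj_on_subset)
  also have "\<dots> = card pos - card (inversions w)"
    using card_Diff_subset[OF finite_inversions, of "inv w" pos] inversions_inv[OF w]
    by (auto simp: inversions_def)
  finally show ?thesis using card_inversions_le_pos[of w] by simp
qed

end

section \<open>Divided differences\<close>

lemma act_simps [simp]:
  "act w (f + g) = act w f + act w g"
  "act w (f * g) = act w f * act w g"
  "act w (f - g) = act w f - act w g"
  "act w (\<lambda>_. c) = (\<lambda>_. c)"
  by (simp_all add: act_def fun_eq_iff)

lemma act_id [simp]: "act id f = f"
  by (simp add: act_def map_prod.id)

lemma act_comp: "bij u \<Longrightarrow> bij w \<Longrightarrow> act (u \<circ> w) f = act u (act w f)"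
  by (simp add: act_def o_inv_distrib fun_eq_iff map_prod_def split_beta)

lemma act_refl_along: "act (refl_along \<alpha>) f = f \<circ> map_prod (refl_along \<alpha>) (refl_along \<alpha>)"
  by (simp add: act_def)

lemma cform_orthogonal:
  "orthogonal_transformation w \<Longrightarrow> cform (map_prod w w a) (map_prod w w x) = cform a x"
  by (simp add: cform_def orthogonal_transformation_def)

lemma act_cform:
  assumes "orthogonal_transformation w" "bij w"
  shows "act w (cform a) = cform (map_prod w w a)"
proof
  fix x
  have "map_prod w w (map_prod (inv w) (inv w) x) = x"
    using assms(2) by (simp add: map_prod_def split_beta bij_is_surj surj_f_inv_f)
  then show "act w (cform a) x = cform (map_prod w w a) x"
    using cform_orthogonal[OF assms(1), of a "map_prod (inv w) (inv w) x"] by (simp add: act_def)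
qed

lemma map_prod_cscale: "linear w \<Longrightarrow> map_prod w w (cscale c x) = cscale c (map_prod w w x)"
  by (simp add: cscale_def linear_diff linear_add linear_cmul)

text \<open>The value of the linear function \<open>cform a\<close> at the coroot of
  \<open>\<gamma>\<close>.\<close>

definition root_pairing :: "'a::real_inner \<Rightarrow> 'a cfun" where
  "root_pairing \<gamma> a = 2 * cform a (\<gamma>, 0) / of_real (\<gamma> \<bullet> \<gamma>)"

lemma root_pairing_orthogonal:
  assumes "orthogonal_transformation w"
  shows "root_pairing (w \<gamma>) (map_prod w w a) = root_pairing \<gamma> a"
proof -
  have "w 0 = 0" using assms linear_0 orthogonal_transformation_linear by blast
  then show ?thesis
    using cform_orthogonal[OF assms, of a "(\<gamma>, 0)"] assms
    by (simp add: root_pairing_def orthogonal_transformation_def)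
qed

lemma root_fun_add: "root_fun \<alpha> (x + y) = root_fun \<alpha> x + root_fun \<alpha> y"
  and root_fun_cscale: "root_fun \<alpha> (cscale c x) = c * root_fun \<alpha> x"
  by (simp_all add: root_fun_def cform_add_right cform_cscale_right)

lemma root_fun_self: "root_fun \<alpha> (\<alpha>, 0) = of_real (\<alpha> \<bullet> \<alpha>)"
  by (simp add: root_fun_def cform_def complex_eq_iff)

lemma root_fun_in_poly_fun [intro, simp]: "root_fun \<alpha> \<in> poly_fun"
  by (simp add: root_fun_def)

lemma cform_refl_along:
  "cform a x - cform a (map_prod (refl_along \<alpha>) (refl_along \<alpha>) x) = root_fun \<alpha> x * root_pairing \<alpha> a"
proof (cases "\<alpha> = 0")
  case True
  then have "refl_along \<alpha> = id" by (simp add: fun_eq_iff refl_along_def)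
  then show ?thesis using True by (simp add: map_prod.id root_fun_def cform_def complex_eq_iff)
next
  case False
  have "map_prod (refl_along \<alpha>) (refl_along \<alpha>) x =
      x + cscale (- (2 * root_fun \<alpha> x / of_real (\<alpha> \<bullet> \<alpha>))) (\<alpha>, 0)"
    using False
    by (cases x) (simp add: refl_along_def cscale_def root_fun_def cform_def Re_divide_of_real Im_divide_of_real)
  then show ?thesis by (simp add: cform_add_right cform_cscale_right root_pairing_def)
qed

context finite_dimensional_inner
begin

lemma act_poly_fun:
  assumes "orthogonal_transformation w" "bij w"
  shows "(f :: 'a cfun) \<in> poly_fun \<Longrightarrow> act w f \<in> poly_fun"
proof (induction rule: poly_fun_induct)
  case (cform a)
  then show ?case unfolding act_cform[OF assms] by simp
next
  case (add f g) then show ?case unfolding act_simps by blast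
next
  case (mult f g) then show ?case unfolding act_simps by blast
qed simp

lemma act_refl_along_poly_fun [intro]:
  "(f :: 'a cfun) \<in> poly_fun \<Longrightarrow> act (refl_along \<alpha>) f \<in> poly_fun"
  by (rule act_poly_fun[OF orthogonal_transformation_refl_along bij_refl_along])

text \<open>Pointwise cancellation fails on the hyperplane of \<open>\<alpha>\<close>. Moving off
  \<open>x\<close> in the direction \<open>\<alpha>\<close> leaves the hyperplane, and continuity
  recovers the value at \<open>x\<close>.\<close>

lemma root_fun_mult_cancel:
  assumes \<alpha>: "(\<alpha> :: 'a) \<noteq> 0" and q: "q \<in> poly_fun" "q' \<in> poly_fun" and eq: "root_fun \<alpha> * q = root_fun \<alpha> * q'"
  shows "q = q'"
proof
  fix x
  let ?g = "\<lambda>t. q (x + cscale t (\<alpha>, 0))" and ?g' = "\<lambda>t. q' (x + cscale t (\<alpha>, 0))"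
  have lim: "?g \<midarrow>0\<rightarrow> q x" "?g' \<midarrow>0\<rightarrow> q' x"
    using poly_fun_line_isCont[OF q(1), where x = x and a = "(\<alpha>, 0)" and s = 0]
      poly_fun_line_isCont[OF q(2), where x = x and a = "(\<alpha>, 0)" and s = 0]
    by (simp_all add: isCont_def)
  have "\<forall>\<^sub>F t in at 0. ?g t = ?g' t"
    using eventually_neq_at_within[of "- root_fun \<alpha> x / of_real (\<alpha> \<bullet> \<alpha>)" 0 UNIV]
  proof eventually_elim
    case (elim t)
    then have "root_fun \<alpha> (x + cscale t (\<alpha>, 0)) \<noteq> 0"
      using \<alpha> by (auto simp: root_fun_add root_fun_cscale root_fun_self field_simps add_eq_0_iff)
    then show ?case using fun_cong[OF eq, of "x + cscale t (\<alpha>, 0)"] by simp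
  qed
  with lim(1) have "?g' \<midarrow>0\<rightarrow> q x" by (rule Lim_transform_eventually)
  then show "q x = q' x" using tendsto_unique[OF at_neq_bot lim(2)] by simp
qed

text \<open>Only linear functions are divided explicitly. The twisted Leibniz rule carries
  divisibility through products.\<close>

lemma reflection_quotient_exists:
  "(f :: 'a cfun) \<in> poly_fun \<Longrightarrow>
    \<exists>q. q \<in> poly_fun \<and> f - act (refl_along \<alpha>) f = root_fun \<alpha> * q"
proof (induction rule: poly_fun_induct)
  case (const c)
  show ?case by (rule exI[of _ 0]) simp
next
  case (cform a)
  have "cform a - act (refl_along \<alpha>) (cform a) = root_fun \<alpha> * (\<lambda>_. root_pairing \<alpha> a)"
    by (simp add: fun_eq_iff act_refl_along cform_refl_along del: map_prod_simp split_paired_All)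
  then show ?case using poly_fun_const by blast
next
  case (add f g)
  then obtain q q' where *: "q \<in> poly_fun" "f - act (refl_along \<alpha>) f = root_fun \<alpha> * q"
    "q' \<in> poly_fun" "g - act (refl_along \<alpha>) g = root_fun \<alpha> * q'" by blast
  have "f + g - act (refl_along \<alpha>) (f + g) = (f - act (refl_along \<alpha>) f) + (g - act (refl_along \<alpha>) g)"
    unfolding act_simps by (rule add_diff_add)
  also have "\<dots> = root_fun \<alpha> * (q + q')" unfolding *(2,4) by (rule distrib_left[symmetric])
  finally have "f + g - act (refl_along \<alpha>) (f + g) = \<dots>" .
  from conjI[OF poly_fun_add[OF *(1,3)] this] show ?case by (rule exI[where x = "q + q'"])
next
  case (mult f g)
  then obtain q q' where *: "q \<in> poly_fun" "f - act (refl_along \<alpha>) f = root_fun \<alpha> * q"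
    "q' \<in> poly_fun" "g - act (refl_along \<alpha>) g = root_fun \<alpha> * q'" by blast
  have "f * g - act (refl_along \<alpha>) (f * g) =
      (f - act (refl_along \<alpha>) f) * g + act (refl_along \<alpha>) f * (g - act (refl_along \<alpha>) g)"
    unfolding act_simps by (simp only: algebra_simps)
  also have "\<dots> = root_fun \<alpha> * (q * g + act (refl_along \<alpha>) f * q')"
    unfolding *(2,4) by (simp only: algebra_simps)
  finally have "f * g - act (refl_along \<alpha>) (f * g) = \<dots>" .
  from conjI[OF poly_fun_add[OF poly_fun_mult[OF *(1) mult(2)]
        poly_fun_mult[OF act_refl_along_poly_fun[OF mult(1)] *(3)]] this]
  show ?case by (rule exI[where x = "q * g + act (refl_along \<alpha>) f * q'"])
qed

lemma
  assumes "(\<alpha> :: 'a) \<noteq> 0" "f \<in> poly_fun"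
  shows nabla_poly_fun [intro]: "nabla \<alpha> f \<in> poly_fun"
    and nabla_eq: "f - act (refl_along \<alpha>) f = root_fun \<alpha> * nabla \<alpha> f"
proof -
  have "\<exists>!q. q \<in> poly_fun \<and> f - act (refl_along \<alpha>) f = root_fun \<alpha> * q"
    using reflection_quotient_exists[OF assms(2)] root_fun_mult_cancel[OF assms(1)] by metis
  from theI'[OF this] show "nabla \<alpha> f \<in> poly_fun" "f - act (refl_along \<alpha>) f = root_fun \<alpha> * nabla \<alpha> f"
    unfolding nabla_def by blast+
qed

lemma nabla_unique:
  assumes "(\<alpha> :: 'a) \<noteq> 0" "f \<in> poly_fun" "q \<in> poly_fun" "f - act (refl_along \<alpha>) f = root_fun \<alpha> * q"
  shows "nabla \<alpha> f = q"
  using root_fun_mult_cancel[OF assms(1) nabla_poly_fun[OF assms(1,2)] assms(3)]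
    nabla_eq[OF assms(1,2)] assms(4) by simp

lemma nabla_add:
  assumes "(\<alpha> :: 'a) \<noteq> 0" "f \<in> poly_fun" "g \<in> poly_fun"
  shows "nabla \<alpha> (f + g) = nabla \<alpha> f + nabla \<alpha> g"
proof (rule nabla_unique[OF assms(1) poly_fun_add[OF assms(2,3)]])
  show "f + g - act (refl_along \<alpha>) (f + g) = root_fun \<alpha> * (nabla \<alpha> f + nabla \<alpha> g)"
    unfolding act_simps distrib_left nabla_eq[OF assms(1,2), symmetric] nabla_eq[OF assms(1,3), symmetric]
    by (rule add_diff_add)
qed (use assms in blast)

lemma nabla_mult:
  assumes "(\<alpha> :: 'a) \<noteq> 0" "f \<in> poly_fun" "g \<in> poly_fun"
  shows "nabla \<alpha> (f * g) = nabla \<alpha> f * g + act (refl_along \<alpha>) f * nabla \<alpha> g"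
proof (rule nabla_unique[OF assms(1) poly_fun_mult[OF assms(2,3)]])
  have "f * g - act (refl_along \<alpha>) (f * g) =
      (f - act (refl_along \<alpha>) f) * g + act (refl_along \<alpha>) f * (g - act (refl_along \<alpha>) g)"
    unfolding act_simps by (simp only: algebra_simps)
  also have "\<dots> = root_fun \<alpha> * (nabla \<alpha> f * g + act (refl_along \<alpha>) f * nabla \<alpha> g)"
    unfolding nabla_eq[OF assms(1,2)] nabla_eq[OF assms(1,3)] by (simp only: algebra_simps)
  finally show "f * g - act (refl_along \<alpha>) (f * g) = \<dots>" .
qed (use assms in blast)

lemma nabla_invariant:
  assumes "(\<alpha> :: 'a) \<noteq> 0" "f \<in> poly_fun" "act (refl_along \<alpha>) f = f"
  shows "nabla \<alpha> f = 0"
  by (rule nabla_unique[OF assms(1,2)]) (simp_all add: assms(3))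

lemma nabla_const [simp]: "(\<alpha> :: 'a) \<noteq> 0 \<Longrightarrow> nabla \<alpha> (\<lambda>_. c) = 0"
  by (rule nabla_invariant) simp_all

lemma nabla_0 [simp]: "(\<alpha> :: 'a) \<noteq> 0 \<Longrightarrow> nabla \<alpha> 0 = 0"
  by (rule nabla_invariant) (simp_all add: act_def fun_eq_iff)

lemma nabla_invariant_mult:
  assumes "(\<alpha> :: 'a) \<noteq> 0" "f \<in> poly_fun" "g \<in> poly_fun" "act (refl_along \<alpha>) f = f"
  shows "nabla \<alpha> (f * g) = f * nabla \<alpha> g"
  unfolding nabla_mult[OF assms(1-3)] nabla_invariant[OF assms(1,2,4)] assms(4) by simp

lemma nabla_scale:
  assumes "(\<alpha> :: 'a) \<noteq> 0" "g \<in> poly_fun"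
  shows "nabla \<alpha> ((\<lambda>_. c) * g) = (\<lambda>_. c) * nabla \<alpha> g"
  by (rule nabla_invariant_mult[OF assms(1) poly_fun_const assms(2)]) simp

lemma nabla_cform: "(\<alpha> :: 'a) \<noteq> 0 \<Longrightarrow> nabla \<alpha> (cform a) = (\<lambda>_. root_pairing \<alpha> a)"
  by (rule nabla_unique)
    (simp_all add: fun_eq_iff act_refl_along cform_refl_along del: map_prod_simp split_paired_All)

lemma act_refl_along_involution: "act (refl_along \<alpha>) (act (refl_along \<alpha>) f) = f"
  by (simp add: act_refl_along fun_eq_iff map_prod_def split_beta)

lemma act_refl_along_root_fun: "(\<alpha> :: 'a) \<noteq> 0 \<Longrightarrow> act (refl_along \<alpha>) (root_fun \<alpha>) = - root_fun \<alpha>"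
  unfolding root_fun_def act_cform[OF orthogonal_transformation_refl_along bij_refl_along]
  by (auto simp: fun_eq_iff cform_def complex_eq_iff refl_along_self linear_0[OF linear_refl_along])

text \<open>The numerator and the root both change sign under the reflection, so the quotient is
  invariant.\<close>

lemma act_nabla:
  assumes "(\<alpha> :: 'a) \<noteq> 0" "f \<in> poly_fun"
  shows "act (refl_along \<alpha>) (nabla \<alpha> f) = nabla \<alpha> f"
proof (rule root_fun_mult_cancel[OF assms(1)])
  have "act (refl_along \<alpha>) (f - act (refl_along \<alpha>) f) = act (refl_along \<alpha>) (root_fun \<alpha> * nabla \<alpha> f)"
    using nabla_eq[OF assms] by simp
  then have "act (refl_along \<alpha>) f - f = - (root_fun \<alpha> * act (refl_along \<alpha>) (nabla \<alpha> f))"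
    unfolding act_simps act_refl_along_involution act_refl_along_root_fun[OF assms(1)]
    by (simp only: mult_minus_left)
  then have "root_fun \<alpha> * act (refl_along \<alpha>) (nabla \<alpha> f) = - (act (refl_along \<alpha>) f - f)"
    by (simp only: minus_minus)
  also have "\<dots> = f - act (refl_along \<alpha>) f" by (rule minus_diff_eq)
  finally show "root_fun \<alpha> * act (refl_along \<alpha>) (nabla \<alpha> f) = root_fun \<alpha> * nabla \<alpha> f"
    unfolding nabla_eq[OF assms] .
qed (use assms in blast)+

lemma nabla_nabla: "(\<alpha> :: 'a) \<noteq> 0 \<Longrightarrow> f \<in> poly_fun \<Longrightarrow> nabla \<alpha> (nabla \<alpha> f) = 0"
  by (rule nabla_invariant[OF _ _ act_nabla]) auto

lemma act_homogeneous:
  assumes "orthogonal_transformation w" "bij w" "homogeneous d (f :: 'a cfun)"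
  shows "homogeneous d (act w f)"
proof -
  have lin: "linear w" by (rule orthogonal_transformation_linear[OF assms(1)])
  have inv: "w (inv w x) = x" "inv w (w x) = x" for x
    using assms(2) by (simp_all add: bij_is_surj surj_f_inv_f bij_is_inj)
  have "inv w (x + y) = inv w (w (inv w x + inv w y))" "inv w (r *\<^sub>R x) = inv w (w (r *\<^sub>R inv w x))" for x y r
    by (simp_all only: linear_add[OF lin] linear_cmul[OF lin] inv(1))
  then have "linear (inv w)" by (intro linearI) (simp_all only: inv(2))
  then have "act w f (cscale c x) = c ^ d * act w f x" for c x
    by (simp add: act_def map_prod_cscale homogeneousD(2)[OF assms(3)] del: map_prod_simp)
  then show ?thesis
    using act_poly_fun[OF assms(1,2) homogeneousD(1)[OF assms(3)]] unfolding homogeneous_def by blast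
qed

lemma nabla_homogeneous:
  assumes \<alpha>: "(\<alpha> :: 'a) \<noteq> 0" and f: "homogeneous (Suc d) f"
  shows "homogeneous d (nabla \<alpha> f)"
proof (rule homogeneousI)
  have pf: "f \<in> poly_fun" using homogeneousD(1)[OF f] .
  show pn: "nabla \<alpha> f \<in> poly_fun" using \<alpha> pf by blast
  fix c :: complex and x assume c: "c \<noteq> 0"
  have hom: "homogeneous (Suc d) (f - act (refl_along \<alpha>) f)"
    by (intro homogeneous_diff f act_homogeneous orthogonal_transformation_refl_along bij_refl_along)
  have "(\<lambda>x. nabla \<alpha> f (cscale c x)) = (\<lambda>_. c ^ d) * nabla \<alpha> f"
  proof (rule root_fun_mult_cancel[OF \<alpha>])
    show "(\<lambda>x. nabla \<alpha> f (cscale c x)) \<in> poly_fun" by (rule poly_fun_comp_cscale[OF pn])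
    show "(\<lambda>_. c ^ d) * nabla \<alpha> f \<in> poly_fun" using pn by blast
    have "c * (root_fun \<alpha> x * nabla \<alpha> f (cscale c x)) = c * (root_fun \<alpha> x * (c ^ d * nabla \<alpha> f x))" for x
      using homogeneousD(2)[OF hom, of c x] unfolding nabla_eq[OF \<alpha> pf]
      by (simp add: root_fun_cscale mult_ac)
    then show "root_fun \<alpha> * (\<lambda>x. nabla \<alpha> f (cscale c x)) = root_fun \<alpha> * ((\<lambda>_. c ^ d) * nabla \<alpha> f)"
      using c by (intro ext) simp
  qed
  then show "nabla \<alpha> f (cscale c x) = c ^ d * nabla \<alpha> f x" by (metis times_fun_apply)
qed

lemma nabla_degree_0: "(\<alpha> :: 'a) \<noteq> 0 \<Longrightarrow> homogeneous 0 f \<Longrightarrow> nabla \<alpha> f = 0"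
  using arg_cong[OF homogeneous_degree_0, of f "nabla \<alpha>"] nabla_const[of \<alpha> "f 0"] by (rule trans)

end

text \<open>Takes arbitrary words, reduced or not, so that letters can be deleted and words
  concatenated before the independence of the reduced word is known.\<close>

definition nablas :: "'a::real_inner list \<Rightarrow> ('a cfun) \<Rightarrow> 'a cfun" where
  "nablas as = foldr (\<lambda>\<alpha> D. nabla \<alpha> \<circ> D) as id"

lemma nablas_Nil [simp]: "nablas [] f = f"
  and nablas_Cons [simp]: "nablas (\<alpha> # as) f = nabla \<alpha> (nablas as f)"
  by (simp_all add: nablas_def)

lemma nablas_append: "nablas (as @ bs) f = nablas as (nablas bs f)"
  by (induction as) auto

context based_root_system
begin

lemma W_orthogonal: "w \<in> W \<Longrightarrow> orthogonal_transformation w"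
  by (rule weyl_group_orthogonal[OF roots])

lemma base_nonzero: "\<alpha> \<in> \<Omega> \<Longrightarrow> \<alpha> \<noteq> 0"
  using base_subset root_nonzero[OF roots] by blast

lemma nablas_poly_fun: "set as \<subseteq> \<Omega> \<Longrightarrow> f \<in> poly_fun \<Longrightarrow> nablas as f \<in> poly_fun"
  by (induction as) (simp_all add: base_nonzero nabla_poly_fun)

lemma nablas_add:
  assumes "set as \<subseteq> \<Omega>" "f \<in> poly_fun" "g \<in> poly_fun"
  shows "nablas as (f + g) = nablas as f + nablas as g"
  using assms(1)
proof (induction as)
  case (Cons \<alpha> as)
  then have as: "set as \<subseteq> \<Omega>" "\<alpha> \<noteq> 0" using base_nonzero by auto
  show ?case unfolding nablas_Cons Cons.IH[OF as(1)]
    by (rule nabla_add[OF as(2) nablas_poly_fun[OF as(1) assms(2)] nablas_poly_fun[OF as(1) assms(3)]])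
qed simp

lemma nablas_invariant_mult:
  assumes "set as \<subseteq> \<Omega>" "f \<in> poly_fun" "g \<in> poly_fun" "\<And>\<alpha>. \<alpha> \<in> \<Omega> \<Longrightarrow> act (refl_along \<alpha>) f = f"
  shows "nablas as (f * g) = f * nablas as g"
  using assms(1)
proof (induction as)
  case (Cons \<alpha> as)
  then have as: "set as \<subseteq> \<Omega>" "\<alpha> \<noteq> 0" "\<alpha> \<in> \<Omega>" using base_nonzero by auto
  show ?case unfolding nablas_Cons Cons.IH[OF as(1)]
    by (rule nabla_invariant_mult[OF as(2) assms(2) nablas_poly_fun[OF as(1) assms(3)] assms(4)[OF as(3)]])
qed simp

lemma nablas_scale:
  assumes "set as \<subseteq> \<Omega>" "g \<in> poly_fun"
  shows "nablas as ((\<lambda>_. c) * g) = (\<lambda>_. c) * nablas as g"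
  by (rule nablas_invariant_mult[OF assms(1) poly_fun_const assms(2)]) simp

lemma nablas_const: "set as \<subseteq> \<Omega> \<Longrightarrow> as \<noteq> [] \<Longrightarrow> nablas as (\<lambda>_. c) = 0"
proof (induction as)
  case (Cons \<alpha> as)
  then have as: "set as \<subseteq> \<Omega>" "\<alpha> \<noteq> 0" using base_nonzero by auto
  show ?case
  proof (cases "as = []")
    case True
    show ?thesis unfolding nablas_Cons True nablas_Nil by (rule nabla_const[OF as(2)])
  next
    case False
    show ?thesis unfolding nablas_Cons Cons.IH[OF as(1) False] by (rule nabla_0[OF as(2)])
  qed
qed simp

lemma nablas_homogeneous:
  "set as \<subseteq> \<Omega> \<Longrightarrow> homogeneous (d + length as) f \<Longrightarrow> homogeneous d (nablas as f)"
proof (induction as arbitrary: d)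
  case (Cons \<alpha> as)
  have "homogeneous (Suc d) (nablas as f)" by (rule Cons.IH) (use Cons.prems in auto)
  then show ?case unfolding nablas_Cons using Cons.prems base_nonzero by (intro nabla_homogeneous) auto
qed simp

lemma nablas_low_degree:
  assumes "set as \<subseteq> \<Omega>" "homogeneous d f" "d < length as"
  shows "nablas as f = 0"
  using assms
proof (induction as)
  case (Cons \<alpha> as)
  then have as: "set as \<subseteq> \<Omega>" "\<alpha> \<noteq> 0" using base_nonzero by auto
  show ?case
  proof (cases "d < length as")
    case True
    show ?thesis unfolding nablas_Cons Cons.IH[OF as(1) Cons.prems(2) True] by (rule nabla_0[OF as(2)])
  next
    case False
    then have "d = 0 + length as" using Cons.prems by simp
    then have "homogeneous 0 (nablas as f)" using Cons.prems(2) nablas_homogeneous[OF as(1)] by metis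
    then show ?thesis unfolding nablas_Cons by (rule nabla_degree_0[OF as(2)])
  qed
qed simp

lemma nabla_sum_list:
  assumes "\<alpha> \<in> \<Omega>" "\<And>x. x \<in> set xs \<Longrightarrow> F x \<in> poly_fun"
  shows "nabla \<alpha> (\<Sum>x\<leftarrow>xs. F x) = (\<Sum>x\<leftarrow>xs. nabla \<alpha> (F x)) \<and> (\<Sum>x\<leftarrow>xs. F x) \<in> poly_fun"
  using assms(2)
proof (induction xs)
  case Nil
  show ?case using base_nonzero[OF assms(1)] by simp
next
  case (Cons x xs)
  then have IH: "nabla \<alpha> (\<Sum>x\<leftarrow>xs. F x) = (\<Sum>x\<leftarrow>xs. nabla \<alpha> (F x))" "(\<Sum>x\<leftarrow>xs. F x) \<in> poly_fun" "F x \<in> poly_fun"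
    by auto
  show ?case
    unfolding list.map sum_list.Cons nabla_add[OF base_nonzero[OF assms(1)] IH(3,2)] IH(1)
    using poly_fun_add[OF IH(3,2)] by blast
qed

text \<open>Among the operators of the word, at most one can differentiate the linear factor, since
  it then becomes constant. Each deletion accounts for the letter that did so, and the first term is
  the case that none did.\<close>

lemma nablas_cform_mult:
  assumes "set as \<subseteq> \<Omega>" and f: "f \<in> poly_fun"
  shows "nablas as (cform a * f) = cform (map_prod (word_prod as) (word_prod as) a) * nablas as f
    + (\<Sum>p\<leftarrow>deletions as. (\<lambda>_. root_pairing (fst p) a) * nablas (snd p) f)"
  using assms(1)
proof (induction as)
  case Nil
  show ?case by (simp add: map_prod.id)
next
  case (Cons \<alpha> as)
  then have as: "set as \<subseteq> \<Omega>" and \<alpha>: "\<alpha> \<in> \<Omega>" "\<alpha> \<noteq> 0" using base_nonzero by auto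
  define w where "w = word_prod as"
  define b where "b = map_prod w w a"
  define F where "F = (\<lambda>p. (\<lambda>_. root_pairing (fst p) a) * nablas (snd p) f)"
  have w: "w \<in> W" unfolding w_def by (rule word_prod_in_W[OF as])
  have pf: "nablas as f \<in> poly_fun" by (rule nablas_poly_fun[OF as f])
  have pd: "nablas (snd p) f \<in> poly_fun" if "p \<in> set (deletions as)" for p
    using nablas_poly_fun[OF _ f, of "snd p"] deletions_props[OF as, of "fst p" "snd p"] that by simp
  have F: "F p \<in> poly_fun" if "p \<in> set (deletions as)" for p
    unfolding F_def using pd[OF that] by blast
  have IH: "nablas as (cform a * f) = cform b * nablas as f + (\<Sum>p\<leftarrow>deletions as. F p)"
    using Cons.IH[OF as] by (simp only: b_def w_def F_def)
  have S: "nabla \<alpha> (\<Sum>p\<leftarrow>deletions as. F p) = (\<Sum>p\<leftarrow>deletions as. nabla \<alpha> (F p))"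
    "(\<Sum>p\<leftarrow>deletions as. F p) \<in> poly_fun"
    using nabla_sum_list[OF \<alpha>(1), of "deletions as" F] F by blast+
  have "nablas (\<alpha> # as) (cform a * f) = nabla \<alpha> (cform b * nablas as f) + (\<Sum>p\<leftarrow>deletions as. nabla \<alpha> (F p))"
    unfolding nablas_Cons IH nabla_add[OF \<alpha>(2) poly_fun_mult[OF cform_in_poly_fun pf] S(2)] S(1) ..
  also have "nabla \<alpha> (cform b * nablas as f) =
      (\<lambda>_. root_pairing \<alpha> b) * nablas as f + act (refl_along \<alpha>) (cform b) * nabla \<alpha> (nablas as f)"
    unfolding nabla_mult[OF \<alpha>(2) cform_in_poly_fun pf] nabla_cform[OF \<alpha>(2)] ..
  \<comment> \<open>Invariance of the pairing moves \<open>w\<close> from the vector to the root;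
    the result is the root that \<open>deletions\<close> attaches to the leading letter.\<close>
  also have "root_pairing \<alpha> b = root_pairing (inv w \<alpha>) a"
    using root_pairing_orthogonal[OF W_orthogonal[OF w], of "inv w \<alpha>" a] w by (simp add: b_def)
  also have "act (refl_along \<alpha>) (cform b) = cform (map_prod (word_prod (\<alpha> # as)) (word_prod (\<alpha> # as)) a)"
    unfolding act_cform[OF orthogonal_transformation_refl_along bij_refl_along] b_def w_def
    by (cases a) simp
  also have "(\<Sum>p\<leftarrow>deletions as. nabla \<alpha> (F p)) =
      (\<Sum>p\<leftarrow>map (\<lambda>(\<gamma>, d). (\<gamma>, \<alpha> # d)) (deletions as). (\<lambda>_. root_pairing (fst p) a) * nablas (snd p) f)"
    unfolding map_map
  proof (rule arg_cong[of _ _ sum_list], rule map_cong[OF HOL.refl])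
    fix p assume "p \<in> set (deletions as)"
    then show "nabla \<alpha> (F p) = ((\<lambda>p. (\<lambda>_. root_pairing (fst p) a) * nablas (snd p) f) \<circ> (\<lambda>(\<gamma>, d). (\<gamma>, \<alpha> # d))) p"
      unfolding F_def comp_def split_beta fst_conv snd_conv nablas_Cons by (intro nabla_scale[OF \<alpha>(2)] pd)
  qed
  finally show ?case
    unfolding deletions.simps list.map sum_list.Cons fst_conv snd_conv nablas_Cons w_def
    by (simp only: add_ac)
qed

end

section \<open>Independence of the reduced word, and the functionals \<open>eps\<close>\<close>

context based_root_system
begin

lemma div_diff_eq_nablas: "div_diff \<Omega> w = nablas (SOME as. red_word w as)"
  by (simp only: div_diff_def nablas_def)

lemma reduced_word_some: "w \<in> W \<Longrightarrow> red_word w (SOME as. red_word w as)"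
  by (rule someI_ex[OF reduced_word_exists])

text \<open>Independence of the reduced word and vanishing on non-reduced words are proved together by
  induction on the length, without braid relations: by \<open>nablas_cform_mult\<close>, the difference of the
  operators of two reduced words for \<open>w\<close> commutes with every linear function up to the twist by
  \<open>w\<close>, and it kills the constants.\<close>

definition nablas_determined :: "nat \<Rightarrow> bool" where
  "nablas_determined k \<longleftrightarrow> (\<forall>as f. set as \<subseteq> \<Omega> \<longrightarrow> length as = k \<longrightarrow> f \<in> poly_fun \<longrightarrow>
     nablas as f = (if card (inversions (word_prod as)) = k then div_diff \<Omega> (word_prod as) f else 0))"

lemma nablas_determinedD:
  assumes "nablas_determined k" "set as \<subseteq> \<Omega>" "length as = k" "f \<in> poly_fun"
  shows "nablas as f = (if card (inversions (word_prod as)) = k then div_diff \<Omega> (word_prod as) f else 0)"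
  using assms unfolding nablas_determined_def by blast

text \<open>On the right-hand side the word enters only through \<open>nablas as f\<close>, so two
  reduced words of \<open>w\<close> can be compared. Deletions that are not reduced contribute zero
  by \<open>det\<close>, which is vacuous for the empty word.\<close>

lemma nablas_reduced_cform_mult:
  assumes red: "red_word w as" and f: "f \<in> poly_fun"
    and det: "\<And>k. Suc k = length as \<Longrightarrow> nablas_determined k"
  shows "nablas as (cform a * f) = cform (map_prod w w a) * nablas as f
    + (\<Sum>\<gamma>\<in>inversions w. (\<lambda>_. root_pairing \<gamma> a) *
        (if Suc (card (inversions (w \<circ> refl_along \<gamma>))) = card (inversions w)
         then div_diff \<Omega> (w \<circ> refl_along \<gamma>) f else 0))"
proof -
  define h where "h \<gamma> = (\<lambda>_. root_pairing \<gamma> a) *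
        (if Suc (card (inversions (w \<circ> refl_along \<gamma>))) = card (inversions w)
         then div_diff \<Omega> (w \<circ> refl_along \<gamma>) f else 0)" for \<gamma>
  have as: "set as \<subseteq> \<Omega>" "word_prod as = w" "length as = card (inversions w)"
    using red reduced_word_iff by auto
  have "(\<lambda>_. root_pairing (fst p) a) * nablas (snd p) f = h (fst p)" if p: "p \<in> set (deletions as)" for p
  proof -
    have d: "set (snd p) \<subseteq> \<Omega>" "Suc (length (snd p)) = length as"
      "word_prod (snd p) = w \<circ> refl_along (fst p)"
      using deletions_props[OF as(1), of "fst p" "snd p"] p as(2) by auto
    from nablas_determinedD[OF det[OF d(2)] d(1) HOL.refl f] show ?thesis
      unfolding h_def d(3) d(2)[symmetric] as(3)[symmetric] by (auto simp only: nat.inject split: if_splits)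
  qed
  then have "(\<Sum>p\<leftarrow>deletions as. (\<lambda>_. root_pairing (fst p) a) * nablas (snd p) f) = (\<Sum>p\<leftarrow>deletions as. h (fst p))"
    by (intro arg_cong[of _ _ sum_list] map_cong HOL.refl)
  also have "\<dots> = sum_list (map h (map fst (deletions as)))"
    by (simp only: map_map comp_def)
  also have "\<dots> = (\<Sum>\<gamma>\<in>inversions w. h \<gamma>)"
    unfolding sum_list_distinct_conv_sum_set[OF reduced_word_deletions(1)[OF red]]
      reduced_word_deletions(2)[OF red] ..
  finally show ?thesis
    unfolding nablas_cform_mult[OF as(1) f] as(2) h_def by simp
qed

text \<open>If \<open>as\<close> is not reduced, the inner operator already vanishes. Otherwise
  \<open>u\<close> has length k - 1: length k is excluded by
  \<open>card_inversions_simple_comp_neq\<close>, and k + 1 by assumption. So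
  \<open>\<alpha> # bs\<close> is another reduced word for \<open>w\<close> and may replace
  \<open>as\<close>, after which \<open>nabla \<alpha>\<close> is applied twice in a row.\<close>

lemma nablas_nonreduced_step:
  assumes det: "nablas_determined k" and as: "set (\<alpha> # as) \<subseteq> \<Omega>" "length as = k"
    and nonred: "card (inversions (word_prod (\<alpha> # as))) \<noteq> Suc k" and f: "f \<in> poly_fun"
  shows "nablas (\<alpha> # as) f = 0"
proof -
  define w where "w = word_prod as"
  define u where "u = refl_along \<alpha> \<circ> w"
  have as': "set as \<subseteq> \<Omega>" and \<alpha>: "\<alpha> \<in> \<Omega>" "\<alpha> \<noteq> 0" using as base_nonzero by auto
  have w: "w \<in> W" unfolding w_def by (rule word_prod_in_W[OF as'])
  have u: "u \<in> W" "word_prod (\<alpha> # as) = u" using word_prod_in_W[OF as(1)] by (auto simp: u_def w_def)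
  show ?thesis
  proof (cases "card (inversions w) = k")
    case False
    then have "nablas as f = 0"
      using nablas_determinedD[OF det as' as(2) f] by (simp only: w_def if_False simp_thms)
    then show ?thesis unfolding nablas_Cons using nabla_0[OF \<alpha>(2)] by (simp only:)
  next
    case True
    obtain bs where bs: "red_word u bs" using reduced_word_exists[OF u(1)] by blast
    then have bs': "set bs \<subseteq> \<Omega>" "word_prod bs = u" "length bs = card (inversions u)"
      using reduced_word_iff by auto
    have w_eq: "word_prod (\<alpha> # bs) = w" by (simp add: bs'(2) u_def fun_eq_iff)
    have "card (inversions u) \<le> Suc k" using card_inversions_le[OF as(1)] u(2) as(2) by simp
    moreover have "card (inversions u) \<noteq> k"
      using card_inversions_simple_comp_neq[OF w \<alpha>(1)] True by (simp add: u_def)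
    moreover have "k \<le> Suc (length bs)"
      using card_inversions_le[of "\<alpha> # bs"] \<alpha>(1) bs'(1) w_eq True by simp
    ultimately have len: "length (\<alpha> # bs) = k" using nonred u(2) bs'(3) by simp
    have "nablas as f = nablas (\<alpha> # bs) f"
      using nablas_determinedD[OF det as' as(2) f] nablas_determinedD[OF det _ len f] \<alpha>(1) bs'(1) True w_eq
      by (simp add: w_def)
    then have "nablas (\<alpha> # as) f = nabla \<alpha> (nabla \<alpha> (nablas bs f))" by (simp only: nablas_Cons)
    also have "\<dots> = 0" by (rule nabla_nabla[OF \<alpha>(2) nablas_poly_fun[OF bs'(1) f]])
    finally show ?thesis .
  qed
qed

lemma nablas_reduced_step:
  assumes det: "nablas_determined k" and red: "red_word w as" "red_word w bs"
    and len: "length as = Suc k" and f: "f \<in> poly_fun"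
  shows "nablas as f = nablas bs f"
proof -
  have len': "length bs = Suc k" using len red by (simp add: reduced_word_def)
  have set: "set as \<subseteq> \<Omega>" "set bs \<subseteq> \<Omega>" using red by (simp_all add: reduced_word_def)
  have det': "nablas_determined l" if "Suc l = length as \<or> Suc l = length bs" for l
    using that len len' det by simp
  \<comment> \<open>The factor \<open>g\<close> is kept arbitrary so that the induction on
    \<open>f\<close> passes through products.\<close>
  have "nablas as (f * g) = nablas bs (f * g)"
    if "g \<in> poly_fun" "nablas as g = nablas bs g" for g
    using f that
  proof (induction arbitrary: g rule: poly_fun_induct)
    case (const c)
    show ?case
      unfolding nablas_scale[OF set(1) const(1)] nablas_scale[OF set(2) const(1)] const(2) ..
  next
    case (cform a)
    note 1 = nablas_reduced_cform_mult[OF red(1) cform(1) det'[OF disjI1], of a]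
    note 2 = nablas_reduced_cform_mult[OF red(2) cform(1) det'[OF disjI2], of a]
    show ?case by (rule trans[OF 1 2[folded cform(2), symmetric]])
  next
    case (add f1 f2)
    have "nablas as (f1 * g + f2 * g) = nablas bs (f1 * g + f2 * g)"
      unfolding nablas_add[OF set(1) poly_fun_mult[OF add(1,5)] poly_fun_mult[OF add(2,5)]]
        nablas_add[OF set(2) poly_fun_mult[OF add(1,5)] poly_fun_mult[OF add(2,5)]]
        add.IH(1)[OF add(5,6)] add.IH(2)[OF add(5,6)] ..
    then show ?case by (simp only: distrib_right)
  next
    case (mult f1 f2)
    show ?case unfolding mult.assoc
      by (rule mult.IH(1)[OF poly_fun_mult[OF mult(2,5)] mult.IH(2)[OF mult(5,6)]])
  qed
  moreover have "nablas as 1 = nablas bs 1"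
  proof -
    have "as \<noteq> []" "bs \<noteq> []" using len len' by auto
    from nablas_const[OF set(1) this(1)] nablas_const[OF set(2) this(2)]
    show ?thesis unfolding func_one by simp
  qed
  ultimately have "nablas as (f * 1) = nablas bs (f * 1)" by blast
  then show ?thesis by (simp only: mult_1_right)
qed

lemma nablas_determined: "nablas_determined k"
proof (induction k)
  case 0
  have "card (inversions (word_prod [])) = 0" using card_inversions_le[of "[]"] by simp
  then have "red_word (word_prod []) []" unfolding reduced_word_iff by simp
  then have "(SOME as. red_word (word_prod []) as) = []"
    using reduced_word_some[OF word_prod_in_W[of "[]"]] by (simp add: reduced_word_def)
  then have "div_diff \<Omega> (word_prod []) f = f" for f
    unfolding div_diff_eq_nablas by (simp only: nablas_Nil)
  with \<open>card (inversions (word_prod [])) = 0\<close>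
  have "nablas [] f = (if card (inversions (word_prod [])) = 0 then div_diff \<Omega> (word_prod []) f else 0)" for f
    by (simp only: nablas_Nil if_True simp_thms)
  then show ?case unfolding nablas_determined_def by (metis length_0_conv)
next
  case (Suc k)
  show ?case unfolding nablas_determined_def
  proof (intro allI impI)
    fix as and f :: "'a cfun"
    assume as: "set as \<subseteq> \<Omega>" "length as = Suc k" and f: "f \<in> poly_fun"
    show "nablas as f = (if card (inversions (word_prod as)) = Suc k then div_diff \<Omega> (word_prod as) f else 0)"
    proof (cases "card (inversions (word_prod as)) = Suc k")
      case True
      have w: "word_prod as \<in> W" by (rule word_prod_in_W[OF as(1)])
      have "red_word (word_prod as) as" using as True unfolding reduced_word_iff by simp
      from nablas_reduced_step[OF Suc this reduced_word_some[OF w] as(2) f] True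
      show ?thesis by (simp only: if_True simp_thms div_diff_eq_nablas)
    next
      case False
      obtain \<alpha> as' where as': "as = \<alpha> # as'" "length as' = k" using as(2) by (cases as) auto
      have "nablas as f = 0"
        unfolding as'(1) by (rule nablas_nonreduced_step[OF Suc _ as'(2) _ f]) (use as(1) False as'(1) in blast)+
      then show ?thesis using False by (simp only: if_False simp_thms)
    qed
  qed
qed

lemma nablas_eq:
  "set as \<subseteq> \<Omega> \<Longrightarrow> f \<in> poly_fun \<Longrightarrow> nablas as f =
    (if card (inversions (word_prod as)) = length as then div_diff \<Omega> (word_prod as) f else 0)"
  by (rule nablas_determinedD[OF nablas_determined]) simp_all

lemma nablas_reduced: "red_word w as \<Longrightarrow> f \<in> poly_fun \<Longrightarrow> nablas as f = div_diff \<Omega> w f"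
  using nablas_eq[of as f] by (simp add: reduced_word_iff)

definition eps :: "('a \<Rightarrow> 'a) \<Rightarrow> ('a cfun) \<Rightarrow> complex" where
  "eps w f = div_diff \<Omega> w f 0"

lemma eps_nablas: "red_word w as \<Longrightarrow> f \<in> poly_fun \<Longrightarrow> eps w f = nablas as f 0"
  unfolding eps_def by (simp only: nablas_reduced)

lemma eps_functional:
  assumes w: "w \<in> W"
  shows "poly_functional (eps w)"
proof -
  obtain as where red: "red_word w as" using reduced_word_exists[OF w] by blast
  then have as: "set as \<subseteq> \<Omega>" by (simp add: reduced_word_def)
  have "eps w (f + g) = eps w f + eps w g" if "f \<in> poly_fun" "g \<in> poly_fun" for f g
    unfolding eps_nablas[OF red that(1)] eps_nablas[OF red that(2)]
      eps_nablas[OF red poly_fun_add[OF that]] nablas_add[OF as that] by (rule plus_fun_apply)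
  moreover have "eps w ((\<lambda>_. c) * f) = c * eps w f" if "f \<in> poly_fun" for f c
    unfolding eps_nablas[OF red that] eps_nablas[OF red poly_fun_mult[OF poly_fun_const that]]
      nablas_scale[OF as that] by (rule times_fun_apply)
  ultimately show ?thesis unfolding poly_functional_def by blast
qed

lemma eps_id: "f \<in> poly_fun \<Longrightarrow> eps id f = f 0"
proof -
  assume f: "f \<in> poly_fun"
  have "card (inversions id) = 0" using card_inversions_le[of "[]"] by (simp only: word_prod_simps list.size list.set le_zero_eq empty_subsetI)
  then have "red_word id []" unfolding reduced_word_iff by simp
  from eps_nablas[OF this f] show ?thesis by (simp only: nablas_Nil)
qed

text \<open>The twisted term of the Leibniz rule has a linear factor and vanishes at the origin;
  only elements one step lower remain.\<close>

lemma eps_cform_mult: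
  assumes w: "w \<in> W" and f: "f \<in> poly_fun"
  shows "eps w (cform a * f) = (\<Sum>\<gamma>\<in>inversions w. root_pairing \<gamma> a *
    (if Suc (card (inversions (w \<circ> refl_along \<gamma>))) = card (inversions w)
     then eps (w \<circ> refl_along \<gamma>) f else 0))"
proof -
  obtain as where red: "red_word w as" using reduced_word_exists[OF w] by blast
  have "eps w (cform a * f) = nablas as (cform a * f) 0"
    by (rule eps_nablas[OF red poly_fun_mult[OF cform_in_poly_fun f]])
  also note fun_cong[OF nablas_reduced_cform_mult[OF red f nablas_determined], of a 0]
  finally show ?thesis by (simp add: sum_fun_apply if_distribR eps_def cong: if_cong)
qed

lemma div_diff_homogeneous:
  assumes "w \<in> W" "homogeneous (d + card (inversions w)) f"
  shows "homogeneous d (div_diff \<Omega> w f)"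
proof -
  obtain as where red: "red_word w as" using reduced_word_exists[OF assms(1)] by blast
  then have as: "set as \<subseteq> \<Omega>" "length as = card (inversions w)" using reduced_word_iff by auto
  show ?thesis
    using nablas_homogeneous[OF as(1), of d f] assms(2) as(2) nablas_reduced[OF red homogeneousD(1)[OF assms(2)]]
    by simp
qed

text \<open>In too low a degree the operator already kills \<open>f\<close>; in too high a degree
  the result is homogeneous of positive degree and vanishes at the origin.\<close>

lemma eps_degree:
  assumes w: "w \<in> W" and f: "homogeneous d f" and neq: "d \<noteq> card (inversions w)"
  shows "eps w f = 0"
proof -
  obtain as where red: "red_word w as" using reduced_word_exists[OF w] by blast
  then have as: "set as \<subseteq> \<Omega>" "length as = card (inversions w)" using reduced_word_iff by auto
  show ?thesis
  proof (cases "d < length as")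
    case True
    show ?thesis unfolding eps_nablas[OF red homogeneousD(1)[OF f]] nablas_low_degree[OF as(1) f True] by simp
  next
    case False
    define k where "k = d - Suc (length as)"
    have k: "d = Suc k + card (inversions w)" using False neq as(2) by (simp add: k_def)
    have "homogeneous (Suc k) (div_diff \<Omega> w f)" by (rule div_diff_homogeneous[OF w f[unfolded k]])
    then show ?thesis unfolding eps_def by (rule homogeneous_at_0) simp
  qed
qed

lemma inversions_bruhat_less:
  assumes w: "w \<in> W" and \<gamma>: "\<gamma> \<in> inversions w"
    and len: "Suc (card (inversions (w \<circ> refl_along \<gamma>))) = card (inversions w)"
  shows "w \<circ> refl_along \<gamma> \<in> W" "w \<circ> refl_along \<gamma> \<sqsubset> w"
proof -
  have root: "\<gamma> \<in> \<Psi>" using \<gamma> pos_subset by (auto simp: inversions_def)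
  show W: "w \<circ> refl_along \<gamma> \<in> W" by (rule W_comp[OF w W_refl[OF root]])
  have "w = (w \<circ> refl_along \<gamma>) \<circ> refl_along \<gamma>" by (simp add: fun_eq_iff)
  then have "bruhat_cover \<Psi> \<Omega> (w \<circ> refl_along \<gamma>) w"
    unfolding bruhat_cover_def len_eq_card_inversions[OF w] len_eq_card_inversions[OF W]
    using w W root len by (metis Suc_eq_plus1)
  then show "w \<circ> refl_along \<gamma> \<sqsubset> w" unfolding bruhat_less_def by (rule tranclp.r_into_trancl[where r = "bruhat_cover \<Psi> \<Omega>"])
qed

lemma bruhat_less_trans: "u \<sqsubset> v \<Longrightarrow> v \<sqsubset> w \<Longrightarrow> u \<sqsubset> w"
  unfolding bruhat_less_def by (rule tranclp_trans)

lemma bruhat_less_len: "u \<sqsubset> w \<Longrightarrow> len \<Omega> u < len \<Omega> w"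
  unfolding bruhat_less_def by (induction rule: tranclp_induct) (auto simp: bruhat_cover_def)

text \<open>The assumption on \<open>g\<close> is chosen so that it survives multiplication: by
  transitivity of the order it holds again for \<open>f2 * g\<close>, which is what the product case
  asks for.\<close>

lemma eps_mult_lower:
  assumes f: "f \<in> poly_fun" and "w \<in> W" "g \<in> poly_fun"
    and "\<And>u. u \<in> W \<Longrightarrow> u \<sqsubset> w \<Longrightarrow> eps u g = 0"
  shows "eps w (f * g) = f 0 * eps w g"
  using assms
proof (induction arbitrary: w g rule: poly_fun_induct)
  case (const c)
  then show ?case using poly_functionalD(2)[OF eps_functional] by blast
next
  case (cform a)
  have "eps w (cform a * g) = 0"
    unfolding eps_cform_mult[OF cform(1,2)]
    by (rule sum.neutral) (use cform(3) inversions_bruhat_less[OF cform(1)] in auto)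
  then show ?case by (simp only: cform_zero_right mult_zero_left)
next
  case (add f1 f2)
  have "eps w ((f1 + f2) * g) = eps w (f1 * g) + eps w (f2 * g)"
    unfolding distrib_right
    by (rule poly_functionalD(1)[OF eps_functional[OF add(5)] poly_fun_mult[OF add(1,6)] poly_fun_mult[OF add(2,6)]])
  also have "\<dots> = (f1 0 + f2 0) * eps w g"
    using add.IH(1)[OF add(5,6,7)] add.IH(2)[OF add(5,6,7)] by (simp only: distrib_right)
  also have "\<dots> = (f1 + f2) 0 * eps w g" by (simp only: plus_fun_apply)
  finally show ?case .
next
  case (mult f1 f2)
  have "eps u (f2 * g) = 0" if u: "u \<in> W" "u \<sqsubset> w" for u
  proof -
    have "eps u (f2 * g) = f2 0 * eps u g"
      by (rule mult.IH(2)[OF u(1) mult(6)]) (use mult(7) bruhat_less_trans u(2) in blast)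
    then show ?thesis using mult(7)[OF u] by simp
  qed
  then have "eps w (f1 * (f2 * g)) = f1 0 * eps w (f2 * g)"
    by (rule mult.IH(1)[OF mult(5) poly_fun_mult[OF mult(2,6)]])
  also have "eps w (f2 * g) = f2 0 * eps w g" by (rule mult.IH(2)[OF mult(5,6,7)])
  also have "f1 0 * (f2 0 * eps w g) = (f1 * f2) 0 * eps w g" by (simp only: mult.assoc times_fun_apply)
  also have "f1 * (f2 * g) = f1 * f2 * g" by (simp only: mult.assoc)
  finally show ?case .
qed

end

section \<open>The ideal of invariants and Schubert polynomials\<close>

lemma ideal_generated_add:
  assumes "f \<in> ideal_generated S" "g \<in> ideal_generated S"
  shows "f + g \<in> ideal_generated S"
  using assms(1)
proof (induction rule: ideal_generated.induct)
  case zero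
  have "0 + g \<in> ideal_generated S" unfolding add_0 by (rule assms(2))
  then show ?case .
next
  case (add a s h)
  have "a * s + (h + g) \<in> ideal_generated S" by (rule ideal_generated.add[OF add(1,2,4)])
  then have "a * s + h + g \<in> ideal_generated S" unfolding add.assoc .
  then show ?case .
qed

lemma ideal_generated_mult:
  assumes "f \<in> ideal_generated S" "p \<in> poly_fun"
  shows "p * f \<in> ideal_generated S"
  using assms(1)
proof (induction rule: ideal_generated.induct)
  case zero
  have "p * 0 \<in> ideal_generated S" unfolding mult_zero_right by (rule ideal_generated.zero)
  then show ?case .
next
  case (add a s h)
  have "(p * a) * s + p * h \<in> ideal_generated S"
    by (rule ideal_generated.add[OF poly_fun_mult[OF assms(2) add(1)] add(2,4)])
  then have "p * (a * s + h) \<in> ideal_generated S" unfolding distrib_left mult.assoc .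
  then show ?case .
qed

lemma ideal_generated_base: "s \<in> S \<Longrightarrow> s \<in> ideal_generated S"
  using ideal_generated.add[OF poly_fun_1 _ ideal_generated.zero, of s S] by simp

lemma ideal_generated_sum:
  "(\<And>i. i \<in> A \<Longrightarrow> f i \<in> ideal_generated S) \<Longrightarrow> sum f A \<in> ideal_generated S"
  by (induction A rule: infinite_finite_induct)
    (auto intro: ideal_generated_add ideal_generated.zero simp del: plus_fun_apply)

lemma ideal_generated_poly_fun:
  assumes "S \<subseteq> poly_fun" "f \<in> ideal_generated S"
  shows "f \<in> poly_fun"
  using assms(2)
proof (induction rule: ideal_generated.induct)
  case zero
  show ?case using poly_fun_0 .
next
  case (add a s h)
  have "a * s + h \<in> poly_fun" by (rule poly_fun_add[OF poly_fun_mult[OF add(1)] add(4)]) (use add(2) assms(1) in blast)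
  then show ?case .
qed

context based_root_system
begin

abbreviation "ideal \<equiv> invariant_ideal \<Psi>"
abbreviation "generators \<equiv> {f \<in> invariants \<Psi>. \<exists>d>0. homogeneous d f}"

lemma generators_poly_fun: "generators \<subseteq> poly_fun"
  by (auto simp: invariants_def)

lemma ideal_poly_fun: "f \<in> ideal \<Longrightarrow> f \<in> poly_fun"
  unfolding invariant_ideal_def by (rule ideal_generated_poly_fun[OF generators_poly_fun])

lemma act_W: "w \<in> W \<Longrightarrow> f \<in> invariants \<Psi> \<Longrightarrow> act w f = f"
  by (simp add: invariants_def)

lemma act_W_poly_fun: "w \<in> W \<Longrightarrow> f \<in> poly_fun \<Longrightarrow> act w f \<in> poly_fun"
  by (rule act_poly_fun[OF W_orthogonal W_bij])

lemma eps_ideal: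
  assumes w: "w \<in> W" and f: "f \<in> ideal"
  shows "eps w f = 0"
  using f unfolding invariant_ideal_def
proof (induction rule: ideal_generated.induct)
  case zero
  show ?case using poly_functional_0[OF eps_functional[OF w]] .
next
  case (add a s h)
  obtain as where red: "red_word w as" using reduced_word_exists[OF w] by blast
  then have as: "set as \<subseteq> \<Omega>" by (simp add: reduced_word_def)
  have s: "s \<in> poly_fun" "s \<in> invariants \<Psi>" "s 0 = 0"
    using add(2) generators_poly_fun homogeneous_at_0 by blast+
  have h: "h \<in> poly_fun" by (rule ideal_generated_poly_fun[OF generators_poly_fun add(3)])
  have "eps w (s * a) = nablas as (s * a) 0"
    by (rule eps_nablas[OF red poly_fun_mult[OF s(1) add(1)]])
  also have "nablas as (s * a) = s * nablas as a"
    by (rule nablas_invariant_mult[OF as s(1) add(1)]) (use act_W W_refl base_subset s(2) in blast)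
  finally have "eps w (s * a) = (s * nablas as a) 0" .
  also have "\<dots> = 0" by (simp only: times_fun_apply s(3) mult_zero_left)
  finally have 0: "eps w (s * a) = 0" .
  have "eps w (a * s + h) = eps w (a * s) + eps w h"
    by (rule poly_functionalD(1)[OF eps_functional[OF w] poly_fun_mult[OF add(1) s(1)] h])
  also have "\<dots> = 0"
    using 0 add(4) by (simp only: mult.commute[of a s] add_0)
  finally have "eps w (a * s + h) = 0" .
  then show ?case .
qed

lemma act_ideal:
  assumes w: "w \<in> W" and f: "f \<in> ideal"
  shows "act w f \<in> ideal"
  using f unfolding invariant_ideal_def
proof (induction rule: ideal_generated.induct)
  case zero
  have eq: "act w 0 = 0" by (simp add: act_def fun_eq_iff)
  have "act w 0 \<in> ideal_generated generators" unfolding eq by (rule ideal_generated.zero)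
  then show ?case .
next
  case (add a s h)
  have "act w s = s" using act_W[OF w] add(2) by blast
  then have "act w (a * s + h) = act w a * s + act w h" by (simp only: act_simps)
  also have "\<dots> \<in> ideal_generated generators"
    by (rule ideal_generated.add[OF act_W_poly_fun[OF w add(1)] add(2,4)])
  finally show ?case .
qed

section \<open>Averaging over the group, and a criterion for membership in the ideal\<close>

definition average :: "('a cfun) \<Rightarrow> 'a cfun" where
  "average f = (\<lambda>_. 1 / of_nat (card W)) * (\<Sum>w\<in>W. act w f)"

lemma finite_W: "finite W" by (rule finite_weyl_group[OF roots])

lemma card_W: "card W \<noteq> 0"
  using finite_W W_id by auto

lemma bij_betw_comp_W: "u \<in> W \<Longrightarrow> bij_betw (\<lambda>w. u \<circ> w) W W"
  by (rule bij_betwI[where g = "\<lambda>w. inv u \<circ> w"])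
    (auto intro: W_comp W_inv simp: comp_assoc[symmetric] weyl_group_inv_comp[OF roots]
      weyl_group_comp_inv[OF roots] simp del: comp_apply)

lemma average_invariant:
  assumes f: "f \<in> poly_fun"
  shows "average f \<in> invariants \<Psi>"
proof -
  have "act u (average f) = average f" if u: "u \<in> W" for u
  proof -
    have "act u (\<Sum>w\<in>W. act w f) = (\<Sum>w\<in>W. act u (act w f))"
      by (simp add: act_def fun_eq_iff sum_fun_apply)
    also have "\<dots> = (\<Sum>w\<in>W. act (u \<circ> w) f)"
      by (rule sum.cong[OF HOL.refl]) (rule act_comp[OF W_bij[OF u] W_bij, symmetric])
    also have "\<dots> = (\<Sum>w\<in>W. act w f)"
      by (rule sum.reindex_bij_betw[OF bij_betw_comp_W[OF u]])
    finally show ?thesis unfolding average_def act_simps by simp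
  qed
  moreover have "average f \<in> poly_fun"
    unfolding average_def by (intro poly_fun_mult poly_fun_const poly_fun_sum act_W_poly_fun f)
  ultimately show ?thesis unfolding invariants_def by blast
qed

lemma average_homogeneous: "homogeneous d f \<Longrightarrow> homogeneous d (average f)"
  unfolding average_def by (intro homogeneous_scale homogeneous_sum act_homogeneous W_orthogonal W_bij)

text \<open>Telescopes along a word: \<open>f - s w f = (f - s f) + s (f - w f)\<close>, and the
  ideal is stable under the group.\<close>

lemma diff_act_ideal:
  assumes f: "f \<in> poly_fun" and simple: "\<And>\<alpha>. \<alpha> \<in> \<Omega> \<Longrightarrow> f - act (refl_along \<alpha>) f \<in> ideal" and w: "w \<in> W"
  shows "f - act w f \<in> ideal"
proof -
  have "f - act (word_prod as) f \<in> ideal" if "set as \<subseteq> \<Omega>" for as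
    using that
  proof (induction as)
    case Nil
    show ?case
      unfolding word_prod_simps act_id diff_self invariant_ideal_def by (rule ideal_generated.zero)
  next
    case (Cons \<alpha> as)
    then have as: "set as \<subseteq> \<Omega>" "\<alpha> \<in> \<Omega>" "refl_along \<alpha> \<in> W" using W_refl base_subset by auto
    have "act (word_prod (\<alpha> # as)) f = act (refl_along \<alpha>) (act (word_prod as) f)"
      unfolding word_prod_simps by (rule act_comp[OF bij_refl_along W_bij[OF word_prod_in_W[OF as(1)]]])
    then have "f - act (word_prod (\<alpha> # as)) f =
        (f - act (refl_along \<alpha>) f) + act (refl_along \<alpha>) (f - act (word_prod as) f)"
      by (simp only: act_simps) (rule ext, simp)
    also have "\<dots> \<in> ideal"
      using ideal_generated_add simple[OF as(2)] act_ideal[OF as(3) Cons.IH[OF as(1)]]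
      unfolding invariant_ideal_def by blast
    finally show ?case .
  qed
  then show ?thesis using W_words[OF w] by blast
qed

lemma homogeneous_in_ideal:
  assumes "homogeneous d f" "\<And>w. w \<in> W \<Longrightarrow> eps w f = 0"
  shows "f \<in> ideal"
  using assms
proof (induction d arbitrary: f)
  case 0
  have "f 0 = 0" using eps_id[OF homogeneousD(1)[OF 0(1)]] 0(2)[OF W_id] by simp
  then have eq: "f = 0"
    using fun_cong[OF homogeneous_degree_0[OF 0(1)]] by (intro ext) (metis zero_fun_apply)
  show ?case unfolding eq invariant_ideal_def by (rule ideal_generated.zero)
next
  case (Suc d)
  have pf: "f \<in> poly_fun" by (rule homogeneousD(1)[OF Suc.prems(1)])
  have "f - act (refl_along \<alpha>) f \<in> ideal" if \<alpha>: "\<alpha> \<in> \<Omega>" for \<alpha>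
  proof -
    have \<alpha>0: "\<alpha> \<noteq> 0" using base_nonzero[OF \<alpha>] .
    have "nabla \<alpha> f \<in> ideal"
    proof (rule Suc.IH[OF nabla_homogeneous[OF \<alpha>0 Suc.prems(1)]])
      fix w assume "w \<in> W"
      then obtain as where red: "red_word w as" using reduced_word_exists by blast
      then have as: "set (as @ [\<alpha>]) \<subseteq> \<Omega>" using \<alpha> by (simp add: reduced_word_def)
      have "eps w (nabla \<alpha> f) = nablas as (nabla \<alpha> f) 0" by (rule eps_nablas[OF red nabla_poly_fun[OF \<alpha>0 pf]])
      also have "nablas as (nabla \<alpha> f) = nablas (as @ [\<alpha>]) f" by (simp only: nablas_append nablas_Cons nablas_Nil)
      \<comment> \<open>The word \<open>as @ [\<alpha>]\<close> need not be reduced. Then its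
        operator is zero; otherwise it computes \<open>eps\<close> of another group element, and the
        assumption on \<open>f\<close> applies.\<close>
      also have "nablas (as @ [\<alpha>]) f 0 = 0"
        unfolding nablas_eq[OF as pf] using Suc.prems(2)[OF word_prod_in_W[OF as]] by (simp add: eps_def)
      finally show "eps w (nabla \<alpha> f) = 0" .
    qed
    then show ?thesis unfolding nabla_eq[OF \<alpha>0 pf] invariant_ideal_def
      by (rule ideal_generated_mult[OF _ root_fun_in_poly_fun])
  qed
  then have diff: "f - act w f \<in> ideal" if "w \<in> W" for w using diff_act_ideal[OF pf _ that] by blast
  have "f - average f = (\<lambda>_. 1 / of_nat (card W)) * (\<Sum>w\<in>W. f - act w f)"
  proof
    fix x
    have "(\<Sum>w\<in>W. f x - act w f x) = of_nat (card W) * f x - (\<Sum>w\<in>W. act w f x)"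
      by (simp add: sum_subtractf)
    then show "(f - average f) x = ((\<lambda>_. 1 / of_nat (card W)) * (\<Sum>w\<in>W. f - act w f)) x"
      using card_W by (simp add: average_def sum_fun_apply field_simps)
  qed
  also have "\<dots> \<in> ideal"
    unfolding invariant_ideal_def
    by (rule ideal_generated_mult[OF ideal_generated_sum poly_fun_const]) (rule diff[unfolded invariant_ideal_def])
  finally have 1: "f - average f \<in> ideal" .
  have 2: "average f \<in> ideal" unfolding invariant_ideal_def
    by (rule ideal_generated_base)
      (use average_invariant[OF pf] average_homogeneous[OF Suc.prems(1)] in blast)
  have "f - average f + average f \<in> ideal"
    using 1 2 unfolding invariant_ideal_def by (rule ideal_generated_add)
  then show ?case by (simp only: diff_add_cancel)
qed

section \<open>The product of the positive roots and its top divided difference\<close>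

definition root_product :: "'a cfun" where
  "root_product = (\<Prod>\<alpha>\<in>pos. root_fun \<alpha>)"

lemma homogeneous_root_product: "homogeneous (card pos) root_product"
proof -
  have "homogeneous (card A) (\<Prod>\<alpha>\<in>A. root_fun \<alpha>)" if "finite A" for A :: "'a set"
    using that
  proof (induction A rule: finite_induct)
    case empty
    then show ?case using homogeneous_const[of 1] by (simp add: func_one)
  next
    case (insert \<alpha> A)
    have "homogeneous (1 + card A) (root_fun \<alpha> * (\<Prod>\<alpha>\<in>A. root_fun \<alpha>))"
      unfolding root_fun_def by (rule homogeneous_mult[OF homogeneous_cform insert.IH[unfolded root_fun_def]])
    then show ?case using insert by (simp del: times_fun_apply)
  qed
  then show ?thesis unfolding root_product_def using finite_pos by blast
qed

lemma root_fun_orthogonal: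
  assumes "orthogonal_transformation w"
  shows "root_fun (w \<gamma>) (map_prod w w y) = root_fun \<gamma> y"
  using cform_orthogonal[OF assms, of "(\<gamma>, 0)" y] linear_0[OF orthogonal_transformation_linear[OF assms]]
  by (simp add: root_fun_def)

text \<open>The reflection permutes the positive roots other than \<open>\<alpha>\<close> and
  negates \<open>\<alpha>\<close>.\<close>

lemma root_product_refl_along:
  assumes \<alpha>: "\<alpha> \<in> \<Omega>"
  shows "root_product (map_prod (refl_along \<alpha>) (refl_along \<alpha>) y) = - root_product y"
proof -
  let ?s = "refl_along \<alpha>"
  have bij: "bij_betw ?s (pos - {\<alpha>}) (pos - {\<alpha>})"
  proof (rule bij_betwI[where g = ?s])
    have "?s \<gamma> \<in> pos - {\<alpha>}" if "\<gamma> \<in> pos - {\<alpha>}" for \<gamma>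
    proof -
      have "?s \<gamma> \<in> pos" using simple_reflection_pos[OF \<alpha>] that by blast
      moreover have "?s \<gamma> \<noteq> \<alpha>"
      proof
        assume "?s \<gamma> = \<alpha>"
        then have "\<gamma> = ?s \<alpha>" by (metis refl_along_refl_along)
        then have "\<gamma> = - \<alpha>" using refl_along_self[OF base_nonzero[OF \<alpha>]] by simp
        then show False using that not_pos_and_neg[OF base_pos[OF \<alpha>]] by blast
      qed
      ultimately show ?thesis by blast
    qed
    then show "?s \<in> pos - {\<alpha>} \<rightarrow> pos - {\<alpha>}" "?s \<in> pos - {\<alpha>} \<rightarrow> pos - {\<alpha>}" by blast+
  qed simp_all
  have split: "root_product z = root_fun \<alpha> z * (\<Prod>\<gamma>\<in>pos - {\<alpha>}. root_fun \<gamma> z)" for z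
    unfolding root_product_def prod_fun_apply by (rule prod.remove[OF finite_pos base_pos[OF \<alpha>]])
  have s: "root_fun (?s \<gamma>) (map_prod ?s ?s y) = root_fun \<gamma> y" for \<gamma>
    by (rule root_fun_orthogonal[OF orthogonal_transformation_refl_along])
  have "(\<Prod>\<gamma>\<in>pos - {\<alpha>}. root_fun \<gamma> (map_prod ?s ?s y)) = (\<Prod>\<gamma>\<in>pos - {\<alpha>}. root_fun (?s \<gamma>) (map_prod ?s ?s y))"
    by (rule prod.reindex_bij_betw[OF bij, symmetric])
  also have "\<dots> = (\<Prod>\<gamma>\<in>pos - {\<alpha>}. root_fun \<gamma> y)" by (simp only: s)
  finally have "(\<Prod>\<gamma>\<in>pos - {\<alpha>}. root_fun \<gamma> (map_prod ?s ?s y)) = (\<Prod>\<gamma>\<in>pos - {\<alpha>}. root_fun \<gamma> y)" .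
  moreover have "root_fun \<alpha> (map_prod ?s ?s y) = - root_fun \<alpha> y"
  proof -
    have "root_fun \<alpha> (map_prod ?s ?s y) = root_fun (?s (- \<alpha>)) (map_prod ?s ?s y)"
      using refl_along_self[OF base_nonzero[OF \<alpha>]] linear_neg[OF linear_refl_along, of \<alpha> \<alpha>] by simp
    also have "\<dots> = root_fun (- \<alpha>) y" by (rule s)
    also have "\<dots> = - root_fun \<alpha> y" by (simp add: root_fun_def cform_def complex_eq_iff)
    finally show ?thesis .
  qed
  ultimately show ?thesis by (simp add: split)
qed

text \<open>Used in two roles: as a base point whose orbit meets no reflecting hyperplane, and as a
  linear function with positive pairings with all positive coroots.\<close>

definition dominant :: "'a cplx" where
  "dominant = ((SOME x. \<forall>\<beta>\<in>pos. x \<bullet> \<beta> > 0), 0)"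

lemma dominant_inner: "\<beta> \<in> pos \<Longrightarrow> fst dominant \<bullet> \<beta> > 0"
  unfolding dominant_def fst_conv
  using someI_ex[of "\<lambda>x. \<forall>\<beta>\<in>pos. x \<bullet> \<beta> > 0"] dominant_vector_exists by blast

lemma root_product_orbit_nonzero:
  assumes w: "w \<in> W"
  shows "root_product (map_prod w w dominant) \<noteq> 0"
proof -
  have "root_fun \<gamma> (map_prod w w dominant) \<noteq> 0" if \<gamma>: "\<gamma> \<in> pos" for \<gamma>
  proof -
    have "root_fun \<gamma> (map_prod w w dominant) = root_fun (w (inv w \<gamma>)) (map_prod w w dominant)"
      using w by simp
    also have "\<dots> = root_fun (inv w \<gamma>) dominant" by (rule root_fun_orthogonal[OF W_orthogonal[OF w]])
    also have "\<dots> = of_real (fst dominant \<bullet> inv w \<gamma>)"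
      by (simp add: root_fun_def cform_def complex_eq_iff dominant_def inner_commute)
    finally have eq: "root_fun \<gamma> (map_prod w w dominant) = of_real (fst dominant \<bullet> inv w \<gamma>)" .
    have "fst dominant \<bullet> inv w \<gamma> \<noteq> 0"
      using W_pos_or_neg[OF W_inv[OF w] \<gamma>] dominant_inner[of "inv w \<gamma>"] dominant_inner[of "- inv w \<gamma>"] by auto
    then show ?thesis by (simp add: eq)
  qed
  then show ?thesis unfolding root_product_def prod_fun_apply using finite_pos by simp
qed

text \<open>The value at \<open>dominant\<close> of the symmetrization of \<open>f / root_product\<close>; the denominators do not
  vanish since the orbit of \<open>dominant\<close> avoids the reflecting hyperplanes.\<close>

definition orbit_sum :: "('a cfun) \<Rightarrow> complex" where
  "orbit_sum f = (\<Sum>w\<in>W. f (map_prod w w dominant) / root_product (map_prod w w dominant))"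

text \<open>The denominator \<open>q\<close>, the product of \<open>root_fun \<alpha>\<close> and
  \<open>root_product\<close>, is invariant under the reflection because both factors change sign.
  Reindexing the orbit therefore moves the reflection from \<open>f\<close> to
  \<open>g\<close>.\<close>

lemma orbit_sum_nabla:
  assumes \<alpha>: "\<alpha> \<in> \<Omega>" and f: "f \<in> poly_fun" and g: "g \<in> poly_fun"
  shows "orbit_sum (nabla \<alpha> f * g) = orbit_sum (f * nabla \<alpha> g)"
proof -
  let ?s = "refl_along \<alpha>"
  define y where "y w = map_prod w w dominant" for w :: "'a \<Rightarrow> 'a"
  have \<alpha>0: "\<alpha> \<noteq> 0" and sW: "?s \<in> W" using base_nonzero[OF \<alpha>] W_refl \<alpha> base_subset by auto
  have nz: "root_fun \<alpha> (y w) \<noteq> 0" if "w \<in> W" for w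
    using root_product_orbit_nonzero[OF that] base_pos[OF \<alpha>] finite_pos
    unfolding root_product_def prod_fun_apply y_def by auto
  have nabla: "nabla \<alpha> h (y w) = (h (y w) - h (y (?s \<circ> w))) / root_fun \<alpha> (y w)"
    if "h \<in> poly_fun" "w \<in> W" for h w
  proof -
    have "map_prod ?s ?s (y w) = y (?s \<circ> w)" by (cases dominant) (simp add: y_def)
    then have "h (y w) - h (y (?s \<circ> w)) = root_fun \<alpha> (y w) * nabla \<alpha> h (y w)"
      using fun_cong[OF nabla_eq[OF \<alpha>0 that(1)], of "y w"] by (simp add: act_refl_along)
    then show ?thesis using nz[OF that(2)] by simp
  qed
  define q where "q w = root_fun \<alpha> (y w) * root_product (y w)" for w
  have q: "q (?s \<circ> w) = q w" for w
  proof -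
    have e: "y (?s \<circ> w) = map_prod ?s ?s (y w)" by (cases dominant) (simp add: y_def)
    have "root_fun \<alpha> (map_prod ?s ?s (y w)) = - root_fun \<alpha> (y w)"
      using fun_cong[OF act_refl_along_root_fun[OF \<alpha>0], of "y w"] by (simp add: act_refl_along)
    then show ?thesis unfolding q_def e using root_product_refl_along[OF \<alpha>, of "y w"] by simp
  qed
  have "(\<Sum>w\<in>W. f (y (?s \<circ> w)) * g (y w) / q w) =
      (\<Sum>w\<in>W. f (y (?s \<circ> (?s \<circ> w))) * g (y (?s \<circ> w)) / q (?s \<circ> w))"
    by (rule sum.reindex_bij_betw[OF bij_betw_comp_W[OF sW], symmetric])
  also have "\<dots> = (\<Sum>w\<in>W. f (y w) * g (y (?s \<circ> w)) / q w)"
    unfolding q comp_assoc[symmetric] refl_along_comp id_comp ..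
  finally have swap: "(\<Sum>w\<in>W. f (y (?s \<circ> w)) * g (y w) / q w) = (\<Sum>w\<in>W. f (y w) * g (y (?s \<circ> w)) / q w)" .
  have "orbit_sum (nabla \<alpha> f * g) = (\<Sum>w\<in>W. f (y w) * g (y w) / q w - f (y (?s \<circ> w)) * g (y w) / q w)"
    unfolding orbit_sum_def y_def[symmetric]
    by (rule sum.cong[OF HOL.refl]) (simp add: nabla[OF f] q_def algebra_simps diff_divide_distrib)
  also have "\<dots> = (\<Sum>w\<in>W. f (y w) * g (y w) / q w - f (y w) * g (y (?s \<circ> w)) / q w)"
    unfolding sum_subtractf swap ..
  also have "\<dots> = orbit_sum (f * nabla \<alpha> g)"
    unfolding orbit_sum_def y_def[symmetric]
    by (rule sum.cong[OF HOL.refl]) (simp add: nabla[OF g] q_def algebra_simps diff_divide_distrib)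
  finally show ?thesis .
qed

lemma orbit_sum_nablas:
  assumes "set as \<subseteq> \<Omega>" "f \<in> poly_fun" "g \<in> poly_fun"
  shows "orbit_sum (nablas as f * g) = orbit_sum (f * nablas (rev as) g)"
  using assms
proof (induction as arbitrary: g)
  case (Cons \<alpha> as)
  then have as: "set as \<subseteq> \<Omega>" "\<alpha> \<in> \<Omega>" by auto
  have "orbit_sum (nabla \<alpha> (nablas as f) * g) = orbit_sum (nablas as f * nabla \<alpha> g)"
    by (rule orbit_sum_nabla[OF as(2) nablas_poly_fun[OF as(1) Cons.prems(2)] Cons.prems(3)])
  also have "\<dots> = orbit_sum (f * nablas (rev as) (nabla \<alpha> g))"
    by (rule Cons.IH[OF as(1) Cons.prems(2) nabla_poly_fun[OF base_nonzero[OF as(2)] Cons.prems(3)]])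
  finally show ?case unfolding rev.simps nablas_append nablas_Cons nablas_Nil .
qed simp

text \<open>The Leibniz rule expresses the value as a sum over saturated chains in the Bruhat order of
  products of pairings with the dominant vector, all of which are positive.\<close>

lemma eps_dominant_power_pos:
  assumes "w \<in> W"
  shows "\<exists>r>0. eps w (cform dominant ^ card (inversions w)) = complex_of_real r"
  using assms
proof (induction "card (inversions w)" arbitrary: w)
  case 0
  then have "w = id" using inversions_empty by simp
  then have "eps w (cform dominant ^ card (inversions w)) = eps id (cform dominant ^ 0)"
    using 0(1) by metis
  also have "\<dots> = (cform dominant ^ 0) 0" by (rule eps_id) blast
  also have "\<dots> = 1" by (simp add: power_fun_apply)
  finally have "eps w (cform dominant ^ card (inversions w)) = 1" .
  then show ?case by (intro exI[of _ 1]) simp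
next
  case (Suc n)
  let ?c = "\<lambda>\<gamma>. Suc (card (inversions (w \<circ> refl_along \<gamma>))) = card (inversions w)"
  have "\<exists>r>0. eps (w \<circ> refl_along \<gamma>) (cform dominant ^ n) = complex_of_real r"
    if "\<gamma> \<in> inversions w" "?c \<gamma>" for \<gamma>
  proof -
    have "n = card (inversions (w \<circ> refl_along \<gamma>))" using that(2) Suc(2) by simp
    with Suc(1)[OF this inversions_bruhat_less(1)[OF Suc(3) that]] show ?thesis by simp
  qed
  then obtain r where r: "\<And>\<gamma>. \<gamma> \<in> inversions w \<Longrightarrow> ?c \<gamma> \<Longrightarrow>
    r \<gamma> > 0 \<and> eps (w \<circ> refl_along \<gamma>) (cform dominant ^ n) = complex_of_real (r \<gamma>)" by metis
  define p where "p \<gamma> = 2 * (fst dominant \<bullet> \<gamma>) / (\<gamma> \<bullet> \<gamma>)" for \<gamma>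
  have p: "root_pairing \<gamma> dominant = complex_of_real (p \<gamma>)" for \<gamma>
    by (simp add: root_pairing_def cform_def dominant_def complex_eq_iff p_def
        Re_divide_of_real Im_divide_of_real)
  have ppos: "p \<gamma> > 0" if "\<gamma> \<in> inversions w" for \<gamma>
    using that dominant_inner pos_subset root_nonzero[OF roots] by (auto simp: inversions_def p_def)
  have "eps w (cform dominant ^ card (inversions w)) = eps w (cform dominant * cform dominant ^ n)"
    unfolding Suc(2)[symmetric] by (simp only: power_Suc)
  also have "\<dots> = (\<Sum>\<gamma>\<in>inversions w. root_pairing \<gamma> dominant *
      (if ?c \<gamma> then eps (w \<circ> refl_along \<gamma>) (cform dominant ^ n) else 0))"
    by (rule eps_cform_mult[OF Suc(3)]) blast
  also have "\<dots> = (\<Sum>\<gamma>\<in>inversions w. complex_of_real (p \<gamma> * (if ?c \<gamma> then r \<gamma> else 0)))"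
    by (rule sum.cong[OF HOL.refl]) (use r in \<open>simp add: p\<close>)
  also have "\<dots> = complex_of_real (\<Sum>\<gamma>\<in>inversions w. p \<gamma> * (if ?c \<gamma> then r \<gamma> else 0))" by simp
  finally have eq: "eps w (cform dominant ^ card (inversions w)) = \<dots>" .
  \<comment> \<open>Strict positivity requires a nonempty sum; dropping the first letter of a
    reduced word provides a cover.\<close>
  have "\<exists>\<gamma>\<in>inversions w. ?c \<gamma>"
  proof -
    obtain as where red: "red_word w as" using reduced_word_exists[OF Suc(3)] by blast
    have "length as = Suc n" using reduced_word_card_inversions[OF red] Suc(2) by simp
    then obtain \<alpha> as' where as: "as = \<alpha> # as'" by (cases as) auto
    define \<gamma> where "\<gamma> = inv (word_prod as') \<alpha>"
    have mem: "(\<gamma>, as') \<in> set (deletions as)" by (simp add: as \<gamma>_def)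
    then have "\<gamma> \<in> inversions w" using reduced_word_deletions(2)[OF red] by force
    moreover have "w \<circ> refl_along \<gamma> = word_prod as'"
      using deletions_props[OF _ mem] red by (simp add: reduced_word_def)
    moreover have "card (inversions (word_prod as')) = length as'"
      by (rule reduced_word_card_inversions[OF reduced_word_tl[OF red[unfolded as]]])
    ultimately show ?thesis using \<open>length as = Suc n\<close> as Suc(2) by (intro bexI[of _ \<gamma>]) simp_all
  qed
  then obtain \<gamma> where \<gamma>: "\<gamma> \<in> inversions w" "?c \<gamma>" by blast
  have "(\<Sum>\<gamma>\<in>inversions w. p \<gamma> * (if ?c \<gamma> then r \<gamma> else 0)) > 0"
  proof (rule sum_pos2[OF finite_inversions \<gamma>(1)])
    show "p \<gamma> * (if ?c \<gamma> then r \<gamma> else 0) > 0" using \<gamma> r[OF \<gamma>] ppos by simp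
    show "p \<delta> * (if ?c \<delta> then r \<delta> else 0) \<ge> 0" if "\<delta> \<in> inversions w" for \<delta>
      using that r[OF that] ppos[OF that] by (simp add: less_imp_le)
  qed
  then show ?case using eq by blast
qed

abbreviation "PS \<equiv> \<lambda>\<Phi>. PS_fun \<Phi> \<Psi> \<Omega>"
abbreviation "\<DD> \<equiv> PS_skew_at \<Psi> \<Omega>"
abbreviation "\<SS> \<equiv> schubert \<Psi> \<Omega>"

text \<open>In fact \<open>kappa = 1\<close>, but only \<open>kappa \<noteq> 0\<close> matters: rescaling all Schubert polynomials by a common
  factor rescales the two sides of the theorem in the same way.\<close>

definition kappa :: complex where
  "kappa = eps w\<^sub>0 root_product / of_nat (card W)"

text \<open>Both \<open>root_product\<close> and \<open>?f\<close> have degree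
  \<open>card pos\<close>, so their top divided differences are constants. If that of
  \<open>root_product\<close> were zero, adjointness would make the orbit sum of
  \<open>nablas (rev as) ?f * root_product\<close> zero; but this is the order of the group times
  \<open>eps w\<^sub>0 ?f\<close>, which is positive.\<close>

lemma eps_longest_root_product_nonzero: "eps w\<^sub>0 root_product \<noteq> 0"
proof
  assume 0: "eps w\<^sub>0 root_product = 0"
  let ?f = "cform dominant ^ card pos"
  obtain as where red: "red_word w\<^sub>0 as" using reduced_word_exists[OF longest_props(1)] by blast
  then have as: "set as \<subseteq> \<Omega>" "length as = card pos" "word_prod as = w\<^sub>0"
    using reduced_word_iff longest_props(2) by auto
  have rpoly: "root_product \<in> poly_fun" by (rule homogeneousD(1)[OF homogeneous_root_product])
  have fpoly: "?f \<in> poly_fun" by blast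
  have "homogeneous (card pos * 1) ?f" by (rule homogeneous_power[OF homogeneous_cform])
  then have fhom: "homogeneous (0 + length (rev as)) ?f" using as(2) by simp
  \<comment> \<open>Adjointness reverses words; as the longest element is an involution, the
    reversed word is again a reduced word for it.\<close>
  have "inv w\<^sub>0 = w\<^sub>0"
    by (rule longest_unique[OF W_inv[OF longest_props(1)]])
      (simp add: inversions_inv[OF longest_props(1)] longest_props(2))
  then have "word_prod (rev as) = w\<^sub>0" using inv_word_prod[of as] as(3) by simp
  then have red': "red_word w\<^sub>0 (rev as)"
    unfolding reduced_word_iff using as longest_props(2) by simp
  have deg: "homogeneous 0 (nablas as root_product)"
    by (rule nablas_homogeneous[OF as(1)]) (use homogeneous_root_product as(2) in simp)
  have "nablas as root_product = 0"
  proof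
    fix x
    show "nablas as root_product x = 0 x"
      using fun_cong[OF homogeneous_degree_0[OF deg], of x] eps_nablas[OF red rpoly] 0 by simp
  qed
  then have "orbit_sum (?f * nablas as root_product) = 0" by (simp add: orbit_sum_def)
  then have "orbit_sum (nablas (rev as) ?f * root_product) = 0"
    using orbit_sum_nablas[of "rev as", OF _ fpoly rpoly] as(1) by simp
  moreover have "nablas (rev as) ?f = (\<lambda>_. eps w\<^sub>0 ?f)"
    unfolding eps_nablas[OF red' fpoly]
    by (rule homogeneous_degree_0[OF nablas_homogeneous[OF _ fhom]]) (simp add: as(1))
  ultimately have "orbit_sum ((\<lambda>_. eps w\<^sub>0 ?f) * root_product) = 0" by metis
  then have "of_nat (card W) * eps w\<^sub>0 ?f = 0"
    using root_product_orbit_nonzero by (simp add: orbit_sum_def)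
  moreover obtain r where "r > 0" "eps w\<^sub>0 ?f = complex_of_real r"
    using eps_dominant_power_pos[OF longest_props(1)] longest_props(2) by metis
  ultimately show False using card_W by simp
qed

lemma kappa_nonzero: "kappa \<noteq> 0"
  using eps_longest_root_product_nonzero card_W by (simp add: kappa_def)

lemma schubert_eq: "\<SS> w = (\<lambda>_. 1 / of_nat (card W)) * div_diff \<Omega> (inv w \<circ> w\<^sub>0) root_product"
  by (simp only: schubert_def root_product_def)

lemma schubert_homogeneous:
  assumes w: "w \<in> W"
  shows "homogeneous (card (inversions w)) (\<SS> w)"
proof -
  have "homogeneous (card (inversions w) + card (inversions (inv w \<circ> w\<^sub>0))) root_product"
    using homogeneous_root_product card_inversions_inv_longest[OF w] by (simp add: add.commute)
  then show ?thesis unfolding schubert_eq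
    by (intro homogeneous_scale div_diff_homogeneous W_comp W_inv w longest_props(1))
qed

lemma schubert_poly_fun: "w \<in> W \<Longrightarrow> \<SS> w \<in> poly_fun"
  by (rule homogeneousD(1)[OF schubert_homogeneous])

text \<open>Concatenating the two words gives an operator for
  \<open>u \<circ> (inv w \<circ> w\<^sub>0)\<close>. On \<open>root_product\<close>, of degree
  \<open>card pos\<close>, only an element of that length can have nonzero \<open>eps\<close>, and
  this is the longest one, which forces \<open>u = w\<close>.\<close>

lemma eps_schubert:
  assumes u: "u \<in> W" and w: "w \<in> W"
  shows "eps u (\<SS> w) = (if u = w then kappa else 0)"
proof -
  have rpoly: "root_product \<in> poly_fun" by (rule homogeneousD(1)[OF homogeneous_root_product])
  have v: "inv w \<circ> w\<^sub>0 \<in> W" by (intro W_comp W_inv w longest_props(1))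
  obtain as where red: "red_word u as" using reduced_word_exists[OF u] by blast
  obtain bs where red': "red_word (inv w \<circ> w\<^sub>0) bs" using reduced_word_exists[OF v] by blast
  have as: "set as \<subseteq> \<Omega>" "word_prod as = u" "length as = card (inversions u)"
    and bs: "set bs \<subseteq> \<Omega>" "word_prod bs = inv w \<circ> w\<^sub>0" "length bs = card (inversions (inv w \<circ> w\<^sub>0))"
    using red red' reduced_word_iff by auto
  have set: "set (as @ bs) \<subseteq> \<Omega>" using as bs by simp
  have uvW: "word_prod (as @ bs) \<in> W" by (rule word_prod_in_W[OF set])
  have prod: "word_prod (as @ bs) = u \<circ> (inv w \<circ> w\<^sub>0)" by (simp only: word_prod_append as bs)
  have dpoly: "div_diff \<Omega> (inv w \<circ> w\<^sub>0) root_product \<in> poly_fun"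
    using nablas_poly_fun[OF bs(1) rpoly] nablas_reduced[OF red' rpoly] by simp
  have "eps u (\<SS> w) = 1 / of_nat (card W) * eps u (div_diff \<Omega> (inv w \<circ> w\<^sub>0) root_product)"
    unfolding schubert_eq by (rule poly_functionalD(2)[OF eps_functional[OF u] dpoly])
  also have "eps u (div_diff \<Omega> (inv w \<circ> w\<^sub>0) root_product) = nablas (as @ bs) root_product 0"
    unfolding eps_nablas[OF red dpoly] nablas_append nablas_reduced[OF red' rpoly] ..
  also have "\<dots> = (if u = w then eps w\<^sub>0 root_product else 0)"
  proof (cases "u = w")
    case True
    have "word_prod (as @ bs) = w\<^sub>0" unfolding prod True using w by (simp add: fun_eq_iff)
    moreover have "length (as @ bs) = card pos"
      using as(3) bs(3) card_inversions_inv_longest[OF w] True by simp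
    ultimately have "red_word w\<^sub>0 (as @ bs)"
      unfolding reduced_word_iff using set longest_props(2) by simp
    then show ?thesis using eps_nablas[OF _ rpoly] True by (simp only: if_True simp_thms)
  next
    case False
    have "word_prod (as @ bs) \<noteq> w\<^sub>0"
    proof
      assume eq: "word_prod (as @ bs) = w\<^sub>0"
      have "u (inv w x) = x" for x
        using fun_cong[OF eq[unfolded prod], of "inv w\<^sub>0 x"] longest_props(1) by simp
      then have "u x = w x" for x using w by (metis W_inv_f)
      then show False using False by blast
    qed
    then have "card (inversions (word_prod (as @ bs))) \<noteq> card pos"
      using longest_unique[OF uvW] by blast
    then have "eps (word_prod (as @ bs)) root_product = 0"
      using eps_degree[OF uvW homogeneous_root_product] by simp
    then show ?thesis unfolding nablas_eq[OF set rpoly] using False by (simp add: eps_def)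
  qed
  finally show ?thesis by (simp add: kappa_def)
qed

lemma schubert_expansion:
  assumes "f \<in> poly_fun"
  shows "f - (\<Sum>w\<in>W. (\<lambda>_. eps w f / kappa) * \<SS> w) \<in> ideal"
  using assms
proof (induction rule: homogeneous_induct)
  case (homogeneous d f)
  have pf: "f \<in> poly_fun" by (rule homogeneousD(1)[OF homogeneous])
  let ?S = "\<Sum>w\<in>W. (\<lambda>_. eps w f / kappa) * \<SS> w"
  \<comment> \<open>The Schubert polynomials have various degrees, but off degree \<open>d\<close>
    the coefficient \<open>eps w f\<close> vanishes. So the whole sum is homogeneous and
    \<open>homogeneous_in_ideal\<close> applies.\<close>
  have hom: "homogeneous d ((\<lambda>_. eps w f / kappa) * \<SS> w)" if w: "w \<in> W" for w
  proof (cases "d = card (inversions w)")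
    case True
    then show ?thesis using schubert_homogeneous[OF w] by (intro homogeneous_scale) simp
  next
    case False
    then have "(\<lambda>_. eps w f / kappa) * \<SS> w = 0"
      using eps_degree[OF w homogeneous] by (simp add: fun_eq_iff)
    then show ?thesis using homogeneous_0 by metis
  qed
  have "homogeneous d (f - ?S)" by (intro homogeneous_diff homogeneous homogeneous_sum hom)
  moreover have "eps u (f - ?S) = 0" if u: "u \<in> W" for u
  proof -
    have "eps u ?S = (\<Sum>w\<in>W. eps u ((\<lambda>_. eps w f / kappa) * \<SS> w))"
      by (rule poly_functional_sum[OF eps_functional[OF u]]) (rule homogeneousD(1)[OF hom])
    also have "\<dots> = (\<Sum>w\<in>W. if w = u then eps u f else 0)"
    proof (rule sum.cong[OF HOL.refl])
      fix w assume w: "w \<in> W"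
      have "eps u ((\<lambda>_. eps w f / kappa) * \<SS> w) = eps w f / kappa * eps u (\<SS> w)"
        by (rule poly_functionalD(2)[OF eps_functional[OF u] schubert_poly_fun[OF w]])
      then show "eps u ((\<lambda>_. eps w f / kappa) * \<SS> w) = (if w = u then eps u f else 0)"
        using eps_schubert[OF u w] kappa_nonzero by auto
    qed
    also have "\<dots> = eps u f" using u finite_W by simp
    finally have eq: "eps u ?S = eps u f" .
    have "?S \<in> poly_fun" by (rule poly_fun_sum) (rule homogeneousD(1)[OF hom])
    from poly_functional_diff[OF eps_functional[OF u] pf this]
    show ?thesis unfolding eq by (simp only: diff_self)
  qed
  ultimately show ?case by (rule homogeneous_in_ideal)
next
  case (add f g)
  let ?S = "\<lambda>f. \<Sum>w\<in>W. (\<lambda>_. eps w f / kappa) * \<SS> w"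
  have "?S (f + g) = ?S f + ?S g"
    unfolding sum.distrib[symmetric]
  proof (rule sum.cong[OF HOL.refl])
    fix w assume "w \<in> W"
    from poly_functionalD(1)[OF eps_functional[OF this] add(1,2)]
    have e: "eps w (f + g) = eps w f + eps w g" .
    show "(\<lambda>_. eps w (f + g) / kappa) * \<SS> w =
        (\<lambda>_. eps w f / kappa) * \<SS> w + (\<lambda>_. eps w g / kappa) * \<SS> w"
      unfolding e by (rule ext) (simp add: add_divide_distrib distrib_right)
  qed
  then have "f + g - ?S (f + g) = (f - ?S f) + (g - ?S g)" by (simp only: add_diff_add)
  also have "\<dots> \<in> ideal"
    using add(3,4) unfolding invariant_ideal_def by (rule ideal_generated_add)
  finally show ?case .
qed

end

section \<open>Dual polynomials and structure constants\<close>

lemma invariants_add: "f \<in> invariants \<Phi> \<Longrightarrow> g \<in> invariants \<Phi> \<Longrightarrow> f + g \<in> invariants \<Phi>"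
  unfolding invariants_def mem_Collect_eq act_simps by (intro conjI poly_fun_add ballI) simp_all

lemma invariants_mult: "f \<in> invariants \<Phi> \<Longrightarrow> g \<in> invariants \<Phi> \<Longrightarrow> f * g \<in> invariants \<Phi>"
  unfolding invariants_def mem_Collect_eq act_simps by (intro conjI poly_fun_mult ballI) simp_all

lemma invariants_const: "(\<lambda>_. c) \<in> invariants \<Phi>"
  unfolding invariants_def mem_Collect_eq act_simps by simp

lemma invariants_poly_fun: "f \<in> invariants \<Phi> \<Longrightarrow> f \<in> poly_fun"
  by (simp add: invariants_def)

context based_root_system
begin

text \<open>The \<open>eps w\<close> span the functionals that vanish on the ideal. This is applied
  to \<open>g \<mapsto> eps w (f * g)\<close> and to the pairing with a harmonic polynomial.\<close>

lemma functional_expansion: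
  assumes \<delta>: "poly_functional \<delta>" and ideal0: "\<And>h. h \<in> ideal \<Longrightarrow> \<delta> h = 0" and f: "f \<in> poly_fun"
  shows "\<delta> f = (\<Sum>w\<in>W. eps w f / kappa * \<delta> (\<SS> w))"
proof -
  let ?S = "\<Sum>w\<in>W. (\<lambda>_. eps w f / kappa) * \<SS> w"
  have p: "(\<lambda>_. eps w f / kappa) * \<SS> w \<in> poly_fun" if "w \<in> W" for w
    by (rule poly_fun_mult[OF poly_fun_const schubert_poly_fun[OF that]])
  have "\<delta> f - \<delta> ?S = 0"
    using poly_functional_diff[OF \<delta> f poly_fun_sum, of W "\<lambda>w. (\<lambda>_. eps w f / kappa) * \<SS> w"]
      p ideal0[OF schubert_expansion[OF f]] by simp
  moreover have "\<delta> ?S = (\<Sum>w\<in>W. \<delta> ((\<lambda>_. eps w f / kappa) * \<SS> w))"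
    by (rule poly_functional_sum[OF \<delta> p])
  moreover have "\<delta> ((\<lambda>_. eps w f / kappa) * \<SS> w) = eps w f / kappa * \<delta> (\<SS> w)"
    if "w \<in> W" for w
    by (rule poly_functionalD(2)[OF \<delta> schubert_poly_fun[OF that]])
  ultimately show ?thesis by simp
qed

lemma eps_mult_functional:
  assumes w: "w \<in> W" and f: "f \<in> poly_fun"
  shows "poly_functional (\<lambda>g. eps w (f * g))"
  unfolding poly_functional_def
proof (intro conjI ballI allI)
  fix g h :: "'a cfun" assume "g \<in> poly_fun" "h \<in> poly_fun"
  then show "eps w (f * (g + h)) = eps w (f * g) + eps w (f * h)"
    unfolding distrib_left by (intro poly_functionalD(1)[OF eps_functional[OF w]] poly_fun_mult f)
next
  fix g :: "'a cfun" and c assume "g \<in> poly_fun"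
  then show "eps w (f * ((\<lambda>_. c) * g)) = c * eps w (f * g)"
    unfolding mult.left_commute[of f] by (intro poly_functionalD(2)[OF eps_functional[OF w]] poly_fun_mult f)
qed

lemma eps_mult_expansion:
  assumes w: "w \<in> W" and f: "f \<in> poly_fun" and g: "g \<in> poly_fun"
  shows "eps w (f * g) = (\<Sum>u\<in>W. eps u g / kappa * eps w (f * \<SS> u))"
proof (rule functional_expansion[OF eps_mult_functional[OF w f] _ g])
  fix h assume "h \<in> ideal"
  then have "f * h \<in> ideal" unfolding invariant_ideal_def by (rule ideal_generated_mult[OF _ f])
  then show "eps w (f * h) = 0" by (rule eps_ideal[OF w])
qed

text \<open>The functional \<open>eps w / kappa\<close> is concentrated in one degree, hence
  represented by some \<open>P\<close>, which is harmonic because \<open>eps w\<close> kills the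
  ideal. A competitor pairs equally with all polynomials by \<open>functional_expansion\<close>, so
  nondegeneracy identifies it with \<open>P\<close>.\<close>

lemma dual_poly:
  assumes w: "w \<in> W"
  shows "dual_poly \<Psi> \<Omega> w \<in> poly_fun"
    and "f \<in> poly_fun \<Longrightarrow> theta_form (dual_poly \<Psi> \<Omega> w) f = eps w f / kappa"
proof -
  have func: "poly_functional (\<lambda>f. eps w f / kappa)"
    using poly_functionalD[OF eps_functional[OF w]]
    unfolding poly_functional_def by (simp add: add_divide_distrib)
  have "\<exists>P\<in>poly_fun. \<forall>f\<in>poly_fun. theta_form P f = eps w f / kappa"
    by (rule graded_functional_representation[OF func, of "card (inversions w)"])
      (simp add: eps_degree[OF w])
  then obtain P where P1: "P \<in> poly_fun" and P2: "\<forall>f\<in>poly_fun. theta_form P f = eps w f / kappa"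
    by (rule bexE)
  note P = P1 bspec[OF P2]
  have "dual_poly \<Psi> \<Omega> w = P"
    unfolding dual_poly_def
  proof (rule the_equality)
    have "theta_form f P = 0" if "f \<in> ideal" for f
      using theta_form_commute[OF ideal_poly_fun[OF that] P(1)] P(2)[OF ideal_poly_fun[OF that]]
        eps_ideal[OF w that] by simp
    moreover have "theta_form P (\<SS> u) = (if w = u then 1 else 0)" if "u \<in> W" for u
      using P(2)[OF schubert_poly_fun[OF that]] eps_schubert[OF w that] kappa_nonzero by simp
    ultimately show "P \<in> harmonics \<Psi> \<and> (\<forall>\<tau>\<in>W. theta_form P (\<SS> \<tau>) = (if w = \<tau> then 1 else 0))"
      unfolding harmonics_def using P(1) by blast
  next
    fix p assume p: "p \<in> harmonics \<Psi> \<and> (\<forall>\<tau>\<in>W. theta_form p (\<SS> \<tau>) = (if w = \<tau> then 1 else 0))"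
    then have pp: "p \<in> poly_fun" by (simp add: harmonics_def)
    have p0: "theta_form p h = 0" if "h \<in> ideal" for h
      using theta_form_commute[OF pp ideal_poly_fun[OF that]] p that by (simp add: harmonics_def)
    have eq: "theta_form p f = theta_form P f" if f: "f \<in> poly_fun" for f
    proof -
      have "theta_form p f = (\<Sum>u\<in>W. eps u f / kappa * theta_form p (\<SS> u))"
        by (rule functional_expansion[OF poly_functional_theta_form[OF pp] p0 f])
      also have "\<dots> = (\<Sum>u\<in>W. if u = w then eps w f / kappa else 0)"
        using p by (intro sum.cong[OF HOL.refl]) auto
      also have "\<dots> = eps w f / kappa" using w finite_W by simp
      finally show ?thesis using P(2)[OF f] by simp
    qed
    have "theta_form (p + (\<lambda>_. - 1) * P) f = 0" if f: "f \<in> poly_fun" for f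
      unfolding theta_form_add_left[OF pp poly_fun_mult[OF poly_fun_const P(1)] f]
        theta_form_scale_left[OF P(1) f] eq[OF f] by simp
    from theta_form_nondegenerate[OF poly_fun_add[OF pp poly_fun_mult[OF poly_fun_const P(1)]] this]
    have "p + (\<lambda>_. - 1) * P = 0" .
    then show "p = P" by (simp add: fun_eq_iff)
  qed
  then show "dual_poly \<Psi> \<Omega> w \<in> poly_fun" "f \<in> poly_fun \<Longrightarrow> theta_form (dual_poly \<Psi> \<Omega> w) f = eps w f / kappa"
    using P by simp_all
qed

text \<open>Applying \<open>eps w\<close> to the defining congruence removes the ideal and isolates
  the coefficient at \<open>w\<close>, which gives uniqueness as well.\<close>

lemma struct_const_eq:
  assumes u: "u \<in> W" and v: "v \<in> W" and w: "w \<in> W"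
  shows "struct_const \<Psi> \<Omega> u v w = eps w (\<SS> u * \<SS> v) / kappa"
proof -
  let ?f = "\<SS> u * \<SS> v"
  have f: "?f \<in> poly_fun" by (rule poly_fun_mult[OF schubert_poly_fun[OF u] schubert_poly_fun[OF v]])
  let ?c = "\<lambda>w. if w \<in> W then eps w ?f / kappa else 0"
  have "struct_const \<Psi> \<Omega> u v = ?c"
    unfolding struct_const_def
  proof (rule the_equality)
    have "(\<Sum>\<rho>\<in>W. (\<lambda>_. ?c \<rho>) * \<SS> \<rho>) = (\<Sum>w\<in>W. (\<lambda>_. eps w ?f / kappa) * \<SS> w)"
      by (rule sum.cong) simp_all
    then show "(\<forall>\<rho>. \<rho> \<notin> W \<longrightarrow> ?c \<rho> = 0) \<and>
        ?f - (\<Sum>\<rho>\<in>W. (\<lambda>_. ?c \<rho>) * \<SS> \<rho>) \<in> ideal"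
      using schubert_expansion[OF f] by simp
  next
    fix c assume c: "(\<forall>\<rho>. \<rho> \<notin> W \<longrightarrow> c \<rho> = 0) \<and> ?f - (\<Sum>\<rho>\<in>W. (\<lambda>_. c \<rho>) * \<SS> \<rho>) \<in> ideal"
    have "c w = ?c w" for w
    proof (cases "w \<in> W")
      case True
      have p: "(\<lambda>_. c \<rho>) * \<SS> \<rho> \<in> poly_fun" if "\<rho> \<in> W" for \<rho>
        by (rule poly_fun_mult[OF poly_fun_const schubert_poly_fun[OF that]])
      have "eps w (\<Sum>\<rho>\<in>W. (\<lambda>_. c \<rho>) * \<SS> \<rho>) = (\<Sum>\<rho>\<in>W. eps w ((\<lambda>_. c \<rho>) * \<SS> \<rho>))"
        by (rule poly_functional_sum[OF eps_functional[OF True] p])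
      also have "\<dots> = (\<Sum>\<rho>\<in>W. if \<rho> = w then c w * kappa else 0)"
      proof (rule sum.cong[OF HOL.refl])
        fix \<rho> assume \<rho>: "\<rho> \<in> W"
        have "eps w ((\<lambda>_. c \<rho>) * \<SS> \<rho>) = c \<rho> * eps w (\<SS> \<rho>)"
          by (rule poly_functionalD(2)[OF eps_functional[OF True] schubert_poly_fun[OF \<rho>]])
        then show "eps w ((\<lambda>_. c \<rho>) * \<SS> \<rho>) = (if \<rho> = w then c w * kappa else 0)"
          using eps_schubert[OF True \<rho>] by auto
      qed
      also have "\<dots> = c w * kappa" using True finite_W by simp
      finally have 1: "eps w (\<Sum>\<rho>\<in>W. (\<lambda>_. c \<rho>) * \<SS> \<rho>) = c w * kappa" .
      have "(\<Sum>\<rho>\<in>W. (\<lambda>_. c \<rho>) * \<SS> \<rho>) \<in> poly_fun" by (rule poly_fun_sum[OF p])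
      from poly_functional_diff[OF eps_functional[OF True] f this]
      have "eps w ?f = c w * kappa" using 1 eps_ideal[OF True conjunct2[OF c]] by simp
      then show ?thesis using True kappa_nonzero by simp
    next
      case False
      then show ?thesis using c by simp
    qed
    then show "c = ?c" by (rule ext)
  qed
  then show ?thesis using w by simp
qed

lemma PS_at_eq:
  assumes "w \<in> W" "f \<in> poly_fun"
  shows "PS_at \<Psi> \<Omega> v w f = eps w (translate v f) / kappa"
  using dual_poly(2)[OF assms(1) translate_poly_fun[OF assms(2)]]
  by (simp add: PS_at_def PS_op_def theta_form_def)

text \<open>The defining sum over the structure constants is \<open>eps_mult_expansion\<close> for
  the factor \<open>\<SS> u\<close>, read from right to left.\<close>

lemma PS_skew_at_eq:
  assumes u: "u \<in> W" and w: "w \<in> W" and f: "f \<in> poly_fun"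
  shows "\<DD> v u w f = eps w (translate v f * \<SS> u) / kappa"
proof -
  have tf: "translate v f \<in> poly_fun" by (rule translate_poly_fun[OF f])
  have "\<DD> v u w f =
      (\<Sum>\<rho>\<in>W. struct_const \<Psi> \<Omega> u \<rho> w * theta_form (dual_poly \<Psi> \<Omega> \<rho>) (translate v f))"
    by (simp add: PS_skew_at_def PS_skew_op_def PS_op_def theta_form_def sum_fun_apply)
  \<comment> \<open>Two factors \<open>1 / kappa\<close> occur, one from the structure constant and
    one from the dual polynomial; the expansion absorbs one of them.\<close>
  also have "\<dots> = (\<Sum>\<rho>\<in>W. eps \<rho> (translate v f) / kappa * eps w (\<SS> u * \<SS> \<rho>)) / kappa"
    unfolding sum_divide_distrib
    by (rule sum.cong[OF HOL.refl]) (simp add: struct_const_eq[OF u _ w] dual_poly(2)[OF _ tf])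
  also have "\<dots> = eps w (\<SS> u * translate v f) / kappa"
    unfolding eps_mult_expansion[OF w schubert_poly_fun[OF u] tf] ..
  finally show ?thesis by (simp only: mult.commute[of "\<SS> u"])
qed

lemma eps_mult_schubert:
  assumes w: "w \<in> W" and u: "u \<in> W" and f: "f \<in> poly_fun" and not_less: "\<not> u \<sqsubset> w"
  shows "eps w (f * \<SS> u) = (if u = w then f 0 * kappa else 0)"
proof -
  have "eps x (\<SS> u) = 0" if "x \<in> W" "x \<sqsubset> w" for x
    using eps_schubert[OF that(1) u] that(2) not_less by auto
  then have "eps w (f * \<SS> u) = f 0 * eps w (\<SS> u)"
    by (rule eps_mult_lower[OF f w schubert_poly_fun[OF u]])
  then show ?thesis using eps_schubert[OF w u] by auto
qed

text \<open>Proved for all polynomials, before restricting to the invariants of the larger group.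
  The first form is enough for the closure of the span; the second uses the triangularity of the
  skew functionals.\<close>

lemma PS_at_mult:
  assumes w: "w \<in> W" and f: "f \<in> poly_fun" and g: "g \<in> poly_fun"
  shows "PS_at \<Psi> \<Omega> v w (f * g) = (\<Sum>u\<in>W. \<DD> v u w f * PS_at \<Psi> \<Omega> v u g)"
    and "PS_at \<Psi> \<Omega> v w (f * g) = f v * PS_at \<Psi> \<Omega> v w g +
      (\<Sum>u | u \<in> W \<and> u \<sqsubset> w. \<DD> v u w f * PS_at \<Psi> \<Omega> v u g)"
proof -
  have tf: "translate v f \<in> poly_fun" and tg: "translate v g \<in> poly_fun"
    using translate_poly_fun f g by blast+
  let ?t = "\<lambda>u. \<DD> v u w f * PS_at \<Psi> \<Omega> v u g"
  have "PS_at \<Psi> \<Omega> v w (f * g) = eps w (translate v f * translate v g) / kappa"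
    unfolding PS_at_eq[OF w poly_fun_mult[OF f g]] translate_simps ..
  also have "\<dots> = (\<Sum>u\<in>W. ?t u)"
    unfolding eps_mult_expansion[OF w tf tg] sum_divide_distrib
    by (rule sum.cong[OF HOL.refl]) (simp add: PS_skew_at_eq[OF _ w f] PS_at_eq[OF _ g])
  finally show eq: "PS_at \<Psi> \<Omega> v w (f * g) = (\<Sum>u\<in>W. ?t u)" .
  have not_less: "\<not> w \<sqsubset> w" using bruhat_less_len by blast
  let ?B = "{u. u \<in> W \<and> u \<sqsubset> w}"
  have "(\<Sum>u\<in>W. ?t u) = (\<Sum>u\<in>insert w ?B. ?t u)"
  proof (rule sum.mono_neutral_right[OF finite_W])
    show "\<forall>u\<in>W - insert w ?B. ?t u = 0"
      using eps_mult_schubert[OF w _ tf] PS_skew_at_eq[OF _ w f] by auto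
  qed (use w in auto)
  also have "\<dots> = ?t w + (\<Sum>u\<in>?B. ?t u)"
    using finite_W not_less by (intro sum.insert) auto
  also have "?t w = f v * PS_at \<Psi> \<Omega> v w g"
    using PS_skew_at_eq[OF w w f] eps_mult_schubert[OF w w tf not_less] kappa_nonzero
    by (simp add: translate_def)
  finally show "PS_at \<Psi> \<Omega> v w (f * g) = f v * PS_at \<Psi> \<Omega> v w g + (\<Sum>u\<in>?B. ?t u)"
    using eq by simp
qed

section \<open>The span as a module over the invariants\<close>

lemma PS_space_iff:
  "\<xi> \<in> PS_space \<Phi> \<Psi> \<Omega> v \<longleftrightarrow> (\<exists>a. \<forall>g. \<xi> g = (\<Sum>w\<in>W. a w * PS \<Phi> v w g))"
  unfolding PS_space_def by (simp add: fun_eq_iff[of \<xi>] sum_fun_apply)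

lemma PS_fun_functional:
  assumes w: "w \<in> W" and f: "f \<in> invariants \<Phi>" and g: "g \<in> invariants \<Phi>"
  shows "PS \<Phi> v w (f + g) = PS \<Phi> v w f + PS \<Phi> v w g"
    and "PS \<Phi> v w ((\<lambda>_. c) * f) = c * PS \<Phi> v w f"
proof -
  have pf: "f \<in> poly_fun" "g \<in> poly_fun" using f g invariants_poly_fun by blast+
  have eq: "PS \<Phi> v w h = eps w (translate v h) / kappa" if "h \<in> invariants \<Phi>" for h
    unfolding PS_fun_def using that PS_at_eq[OF w invariants_poly_fun[OF that]] by simp
  show "PS \<Phi> v w (f + g) = PS \<Phi> v w f + PS \<Phi> v w g"
    unfolding eq[OF f] eq[OF g] eq[OF invariants_add[OF f g]] translate_simps
      poly_functionalD(1)[OF eps_functional[OF w] pf[THEN translate_poly_fun]]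
    by (rule add_divide_distrib)
  show "PS \<Phi> v w ((\<lambda>_. c) * f) = c * PS \<Phi> v w f"
    unfolding eq[OF f] eq[OF invariants_mult[OF invariants_const f]] translate_simps
      poly_functionalD(2)[OF eps_functional[OF w] translate_poly_fun[OF pf(1)]]
    by simp
qed

lemma PS_space_submodule: "is_inv_submodule \<Phi> (PS_space \<Phi> \<Psi> \<Omega> v)"
  unfolding is_inv_submodule_def
proof (intro conjI ballI subsetI)
  fix \<xi> assume "\<xi> \<in> PS_space \<Phi> \<Psi> \<Omega> v"
  then obtain a where a: "\<And>g. \<xi> g = (\<Sum>w\<in>W. a w * PS \<Phi> v w g)" unfolding PS_space_iff by blast
  have "\<xi> (f + g) = \<xi> f + \<xi> g" if "f \<in> invariants \<Phi>" "g \<in> invariants \<Phi>" for f g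
    unfolding a sum.distrib[symmetric]
    by (rule sum.cong[OF HOL.refl]) (simp only: PS_fun_functional(1)[OF _ that] distrib_left)
  moreover have "\<xi> ((\<lambda>_. c) * f) = c * \<xi> f" if "f \<in> invariants \<Phi>" for f c
    unfolding a sum_distrib_left
    by (rule sum.cong[OF HOL.refl]) (simp only: PS_fun_functional(2)[OF _ that that] mult.left_commute)
  moreover have "\<xi> f = 0" if "f \<notin> invariants \<Phi>" for f
    unfolding a using that by (simp add: PS_fun_def)
  ultimately show "\<xi> \<in> inv_dual \<Phi>" unfolding inv_dual_def by blast
next
  show "0 \<in> PS_space \<Phi> \<Psi> \<Omega> v"
    unfolding PS_space_iff by (rule exI[of _ "\<lambda>_. 0"]) simp
next
  fix \<xi> \<eta> assume "\<xi> \<in> PS_space \<Phi> \<Psi> \<Omega> v" "\<eta> \<in> PS_space \<Phi> \<Psi> \<Omega> v"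
  then obtain a b where "\<And>g. \<xi> g = (\<Sum>w\<in>W. a w * PS \<Phi> v w g)"
    "\<And>g. \<eta> g = (\<Sum>w\<in>W. b w * PS \<Phi> v w g)" unfolding PS_space_iff by blast
  then show "\<xi> + \<eta> \<in> PS_space \<Phi> \<Psi> \<Omega> v"
    unfolding PS_space_iff by (intro exI[of _ "\<lambda>w. a w + b w"]) (simp add: distrib_right sum.distrib)
next
  fix \<gamma> \<xi> assume \<gamma>: "\<gamma> \<in> invariants \<Phi>" and "\<xi> \<in> PS_space \<Phi> \<Psi> \<Omega> v"
  then obtain a where a: "\<And>g. \<xi> g = (\<Sum>w\<in>W. a w * PS \<Phi> v w g)" unfolding PS_space_iff by blast
  \<comment> \<open>On coefficient vectors \<open>\<gamma>\<close> acts by the matrix with entries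
    \<open>\<DD> v u w \<gamma>\<close>, with \<open>u\<close> as row index and \<open>w\<close> as
    column index.\<close>
  have "dual_act \<Phi> \<gamma> \<xi> g = (\<Sum>u\<in>W. (\<Sum>w\<in>W. a w * \<DD> v u w \<gamma>) * PS \<Phi> v u g)" for g
  proof (cases "g \<in> invariants \<Phi>")
    case True
    have pf: "\<gamma> \<in> poly_fun" "g \<in> poly_fun" using \<gamma> True invariants_poly_fun by blast+
    have "dual_act \<Phi> \<gamma> \<xi> g = (\<Sum>w\<in>W. a w * PS_at \<Psi> \<Omega> v w (\<gamma> * g))"
      using True invariants_mult[OF \<gamma> True] by (simp add: dual_act_def a PS_fun_def)
    also have "\<dots> = (\<Sum>w\<in>W. \<Sum>u\<in>W. a w * \<DD> v u w \<gamma> * PS \<Phi> v u g)"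
      using True by (intro sum.cong[OF HOL.refl])
        (simp add: PS_at_mult(1)[OF _ pf] PS_fun_def sum_distrib_left mult.assoc)
    also have "\<dots> = (\<Sum>u\<in>W. \<Sum>w\<in>W. a w * \<DD> v u w \<gamma> * PS \<Phi> v u g)"
      by (rule sum.swap)
    finally show ?thesis by (simp add: sum_distrib_right)
  qed (simp add: dual_act_def PS_fun_def)
  then show "dual_act \<Phi> \<gamma> \<xi> \<in> PS_space \<Phi> \<Psi> \<Omega> v"
    unfolding PS_space_iff
    by (intro exI[of _ "\<lambda>u. \<Sum>w\<in>W. a w * \<DD> v u w \<gamma>"] allI)
qed

lemma dual_act_PS_fun:
  assumes \<gamma>: "\<gamma> \<in> invariants \<Phi>" and w: "w \<in> W"
  shows "dual_act \<Phi> \<gamma> (PS \<Phi> v w) = (\<lambda>_. \<gamma> v) * PS \<Phi> v w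
    + (\<Sum>u | u \<in> W \<and> u \<sqsubset> w. (\<lambda>_. \<DD> v u w \<gamma>) * PS \<Phi> v u)"
proof
  fix g
  show "dual_act \<Phi> \<gamma> (PS \<Phi> v w) g = ((\<lambda>_. \<gamma> v) * PS \<Phi> v w
    + (\<Sum>u | u \<in> W \<and> u \<sqsubset> w. (\<lambda>_. \<DD> v u w \<gamma>) * PS \<Phi> v u)) g"
  proof (cases "g \<in> invariants \<Phi>")
    case True
    have pf: "\<gamma> \<in> poly_fun" "g \<in> poly_fun" using \<gamma> True invariants_poly_fun by blast+
    have "dual_act \<Phi> \<gamma> (PS \<Phi> v w) g = PS_at \<Psi> \<Omega> v w (\<gamma> * g)"
      using True invariants_mult[OF \<gamma> True] by (simp add: dual_act_def PS_fun_def)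
    then show ?thesis
      using True unfolding PS_at_mult(2)[OF w pf] by (simp add: PS_fun_def sum_fun_apply)
  qed (simp add: dual_act_def PS_fun_def sum_fun_apply)
qed

end

theorem theorem6p2:
  fixes \<Phi> \<Psi> \<Omega> :: "'a::real_inner set" and v :: "'a cplx"
  assumes "finite_dimensional TYPE('a)"
    and "root_system \<Phi>"
    and "root_system \<Psi>" and "\<Psi> \<subseteq> \<Phi>"
    and "is_base \<Psi> \<Omega>"
  shows "is_inv_submodule \<Phi> (PS_space \<Phi> \<Psi> \<Omega> v) \<and>
    (\<forall>\<gamma>\<in>invariants \<Phi>. \<forall>\<sigma>\<in>weyl_group \<Psi>.
       dual_act \<Phi> \<gamma> (PS_fun \<Phi> \<Psi> \<Omega> v \<sigma>) =
         (\<lambda>_. \<gamma> v) * PS_fun \<Phi> \<Psi> \<Omega> v \<sigma>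
         + (\<Sum>\<tau> | \<tau> \<in> weyl_group \<Psi> \<and> bruhat_less \<Psi> \<Omega> \<tau> \<sigma>.
              (\<lambda>_. PS_skew_at \<Psi> \<Omega> v \<tau> \<sigma> \<gamma>) * PS_fun \<Phi> \<Psi> \<Omega> v \<tau>))"
proof -
  interpret based_root_system \<Psi> \<Omega> by unfold_locales (fact assms)+
  show ?thesis using PS_space_submodule dual_act_PS_fun by blast
qed

end
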